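(* Let $(M,\nabla,\langle\cdot,\cdot\rangle)$ be an affine-Riemann manifold of dimension $n$. Then its canonical Hermitian structure $(TM,J_1,g_1)$ is pluriclosed if and only if, for any affine coordinates $(x_1,\dots,x_n)$, $$\frac{\partial^2\mu_{ik}}{\partial x_j\partial x_h}+\frac{\partial^2\mu_{jh}}{\partial x_i\partial x_k}=\frac{\partial^2\mu_{jk}}{\partial x_i\partial x_h}+\frac{\partial^2\mu_{ih}}{\partial x_j\partial x_k}$$ for all $1\le i<j\le n$ and $1\le k<h\le n$, where $\mu_{ij}=\langle\partial_{x_i},\partial_{x_j}\rangle$. When $\dim M=2$, this condition reduces to $$\frac{\partial^2\mu_{11}}{\partial x_2^2}+\frac{\partial^2\mu_{22}}{\partial x_1^2}=2\frac{\partial^2\mu_{12}}{\partial x_1\partial x_2}.$$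
   Context: An affine-Riemann manifold $(M,\nabla,\langle\cdot,\cdot\rangle)$ is a manifold with a flat torsionless connection $\nabla$ and a Riemannian metric. Affine coordinates are local coordinates $(x_1,\dots,x_n)$ with $\nabla_{\partial_{x_i}}\partial_{x_j}=0$ for all $i,j$ (they exist near every point). Canonical Hermitian structure: $\pi_1:TM\to M$ is the projection; for a vector field $X$ on $M$, $X^h$ is the horizontal lift with respect to $\nabla$ and $X^v$ the vertical lift; $J_1X^h=X^v$, $J_1X^v=-X^h$; $g_1(X^h,Y^h)=g_1(X^v,Y^v)=\langle X,Y\rangle\circ\pi_1$, $g_1(X^h,Y^v)=0$. A Hermitian manifold $(N,J,g)$ with fundamental form $\omega=g(J\cdot,\cdot)$ is pluriclosed if $dd^c\omega=0$, equivalently $d(J\,d\omega)=0$ where $(J\eta)(X_1,\dots,X_p)=(-1)^p\eta(JX_1,\dots,JX_p)$. *)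

theory Defs
  imports "HOL-Analysis.Analysis"
begin

section \<open>Smooth manifolds\<close>

primrec Ck_on ::
  "nat \<Rightarrow> 'e::euclidean_space set \<Rightarrow> ('e \<Rightarrow> 'f::real_normed_vector) \<Rightarrow> bool" where
  "Ck_on 0 S f \<longleftrightarrow> continuous_on S f"
| "Ck_on (Suc k) S f \<longleftrightarrow>
     (\<forall>x\<in>S. f differentiable (at x)) \<and>
     (\<forall>v. Ck_on k S (\<lambda>x. frechet_derivative f (at x) v))"

text \<open>Intended for open \<open>S\<close> only.\<close>

definition smooth_on ::
  "'e::euclidean_space set \<Rightarrow> ('e \<Rightarrow> 'f::real_normed_vector) \<Rightarrow> bool" where
  "smooth_on S f \<longleftrightarrow> (\<forall>k. Ck_on k S f)"

text \<open>A chart is a pair of its domain and its coordinate map; only the values of the coordinate map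
  on the domain are meaningful.\<close>

type_synonym ('a, 'e) chart = "'a set \<times> ('a \<Rightarrow> 'e)"

definition is_chart :: "('a, 'e::euclidean_space) chart \<Rightarrow> bool" where
  "is_chart c \<longleftrightarrow> inj_on (snd c) (fst c) \<and> open (snd c ` fst c)"

definition compatible ::
  "('a, 'e::euclidean_space) chart \<Rightarrow> ('a, 'e) chart \<Rightarrow> bool" where
  "compatible c d \<longleftrightarrow>
     open (snd c ` (fst c \<inter> fst d)) \<and>
     open (snd d ` (fst c \<inter> fst d)) \<and>
     smooth_on (snd c ` (fst c \<inter> fst d)) (snd d \<circ> inv_into (fst c) (snd c)) \<and>
     smooth_on (snd d ` (fst c \<inter> fst d)) (snd c \<circ> inv_into (fst d) (snd d))"

definition smooth_atlas :: "('a, 'e::euclidean_space) chart set \<Rightarrow> bool" where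
  "smooth_atlas A \<longleftrightarrow> (\<forall>c\<in>A. is_chart c) \<and> (\<forall>c\<in>A. \<forall>d\<in>A. compatible c d)"

text \<open>A manifold is given by an atlas: its underlying set is the union of the chart domains, and its
  topology is the one for which all charts are homeomorphisms onto open sets.\<close>

definition points :: "('a, 'e::euclidean_space) chart set \<Rightarrow> 'a set" where
  "points A = (\<Union>c\<in>A. fst c)"

definition mopen :: "('a, 'e::euclidean_space) chart set \<Rightarrow> 'a set \<Rightarrow> bool" where
  "mopen A U \<longleftrightarrow> U \<subseteq> points A \<and> (\<forall>c\<in>A. open (snd c ` (U \<inter> fst c)))"

lemma istopology_mopen:
  assumes "smooth_atlas A"
  shows "istopology (mopen A)"
  unfolding istopology_def
proof (intro conjI allI impI)
  fix S T assume S: "mopen A S" and T: "mopen A T"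
  have "open (snd c ` (S \<inter> T \<inter> fst c))" if c: "c \<in> A" for c
  proof -
    have inj: "inj_on (snd c) (fst c)"
      using assms c by (auto simp: smooth_atlas_def is_chart_def)
    have "snd c ` (S \<inter> T \<inter> fst c) = snd c ` ((S \<inter> fst c) \<inter> (T \<inter> fst c))"
      by (rule arg_cong[where f = "image (snd c)"]) blast
    also have "\<dots> = snd c ` (S \<inter> fst c) \<inter> snd c ` (T \<inter> fst c)"
      by (rule inj_on_image_Int[OF inj]) auto
    finally show ?thesis
      using S T c by (simp add: mopen_def open_Int)
  qed
  then show "mopen A (S \<inter> T)"
    using S by (auto simp: mopen_def)
next
  fix K assume K: "\<forall>S\<in>K. mopen A S"
  have "open (snd c ` (\<Union>K \<inter> fst c))" if c: "c \<in> A" for c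
  proof -
    have "snd c ` (\<Union>K \<inter> fst c) = (\<Union>S\<in>K. snd c ` (S \<inter> fst c))"
      by blast
    moreover have "open (\<Union>S\<in>K. snd c ` (S \<inter> fst c))"
      using K c by (intro open_UN) (auto simp: mopen_def)
    ultimately show ?thesis
      by simp
  qed
  then show "mopen A (\<Union>K)"
    using K by (auto simp: mopen_def)
qed

definition smooth_manifold :: "('a, 'e::euclidean_space) chart set \<Rightarrow> bool" where
  "smooth_manifold A \<longleftrightarrow>
     smooth_atlas A \<and>
     Hausdorff_space (topology (mopen A)) \<and>
     second_countable (topology (mopen A))"

definition maximal_atlas ::
  "('a, 'e::euclidean_space) chart set \<Rightarrow> ('a, 'e) chart set" where
  "maximal_atlas A = {c. fst c \<subseteq> points A \<and> is_chart c \<and> (\<forall>d\<in>A. compatible c d)}"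

definition smooth_fun ::
  "('a, 'e::euclidean_space) chart set \<Rightarrow> 'a set \<Rightarrow> ('a \<Rightarrow> real) \<Rightarrow> bool" where
  "smooth_fun A U f \<longleftrightarrow>
     (\<forall>c\<in>A. smooth_on (snd c ` (U \<inter> fst c)) (f \<circ> inv_into (fst c) (snd c)))"

definition smooth_near ::
  "('a, 'e::euclidean_space) chart set \<Rightarrow> 'a \<Rightarrow> ('a \<Rightarrow> real) \<Rightarrow> bool" where
  "smooth_near A p f \<longleftrightarrow> (\<exists>U. mopen A U \<and> p \<in> U \<and> smooth_fun A U f)"


section \<open>Tangent vectors and vector fields\<close>

text \<open>A tangent vector at \<open>p\<close> is a directional derivative acting on the functions that are smooth
  near \<open>p\<close>; it is extended by \<open>0\<close> to all other functions, so that equality of tangent vectors is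
  equality in HOL. Vector space operations on tangent vectors are pointwise.\<close>

type_synonym 'a tvec = "('a \<Rightarrow> real) \<Rightarrow> real"
type_synonym 'a vfield = "'a \<Rightarrow> 'a tvec"

definition dir_deriv ::
  "('a, 'e::euclidean_space) chart set \<Rightarrow> ('a, 'e) chart \<Rightarrow> 'e \<Rightarrow> 'a vfield" where
  "dir_deriv A c u p f =
     (if smooth_near A p f
      then frechet_derivative (f \<circ> inv_into (fst c) (snd c)) (at (snd c p)) u
      else 0)"

definition tangent_space ::
  "('a, 'e::euclidean_space) chart set \<Rightarrow> 'a \<Rightarrow> 'a tvec set" where
  "tangent_space A p = {dir_deriv A c u p |c u. c \<in> A \<and> p \<in> fst c}"

definition smooth_vfield ::
  "('a, 'e::euclidean_space) chart set \<Rightarrow> 'a set \<Rightarrow> 'a vfield \<Rightarrow> bool" where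
  "smooth_vfield A U X \<longleftrightarrow>
     (\<forall>p\<in>U. X p \<in> tangent_space A p) \<and>
     (\<forall>W f. mopen A W \<longrightarrow> W \<subseteq> U \<longrightarrow> smooth_fun A W f \<longrightarrow> smooth_fun A W (\<lambda>p. X p f))"

definition bracket ::
  "('a, 'e::euclidean_space) chart set \<Rightarrow> 'a vfield \<Rightarrow> 'a vfield \<Rightarrow> 'a vfield" where
  "bracket A X Y p f =
     (if smooth_near A p f then X p (\<lambda>q. Y q f) - Y p (\<lambda>q. X q f) else 0)"


section \<open>Affine-Riemann manifolds\<close>

text \<open>A connection is given by the covariant derivatives \<open>nab p v Y\<close>, standing for \<open>\<nabla>\<^sub>v Y\<close>, of locally
  defined vector fields \<open>Y\<close> along tangent vectors \<open>v\<close> at \<open>p\<close>.\<close>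

type_synonym 'a conn = "'a \<Rightarrow> 'a tvec \<Rightarrow> 'a vfield \<Rightarrow> 'a tvec"

definition cov :: "'a conn \<Rightarrow> 'a vfield \<Rightarrow> 'a vfield \<Rightarrow> 'a vfield" where
  "cov nab X Y = (\<lambda>p. nab p (X p) Y)"

definition connection ::
  "('a, 'e::euclidean_space) chart set \<Rightarrow> 'a conn \<Rightarrow> bool" where
  "connection A nab \<longleftrightarrow>
     (\<forall>U X Y. mopen A U \<longrightarrow> smooth_vfield A U X \<longrightarrow> smooth_vfield A U Y \<longrightarrow>
        smooth_vfield A U (cov nab X Y)) \<and>
     (\<forall>U Y p. mopen A U \<longrightarrow> smooth_vfield A U Y \<longrightarrow> p \<in> U \<longrightarrow>
        (\<forall>v\<in>tangent_space A p.
           nab p v Y \<in> tangent_space A p \<and>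
           (\<forall>w\<in>tangent_space A p. \<forall>a b.
              nab p (\<lambda>f. a * v f + b * w f) Y = (\<lambda>f. a * nab p v Y f + b * nab p w Y f)) \<and>
           (\<forall>Z. smooth_vfield A U Z \<longrightarrow>
              nab p v (\<lambda>q f. Y q f + Z q f) = (\<lambda>f. nab p v Y f + nab p v Z f)) \<and>
           (\<forall>k. smooth_fun A U k \<longrightarrow>
              nab p v (\<lambda>q f. k q * Y q f) = (\<lambda>f. v k * Y p f + k p * nab p v Y f)) \<and>
           (\<forall>Z. (\<forall>q\<in>U. Z q = Y q) \<longrightarrow> nab p v Z = nab p v Y)))"

definition torsionless ::
  "('a, 'e::euclidean_space) chart set \<Rightarrow> 'a conn \<Rightarrow> bool" where
  "torsionless A nab \<longleftrightarrow>
     (\<forall>U X Y. mopen A U \<longrightarrow> smooth_vfield A U X \<longrightarrow> smooth_vfield A U Y \<longrightarrow>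
        (\<forall>p\<in>U. \<forall>f. cov nab X Y p f - cov nab Y X p f - bracket A X Y p f = 0))"

definition flat ::
  "('a, 'e::euclidean_space) chart set \<Rightarrow> 'a conn \<Rightarrow> bool" where
  "flat A nab \<longleftrightarrow>
     (\<forall>U X Y Z. mopen A U \<longrightarrow>
        smooth_vfield A U X \<longrightarrow> smooth_vfield A U Y \<longrightarrow> smooth_vfield A U Z \<longrightarrow>
        (\<forall>p\<in>U. \<forall>f.
           cov nab X (cov nab Y Z) p f - cov nab Y (cov nab X Z) p f
             - cov nab (bracket A X Y) Z p f = 0))"

type_synonym 'a metric_tensor = "'a \<Rightarrow> 'a tvec \<Rightarrow> 'a tvec \<Rightarrow> real"

definition riemannian_metric ::
  "('a, 'e::euclidean_space) chart set \<Rightarrow> 'a metric_tensor \<Rightarrow> bool" where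
  "riemannian_metric A g \<longleftrightarrow>
     (\<forall>p\<in>points A. \<forall>v\<in>tangent_space A p.
        (\<forall>w\<in>tangent_space A p.
           g p v w = g p w v \<and>
           (\<forall>z\<in>tangent_space A p. \<forall>a b.
              g p (\<lambda>f. a * v f + b * w f) z = a * g p v z + b * g p w z)) \<and>
        (v \<noteq> (\<lambda>f. 0) \<longrightarrow> g p v v > 0)) \<and>
     (\<forall>U X Y. mopen A U \<longrightarrow> smooth_vfield A U X \<longrightarrow> smooth_vfield A U Y \<longrightarrow>
        smooth_fun A U (\<lambda>p. g p (X p) (Y p)))"

definition affine_riemann ::
  "('a, 'e::euclidean_space) chart set \<Rightarrow> 'a conn \<Rightarrow> 'a metric_tensor \<Rightarrow> bool" where
  "affine_riemann A nab g \<longleftrightarrow>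
     smooth_manifold A \<and> connection A nab \<and> flat A nab \<and> torsionless A nab \<and>
     riemannian_metric A g"

text \<open>\<open>coord_field A c i\<close> is the local vector field \<open>\<partial>/\<partial>x\<^sub>i\<close> of the chart \<open>c\<close>, so
  \<open>coord_field A c i p f\<close> is the partial derivative of \<open>f\<close> at \<open>p\<close> for \<open>f\<close> smooth near \<open>p\<close>.\<close>

definition coord_field ::
  "('a, real^'n) chart set \<Rightarrow> ('a, real^'n) chart \<Rightarrow> 'n \<Rightarrow> 'a vfield" where
  "coord_field A c i = dir_deriv A c (axis i 1)"

definition affine_coordinates ::
  "('a, real^'n) chart set \<Rightarrow> 'a conn \<Rightarrow> ('a, real^'n) chart \<Rightarrow> bool" where
  "affine_coordinates A nab c \<longleftrightarrow>
     c \<in> maximal_atlas A \<and>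
     (\<forall>i j. \<forall>p\<in>fst c. cov nab (coord_field A c i) (coord_field A c j) p = (\<lambda>f. 0))"

definition metric_coeff ::
  "('a, real^'n) chart set \<Rightarrow> 'a metric_tensor \<Rightarrow> ('a, real^'n) chart \<Rightarrow> 'n \<Rightarrow> 'n \<Rightarrow> 'a \<Rightarrow> real"
  where
  "metric_coeff A g c i j p = g p (coord_field A c i p) (coord_field A c j p)"

definition partial2 ::
  "('a, real^'n) chart set \<Rightarrow> ('a, real^'n) chart \<Rightarrow> 'n \<Rightarrow> 'n \<Rightarrow> ('a \<Rightarrow> real) \<Rightarrow> 'a \<Rightarrow> real" where
  "partial2 A c i j f p = coord_field A c i p (\<lambda>q. coord_field A c j q f)"


section \<open>Pluriclosed Hermitian structures\<close>

text \<open>Differential forms of degree \<open>k\<close> are represented by their values on lists of \<open>k\<close> local vector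
  fields; \<open>ext_d\<close> is the invariant formula for the exterior derivative.\<close>

type_synonym 'a dform = "'a vfield list \<Rightarrow> 'a \<Rightarrow> real"

definition omit :: "nat \<Rightarrow> 'b list \<Rightarrow> 'b list" where
  "omit i xs = take i xs @ drop (Suc i) xs"

definition ext_d :: "('a, 'e::euclidean_space) chart set \<Rightarrow> 'a dform \<Rightarrow> 'a dform" where
  "ext_d A \<eta> Xs p =
     (\<Sum>i<length Xs. (-1) ^ i * (Xs ! i) p (\<lambda>q. \<eta> (omit i Xs) q)) +
     (\<Sum>j<length Xs. \<Sum>i<j.
        (-1) ^ (i + j) * \<eta> (bracket A (Xs ! i) (Xs ! j) # omit i (omit j Xs)) p)"

type_synonym 'a endo_field = "'a \<Rightarrow> 'a tvec \<Rightarrow> 'a tvec"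

definition J_form :: "'a endo_field \<Rightarrow> 'a dform \<Rightarrow> 'a dform" where
  "J_form J \<eta> Xs p = (-1) ^ length Xs * \<eta> (map (\<lambda>X q. J q (X q)) Xs) p"

definition fundamental_form :: "'a endo_field \<Rightarrow> 'a metric_tensor \<Rightarrow> 'a dform" where
  "fundamental_form J g Xs p = g p (J p ((Xs ! 0) p)) ((Xs ! 1) p)"

definition pluriclosed ::
  "('a, 'e::euclidean_space) chart set \<Rightarrow> 'a endo_field \<Rightarrow> 'a metric_tensor \<Rightarrow> bool" where
  "pluriclosed A J g \<longleftrightarrow>
     (\<forall>U Xs. mopen A U \<longrightarrow> length Xs = 4 \<longrightarrow> (\<forall>X\<in>set Xs. smooth_vfield A U X) \<longrightarrow>
        (\<forall>p\<in>U. ext_d A (J_form J (ext_d A (fundamental_form J g))) Xs p = 0))"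


section \<open>The canonical Hermitian structure of the tangent bundle\<close>

definition tm_chart ::
  "('a, real^'n) chart set \<Rightarrow> ('a, real^'n) chart \<Rightarrow> ('a \<times> 'a tvec, (real^'n) \<times> (real^'n)) chart"
  where
  "tm_chart A c =
     ({(p, u). p \<in> fst c \<and> u \<in> tangent_space A p},
      \<lambda>(p, u). (snd c p, \<chi> i. u (\<lambda>q. snd c q $ i)))"

definition tm_atlas ::
  "('a, real^'n) chart set \<Rightarrow> ('a \<times> 'a tvec, (real^'n) \<times> (real^'n)) chart set" where
  "tm_atlas A = tm_chart A ` A"

text \<open>The vertical lift of \<open>x\<close> to \<open>(p, u)\<close> is the velocity at \<open>t = 0\<close> of the curve \<open>(p, u + t x)\<close>.\<close>

definition vlift :: "('a, real^'n) chart set \<Rightarrow> 'a \<times> 'a tvec \<Rightarrow> 'a tvec \<Rightarrow> ('a \<times> 'a tvec) tvec"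
  where
  "vlift A = (\<lambda>(p, u) x F.
     if smooth_near (tm_atlas A) (p, u) F
     then deriv (\<lambda>t. F (p, \<lambda>f. u f + t * x f)) (0::real) else 0)"

text \<open>The horizontal lift of \<open>x\<close> to \<open>(p, u)\<close> is the image of \<open>x\<close> under the differential at \<open>p\<close> of any
  local section \<open>Y\<close> of the tangent bundle with \<open>Y p = u\<close> and \<open>\<nabla>\<^sub>x Y = 0\<close>.\<close>

definition hlift ::
  "('a, real^'n) chart set \<Rightarrow> 'a conn \<Rightarrow> 'a \<times> 'a tvec \<Rightarrow> 'a tvec \<Rightarrow> ('a \<times> 'a tvec) tvec" where
  "hlift A nab = (\<lambda>(p, u) x.
     THE \<xi>. \<exists>U Y. mopen A U \<and> p \<in> U \<and> smooth_vfield A U Y \<and> Y p = u \<and> nab p x Y = (\<lambda>f. 0) \<and>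
       \<xi> = (\<lambda>F. if smooth_near (tm_atlas A) (p, u) F then x (\<lambda>q. F (q, Y q)) else 0))"

text \<open>The unique \<open>(x, y)\<close> such that \<open>\<xi>\<close> is the horizontal lift of \<open>x\<close> plus the vertical lift of \<open>y\<close>.\<close>

definition lift_split ::
  "('a, real^'n) chart set \<Rightarrow> 'a conn \<Rightarrow> 'a \<times> 'a tvec \<Rightarrow> ('a \<times> 'a tvec) tvec \<Rightarrow> 'a tvec \<times> 'a tvec"
  where
  "lift_split A nab P \<xi> =
     (THE z. fst z \<in> tangent_space A (fst P) \<and> snd z \<in> tangent_space A (fst P) \<and>
        \<xi> = (\<lambda>F. hlift A nab P (fst z) F + vlift A P (snd z) F))"

definition J1 :: "('a, real^'n) chart set \<Rightarrow> 'a conn \<Rightarrow> ('a \<times> 'a tvec) endo_field" where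
  "J1 A nab P \<xi> =
     (case lift_split A nab P \<xi> of (x, y) \<Rightarrow> (\<lambda>F. vlift A P x F - hlift A nab P y F))"

definition g1 ::
  "('a, real^'n) chart set \<Rightarrow> 'a conn \<Rightarrow> 'a metric_tensor \<Rightarrow> ('a \<times> 'a tvec) metric_tensor" where
  "g1 A nab g P \<xi> \<zeta> =
     (case (lift_split A nab P \<xi>, lift_split A nab P \<zeta>) of
        ((x, y), (x', y')) \<Rightarrow> g (fst P) x x' + g (fst P) y y')"

end

theory Submission
  imports Defs
begin

text \<open>In affine coordinates \<open>x\<close> on \<open>M\<close>, with induced coordinates \<open>(x, y)\<close> on \<open>TM\<close>, horizontal and vertical
  lifts of constant vectors are the constant vectors \<open>(a, 0)\<close> and \<open>(0, b)\<close>; so \<open>J(a, b) = (-b, a)\<close> is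
  constant and \<open>\<omega>((a, b), (a', b')) = \<mu>(a, b') - \<mu>(b, a')\<close> with \<open>\<mu>\<close> depending on \<open>x\<close> only. In a chart,
  the invariant formula for the exterior derivative reduces to the alternating sum of derivatives of the
  coefficients, and \<open>d J d \<omega>\<close> turns into a signed sum of the expressions
  \<open>\<partial>\<^sub>a \<partial>\<^sub>b\<^sub>' \<mu>(a', b) + \<partial>\<^sub>a\<^sub>' \<partial>\<^sub>b \<mu>(a, b') - \<partial>\<^sub>a \<partial>\<^sub>b \<mu>(a', b') - \<partial>\<^sub>a\<^sub>' \<partial>\<^sub>b\<^sub>' \<mu>(a, b)\<close>.

  That the coordinate condition implies pluriclosedness needs affine coordinates near every point. They
  are functions \<open>\<phi>\<close> with \<open>D\<^sup>2\<phi>(u, v) = D\<phi>(\<Gamma>(u, v))\<close>, that is, solutions of a linear total differential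
  equation for \<open>(\<phi>, D\<phi>)\<close> whose integrability conditions are the vanishing of torsion and curvature. Such
  an equation is solved by Picard iteration along rays from the base point.\<close>

section \<open>Calculus of smooth maps\<close>

text \<open>Integration along rays enforces the equation only in the radial direction. The other
  directions come from integrability, through an integral equation for the defect; to write the
  defect down, the solution must already be known to be C1. This is why each Picard term is carried
  together with its derivative and both series are estimated. Since the equation is linear, one
  radius serves all initial values: the coordinate functions, with gradients the standard basis
  vectors at the base point, live on a common ball and form a chart by the inverse function theorem.
  Smoothness beyond C1 is bootstrapped from the equation itself.

  On \<open>TM\<close> the obstacle is the encoding. Forms are functions of lists of fields, so each
  form has to be shown to have smooth, multilinear, alternating coefficients before its exterior
  derivative can be computed. \<open>hlift\<close> and \<open>lift_split\<close> are definite
  descriptions, so their coordinate formulas include a proof that the result is independent of the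
  auxiliary section, respectively that the splitting is unique.\<close>

lemma frechet_derivative_works_at:
  assumes "(f has_derivative f') (at x)"
  shows "frechet_derivative f (at x) = f'"
  using frechet_derivative_at[OF assms] by simp

text \<open>Since \<open>frechet_derivative f (at x)\<close> sees the values of \<open>f\<close>
  near \<open>x\<close>, agreement on \<open>S\<close> passes to derivatives because
  \<open>S\<close> is a neighbourhood of each of its points.\<close>

lemma Ck_on_cong:
  assumes "open S" "\<And>x. x \<in> S \<Longrightarrow> f x = g x" "Ck_on k S f"
  shows "Ck_on k S g"
  using assms(2,3)
proof (induction k arbitrary: f g)
  case 0
  then show ?case
    using continuous_on_cong[of S S f g] by simp
next
  case (Suc k)
  have d: "(g has_derivative frechet_derivative f (at x)) (at x)" if "x \<in> S" for x
  proof (rule has_derivative_transform_within_open[OF _ assms(1) that])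
    show "(f has_derivative frechet_derivative f (at x)) (at x)"
      using Suc.prems(2) that by (simp add: frechet_derivative_works[symmetric])
  qed (rule Suc.prems(1))
  have "Ck_on k S (\<lambda>x. frechet_derivative g (at x) v)" for v
  proof (rule Suc.IH[where f = "\<lambda>x. frechet_derivative f (at x) v"])
    show "frechet_derivative f (at x) v = frechet_derivative g (at x) v" if "x \<in> S" for x
      using frechet_derivative_works_at[OF d[OF that]] by simp
    show "Ck_on k S (\<lambda>x. frechet_derivative f (at x) v)"
      using Suc.prems(2) by simp
  qed
  then show ?case
    using d by (auto simp: differentiable_def)
qed

text \<open>Any explicit formula for the derivative may stand in for
  \<open>frechet_derivative\<close>; closure under sums, products and composition is proved by
  exhibiting the usual rules here.\<close>

lemma Ck_on_SucI:
  assumes "open S" "\<And>x. x \<in> S \<Longrightarrow> (f has_derivative f' x) (at x)"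
    and "\<And>v. Ck_on k S (\<lambda>x. f' x v)"
  shows "Ck_on (Suc k) S f"
proof -
  have "Ck_on k S (\<lambda>x. frechet_derivative f (at x) v)" for v
    by (rule Ck_on_cong[OF assms(1) _ assms(3)[of v]])
      (simp add: frechet_derivative_works_at[OF assms(2)])
  then show ?thesis
    using assms(2) by (auto simp: differentiable_def)
qed

lemma Ck_on_SucD: "Ck_on (Suc k) S f \<Longrightarrow> Ck_on k S f"
proof (induction k arbitrary: f)
  case 0
  then show ?case
    by (auto intro!: continuous_at_imp_continuous_on differentiable_imp_continuous_within)
next
  case (Suc k)
  then show ?case
    by auto
qed

lemma Ck_on_subset: "Ck_on k S f \<Longrightarrow> T \<subseteq> S \<Longrightarrow> Ck_on k T f"
  by (induction k arbitrary: f) (auto intro: continuous_on_subset)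

lemma Ck_on_local:
  assumes "\<And>x. x \<in> S \<Longrightarrow> \<exists>T. open T \<and> x \<in> T \<and> Ck_on k T f"
  shows "Ck_on k S f"
  using assms
proof (induction k arbitrary: f)
  case 0
  then show ?case
    by (force intro!: continuous_at_imp_continuous_on simp: continuous_on_eq_continuous_at)
next
  case (Suc k)
  have "Ck_on k S (\<lambda>x. frechet_derivative f (at x) v)" for v
    using Suc.prems by (intro Suc.IH) fastforce
  then show ?case
    using Suc.prems by fastforce
qed

lemma Ck_on_const: "Ck_on k S (\<lambda>x. c)"
  by (induction k arbitrary: c) auto

lemma Ck_on_linear:
  assumes "bounded_linear L" "open S" "Ck_on k S f"
  shows "Ck_on k S (\<lambda>x. L (f x))"
  using assms(3)
proof (induction k arbitrary: f)
  case 0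
  then show ?case
    by (auto intro: bounded_linear.continuous_on[OF assms(1)])
next
  case (Suc k)
  show ?case
  proof (rule Ck_on_SucI[OF assms(2)])
    show "((\<lambda>x. L (f x)) has_derivative (\<lambda>v. L (frechet_derivative f (at x) v))) (at x)" if "x \<in> S" for x
      using Suc.prems that
      by (intro bounded_linear.has_derivative[OF assms(1)]) (simp add: frechet_derivative_works[symmetric])
    show "Ck_on k S (\<lambda>x. L (frechet_derivative f (at x) v))" for v
      using Suc.prems by (intro Suc.IH) auto
  qed
qed

lemma Ck_on_add:
  assumes "open S" "Ck_on k S f" "Ck_on k S g"
  shows "Ck_on k S (\<lambda>x. f x + g x)"
  using assms(2,3)
proof (induction k arbitrary: f g)
  case 0
  then show ?case
    by (auto intro: continuous_on_add)
next
  case (Suc k)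
  show ?case
  proof (rule Ck_on_SucI[OF assms(1)])
    show "((\<lambda>x. f x + g x) has_derivative
        (\<lambda>v. frechet_derivative f (at x) v + frechet_derivative g (at x) v)) (at x)" if "x \<in> S" for x
      using Suc.prems that by (intro has_derivative_add) (simp_all add: frechet_derivative_works[symmetric])
    show "Ck_on k S (\<lambda>x. frechet_derivative f (at x) v + frechet_derivative g (at x) v)" for v
      using Suc.prems by (intro Suc.IH) auto
  qed
qed

lemma Ck_on_sum:
  assumes "open S" "\<And>i. i \<in> I \<Longrightarrow> Ck_on k S (f i)"
  shows "Ck_on k S (\<lambda>x. \<Sum>i\<in>I. f i x)"
  using assms(2)
  by (induction I rule: infinite_finite_induct)
    (auto intro: Ck_on_add Ck_on_const assms(1) simp del: Ck_on.simps)

lemma Ck_on_bilinear: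
  assumes "bounded_bilinear B" "open S" "Ck_on k S f" "Ck_on k S g"
  shows "Ck_on k S (\<lambda>x. B (f x) (g x))"
  using assms(3,4)
proof (induction k arbitrary: f g)
  case 0
  then show ?case
    by (auto intro: bounded_bilinear.continuous_on[OF assms(1)])
next
  case (Suc k)
  show ?case
  proof (rule Ck_on_SucI[OF assms(2)])
    show "((\<lambda>x. B (f x) (g x)) has_derivative
        (\<lambda>v. B (f x) (frechet_derivative g (at x) v) + B (frechet_derivative f (at x) v) (g x))) (at x)"
      if "x \<in> S" for x
      using Suc.prems that
      by (intro bounded_bilinear.FDERIV[OF assms(1)]) (simp_all add: frechet_derivative_works[symmetric])
    show "Ck_on k S (\<lambda>x. B (f x) (frechet_derivative g (at x) v) + B (frechet_derivative f (at x) v) (g x))" for v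
      using Suc.prems
      by (intro Ck_on_add[OF assms(2)] Suc.IH) (simp_all add: Ck_on_SucD del: Ck_on.simps, simp_all)
  qed
qed

lemma linear_expand_Basis:
  fixes f :: "'a::euclidean_space \<Rightarrow> 'b::real_vector"
  assumes "linear f"
  shows "f x = (\<Sum>b\<in>Basis. (x \<bullet> b) *\<^sub>R f b)"
proof -
  have "f x = f (\<Sum>b\<in>Basis. (x \<bullet> b) *\<^sub>R b)"
    by (simp add: euclidean_representation)
  also have "\<dots> = (\<Sum>b\<in>Basis. (x \<bullet> b) *\<^sub>R f b)"
    by (simp add: linear_sum[OF assms] linear_scale[OF assms])
  finally show ?thesis .
qed

text \<open>Regularity of \<open>L x a\<close> is known for fixed \<open>a\<close> only. Expanding
  the moving argument \<open>X x\<close> in the standard basis leaves finitely many products of a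
  coordinate of \<open>X\<close> with some \<open>L x b\<close>. This turns the
  direction-by-direction definition of \<open>Ck_on\<close> into a usable chain rule.\<close>

lemma Ck_on_apply_linear:
  fixes X :: "'a::euclidean_space \<Rightarrow> 'b::euclidean_space" and L :: "'a \<Rightarrow> 'b \<Rightarrow> 'c::real_normed_vector"
  assumes "open S" "\<And>x. x \<in> S \<Longrightarrow> linear (L x)" "\<And>a. Ck_on k S (\<lambda>x. L x a)" "Ck_on k S X"
  shows "Ck_on k S (\<lambda>x. L x (X x))"
proof (rule Ck_on_cong[OF assms(1)])
  show "Ck_on k S (\<lambda>x. \<Sum>b\<in>Basis. (X x \<bullet> b) *\<^sub>R L x b)"
    by (intro Ck_on_sum[OF assms(1)] Ck_on_bilinear[OF bounded_bilinear_scaleR assms(1)] assms(3)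
        Ck_on_linear[OF bounded_linear_inner_left assms(1,4)])
  show "(\<Sum>b\<in>Basis. (X x \<bullet> b) *\<^sub>R L x b) = L x (X x)" if "x \<in> S" for x
    by (rule linear_expand_Basis[OF assms(2)[OF that], symmetric])
qed

lemma linear_frechet_derivative:
  "f differentiable (at x) \<Longrightarrow> linear (frechet_derivative f (at x))"
  using frechet_derivative_works has_derivative_linear by blast

lemma Ck_on_compose:
  fixes f :: "'a::euclidean_space \<Rightarrow> 'b::euclidean_space" and g :: "'b \<Rightarrow> 'c::real_normed_vector"
  assumes "open S" "open T" "f ` S \<subseteq> T" "Ck_on k S f" "Ck_on k T g"
  shows "Ck_on k S (\<lambda>x. g (f x))"
  using assms(4,5)
proof (induction k arbitrary: g)
  case 0
  then show ?case
    using assms(3) by (auto intro: continuous_on_compose2)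
next
  case (Suc k)
  have fT: "f x \<in> T" if "x \<in> S" for x
    using assms(3) that by auto
  show ?case
  proof (rule Ck_on_SucI[OF assms(1)])
    show "((\<lambda>x. g (f x)) has_derivative
        (\<lambda>v. frechet_derivative g (at (f x)) (frechet_derivative f (at x) v))) (at x)" if "x \<in> S" for x
      using Suc.prems that fT
      by (intro diff_chain_at[of f _ x g, unfolded o_def]) (simp_all add: frechet_derivative_works[symmetric])
    \<comment> \<open>The induction hypothesis is applied to \<open>g\<close> differentiated in a
      fixed direction, one order lower; hence the induction generalises over \<open>g\<close> while
      \<open>f\<close> stays fixed.\<close>
    show "Ck_on k S (\<lambda>x. frechet_derivative g (at (f x)) (frechet_derivative f (at x) v))" for v
    proof (rule Ck_on_apply_linear[OF assms(1)])
      show "linear (frechet_derivative g (at (f x)))" if "x \<in> S" for x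
        using Suc.prems(2) fT[OF that] linear_frechet_derivative by auto
      show "Ck_on k S (\<lambda>x. frechet_derivative g (at (f x)) a)" for a
        using Suc.prems by (intro Suc.IH[where g = "\<lambda>y. frechet_derivative g (at y) a"])
          (simp_all add: Ck_on_SucD del: Ck_on.simps, simp_all)
      show "Ck_on k S (\<lambda>x. frechet_derivative f (at x) v)"
        using Suc.prems by simp
    qed
  qed
qed

lemma Ck_on_ident: "Ck_on k S (\<lambda>x. x)"
  by (cases k) (auto simp: Ck_on_const)

section \<open>Infinitely differentiable maps\<close>

lemma smooth_onD: "smooth_on S f \<Longrightarrow> Ck_on k S f"
  by (simp add: smooth_on_def)

lemma smooth_on_differentiable: "smooth_on S f \<Longrightarrow> x \<in> S \<Longrightarrow> f differentiable (at x)"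
  using smooth_onD[of S f "Suc 0"] by auto

lemma smooth_on_has_derivative:
  "smooth_on S f \<Longrightarrow> x \<in> S \<Longrightarrow> (f has_derivative frechet_derivative f (at x)) (at x)"
  using smooth_on_differentiable frechet_derivative_works by blast

lemma smooth_on_continuous_on: "smooth_on S f \<Longrightarrow> continuous_on S f"
  using smooth_onD[of S f 0] by auto

lemma smooth_on_deriv: "smooth_on S f \<Longrightarrow> smooth_on S (\<lambda>x. frechet_derivative f (at x) v)"
  unfolding smooth_on_def
proof
  fix k assume "\<forall>k. Ck_on k S f"
  then have "Ck_on (Suc k) S f" ..
  then show "Ck_on k S (\<lambda>x. frechet_derivative f (at x) v)"
    by simp
qed

lemma smooth_on_cong:
  "open S \<Longrightarrow> (\<And>x. x \<in> S \<Longrightarrow> f x = g x) \<Longrightarrow> smooth_on S f \<Longrightarrow> smooth_on S g"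
  unfolding smooth_on_def using Ck_on_cong by metis

lemma smooth_on_subset: "smooth_on S f \<Longrightarrow> T \<subseteq> S \<Longrightarrow> smooth_on T f"
  unfolding smooth_on_def using Ck_on_subset by metis

lemma smooth_on_local:
  assumes "\<And>x. x \<in> S \<Longrightarrow> \<exists>T. open T \<and> x \<in> T \<and> smooth_on T f"
  shows "smooth_on S f"
  unfolding smooth_on_def
proof
  show "Ck_on k S f" for k
    by (rule Ck_on_local) (use assms smooth_onD in metis)
qed

lemma smooth_on_const: "smooth_on S (\<lambda>x. c)"
  by (simp add: smooth_on_def Ck_on_const)

lemma smooth_on_ident: "smooth_on S (\<lambda>x. x)"
  by (simp add: smooth_on_def Ck_on_ident)

lemma smooth_on_linear:
  "bounded_linear L \<Longrightarrow> open S \<Longrightarrow> smooth_on S f \<Longrightarrow> smooth_on S (\<lambda>x. L (f x))"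
  by (simp add: smooth_on_def Ck_on_linear)

lemma smooth_on_add:
  "open S \<Longrightarrow> smooth_on S f \<Longrightarrow> smooth_on S g \<Longrightarrow> smooth_on S (\<lambda>x. f x + g x)"
  by (simp add: smooth_on_def Ck_on_add)

lemma smooth_on_sum:
  "open S \<Longrightarrow> (\<And>i. i \<in> I \<Longrightarrow> smooth_on S (f i)) \<Longrightarrow> smooth_on S (\<lambda>x. \<Sum>i\<in>I. f i x)"
  by (simp add: smooth_on_def Ck_on_sum)

lemma smooth_on_bilinear:
  "bounded_bilinear B \<Longrightarrow> open S \<Longrightarrow> smooth_on S f \<Longrightarrow> smooth_on S g \<Longrightarrow>
    smooth_on S (\<lambda>x. B (f x) (g x))"
  by (simp add: smooth_on_def Ck_on_bilinear)

lemma smooth_on_diff: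
  assumes "open S" "smooth_on S f" "smooth_on S g"
  shows "smooth_on S (\<lambda>x. f x - g x)"
  using smooth_on_add[OF assms(1,2) smooth_on_linear[OF bounded_linear_minus[OF bounded_linear_ident] assms(1,3)]]
  by simp

lemma smooth_on_apply_linear:
  fixes X :: "'a::euclidean_space \<Rightarrow> 'b::euclidean_space" and L :: "'a \<Rightarrow> 'b \<Rightarrow> 'c::real_normed_vector"
  assumes "open S" "\<And>x. x \<in> S \<Longrightarrow> linear (L x)" "\<And>a. smooth_on S (\<lambda>x. L x a)" "smooth_on S X"
  shows "smooth_on S (\<lambda>x. L x (X x))"
  using assms by (simp add: smooth_on_def Ck_on_apply_linear)

lemma smooth_on_deriv_along:
  assumes "open S" "smooth_on S f" "smooth_on S X"
  shows "smooth_on S (\<lambda>x. frechet_derivative f (at x) (X x))"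
  by (rule smooth_on_apply_linear[OF assms(1) _ smooth_on_deriv[OF assms(2)] assms(3)])
    (use linear_frechet_derivative smooth_on_differentiable[OF assms(2)] in blast)

lemma smooth_on_compose:
  fixes f :: "'a::euclidean_space \<Rightarrow> 'b::euclidean_space" and g :: "'b \<Rightarrow> 'c::real_normed_vector"
  assumes "open S" "open T" "f ` S \<subseteq> T" "smooth_on S f" "smooth_on T g"
  shows "smooth_on S (\<lambda>x. g (f x))"
  using assms by (simp add: smooth_on_def Ck_on_compose)

lemma smooth_on_inner_Basis:
  fixes f :: "'a::euclidean_space \<Rightarrow> 'b::euclidean_space"
  assumes "open S" "\<And>b. b \<in> Basis \<Longrightarrow> smooth_on S (\<lambda>x. f x \<bullet> b)"
  shows "smooth_on S f"
proof (rule smooth_on_cong[OF assms(1)])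
  show "smooth_on S (\<lambda>x. \<Sum>b\<in>Basis. (f x \<bullet> b) *\<^sub>R b)"
    by (intro smooth_on_sum[OF assms(1)] smooth_on_bilinear[OF bounded_bilinear_scaleR assms(1)]
        smooth_on_const assms(2))
qed (simp add: euclidean_representation)

text \<open>Product rule for a linear map that varies with the point, given derivatives for fixed
  arguments only; as in \<open>Ck_on_apply_linear\<close>, the argument is expanded in a
  basis.\<close>

lemma has_derivative_apply_linear:
  fixes X :: "'a::real_normed_vector \<Rightarrow> 'b::euclidean_space" and L :: "'a \<Rightarrow> 'b \<Rightarrow> 'c::real_normed_vector"
  assumes "open S" "x \<in> S" "\<And>z. z \<in> S \<Longrightarrow> linear (L z)"
    and dL: "\<And>a. ((\<lambda>z. L z a) has_derivative dL a) (at x)"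
    and X: "(X has_derivative X') (at x)"
  shows "((\<lambda>z. L z (X z)) has_derivative (\<lambda>h. dL (X x) h + L x (X' h))) (at x)"
proof -
  have expand: "L z w = (\<Sum>b\<in>Basis. (w \<bullet> b) *\<^sub>R L z b)" if "z \<in> S" for z w
    using linear_expand_Basis[OF assms(3)[OF that]] .
  have "((\<lambda>z. \<Sum>b\<in>Basis. (X x \<bullet> b) *\<^sub>R L z b) has_derivative (\<lambda>h. \<Sum>b\<in>Basis. (X x \<bullet> b) *\<^sub>R dL b h)) (at x)"
    by (intro has_derivative_sum has_derivative_scaleR_right dL)
  then have "((\<lambda>z. L z (X x)) has_derivative (\<lambda>h. \<Sum>b\<in>Basis. (X x \<bullet> b) *\<^sub>R dL b h)) (at x)"
    by (rule has_derivative_transform_within_open[OF _ assms(1,2)]) (simp add: expand[symmetric])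
  \<comment> \<open>That \<open>dL\<close> depends linearly on its index is obtained here from
    uniqueness of the derivative.\<close>
  then have dLX: "dL (X x) = (\<lambda>h. \<Sum>b\<in>Basis. (X x \<bullet> b) *\<^sub>R dL b h)"
    using has_derivative_unique[OF dL] by blast
  have "((\<lambda>z. \<Sum>b\<in>Basis. (X z \<bullet> b) *\<^sub>R L z b) has_derivative
      (\<lambda>h. \<Sum>b\<in>Basis. (X x \<bullet> b) *\<^sub>R dL b h + (X' h \<bullet> b) *\<^sub>R L x b)) (at x)"
    by (intro has_derivative_sum has_derivative_scaleR has_derivative_inner_left dL X)
  then have "((\<lambda>z. L z (X z)) has_derivative
      (\<lambda>h. \<Sum>b\<in>Basis. (X x \<bullet> b) *\<^sub>R dL b h + (X' h \<bullet> b) *\<^sub>R L x b)) (at x)"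
    by (rule has_derivative_transform_within_open[OF _ assms(1,2)]) (simp add: expand[symmetric])
  moreover have "(\<Sum>b\<in>Basis. (X x \<bullet> b) *\<^sub>R dL b h + (X' h \<bullet> b) *\<^sub>R L x b) = dL (X x) h + L x (X' h)" for h
    by (simp add: dLX sum.distrib expand[OF assms(2), of "X' h"])
  ultimately show ?thesis
    by simp
qed

section \<open>Difference quotients and symmetry of second derivatives\<close>

lemma has_real_derivative_along_line:
  fixes f :: "'a::real_normed_vector \<Rightarrow> real"
  assumes "f differentiable (at (a + s *\<^sub>R u))"
  shows "((\<lambda>s. f (a + s *\<^sub>R u)) has_real_derivative frechet_derivative f (at (a + s *\<^sub>R u)) u) (at s)"
proof -
  let ?D = "frechet_derivative f (at (a + s *\<^sub>R u))"
  have "((\<lambda>s. a + s *\<^sub>R u) has_derivative (\<lambda>h. h *\<^sub>R u)) (at s)"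
    by (auto intro!: derivative_eq_intros)
  moreover have "(f has_derivative ?D) (at (a + s *\<^sub>R u))"
    using assms frechet_derivative_works by blast
  ultimately have "((\<lambda>s. f (a + s *\<^sub>R u)) has_derivative (\<lambda>h. ?D (h *\<^sub>R u))) (at s)"
    using diff_chain_at[of "\<lambda>s. a + s *\<^sub>R u" "\<lambda>h. h *\<^sub>R u" s f ?D] by (simp add: o_def)
  moreover have "(\<lambda>h. ?D (h *\<^sub>R u)) = (*) (?D u)"
    using linear_scale[OF linear_frechet_derivative[OF assms]] by (simp add: fun_eq_iff)
  ultimately show ?thesis
    by (simp add: has_field_derivative_def)
qed

text \<open>The mean value theorem is used twice: along \<open>u\<close>, for the difference of
  \<open>f\<close> at points that are \<open>t v\<close> apart, then along \<open>v\<close>, for the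
  derivative so obtained. The quotient is thus exactly a value of the second derivative near
  \<open>x\<close>, and continuity at \<open>x\<close> gives the estimate.\<close>

lemma second_difference_quotient:
  fixes f :: "'a::euclidean_space \<Rightarrow> real"
  assumes "open S" "x \<in> S" "smooth_on S f" "e > 0"
  shows "\<exists>d>0. \<forall>t. 0 < t \<longrightarrow> t < d \<longrightarrow>
    \<bar>(f (x + t *\<^sub>R u + t *\<^sub>R v) - f (x + t *\<^sub>R u) - f (x + t *\<^sub>R v) + f x) / t\<^sup>2
      - frechet_derivative (\<lambda>y. frechet_derivative f (at y) u) (at x) v\<bar> < e"
proof -
  define D where "D = (\<lambda>y. frechet_derivative f (at y) u)"
  define D2 where "D2 = (\<lambda>y. frechet_derivative D (at y) v)"
  have sD: "smooth_on S D" and sD2: "smooth_on S D2"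
    unfolding D_def D2_def using assms(3) by (auto intro: smooth_on_deriv)
  have "isCont D2 x"
    using smooth_on_continuous_on[OF sD2] assms(1,2) continuous_on_eq_continuous_at by blast
  then obtain d1 where d1: "d1 > 0" "\<And>y. dist y x < d1 \<Longrightarrow> dist (D2 y) (D2 x) < e"
    using \<open>e > 0\<close> unfolding continuous_at_eps_delta by blast
  obtain d2 where d2: "d2 > 0" "ball x d2 \<subseteq> S"
    using assms(1,2) open_contains_ball by blast
  \<comment> \<open>The denominator bounds how far \<open>s u + r v\<close> moves per unit of
    \<open>t\<close>; the summand \<open>1\<close> keeps it positive when \<open>u\<close> and
    \<open>v\<close> vanish.\<close>
  define d where "d = min d1 d2 / (norm u + norm v + 1)"
  have pos: "norm u + norm v + 1 > 0"
    by (smt (verit) norm_ge_zero)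
  have near: "dist (x + s *\<^sub>R u + r *\<^sub>R v) x < min d1 d2"
    if "0 \<le> s" "s \<le> t" "0 \<le> r" "r \<le> t" "0 < t" "t < d" for s r t
  proof -
    have "dist (x + s *\<^sub>R u + r *\<^sub>R v) x = norm (s *\<^sub>R u + r *\<^sub>R v)"
      by (simp add: dist_norm)
    also have "\<dots> \<le> s * norm u + r * norm v"
      using that by (intro norm_triangle_le) auto
    also have "\<dots> \<le> t * norm u + t * norm v"
      using that by (intro add_mono mult_right_mono) auto
    also have "\<dots> \<le> t * (norm u + norm v + 1)"
      using that by (simp add: algebra_simps)
    also have "\<dots> < d * (norm u + norm v + 1)"
      using that pos by simp
    also have "\<dots> = min d1 d2"
      using pos by (simp add: d_def)
    finally show ?thesis .
  qed
  have inS: "x + s *\<^sub>R u + r *\<^sub>R v \<in> S"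
    if "0 \<le> s" "s \<le> t" "0 \<le> r" "r \<le> t" "0 < t" "t < d" for s r t
    using near[OF that] d2 by (auto simp: dist_commute)
  have "\<bar>(f (x + t *\<^sub>R u + t *\<^sub>R v) - f (x + t *\<^sub>R u) - f (x + t *\<^sub>R v) + f x) / t\<^sup>2 - D2 x\<bar> < e"
    if t: "0 < t" "t < d" for t
  proof -
    have der1: "((\<lambda>s. f (x + s *\<^sub>R u + t *\<^sub>R v) - f (x + s *\<^sub>R u)) has_real_derivative
        D (x + s *\<^sub>R u + t *\<^sub>R v) - D (x + s *\<^sub>R u)) (at s)" if "0 \<le> s" "s \<le> t" for s
    proof -
      have "f differentiable (at ((x + t *\<^sub>R v) + s *\<^sub>R u))" "f differentiable (at (x + s *\<^sub>R u))"
        using smooth_on_differentiable[OF assms(3)] inS[of s t t] inS[of s t 0] that t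
        by (auto simp: algebra_simps)
      then show ?thesis
        unfolding D_def
        using has_real_derivative_along_line[of f "x + t *\<^sub>R v" s u]
          has_real_derivative_along_line[of f x s u]
        by (auto intro!: DERIV_diff simp: algebra_simps)
    qed
    obtain s where s: "0 < s" "s < t" and eq1:
      "f (x + t *\<^sub>R u + t *\<^sub>R v) - f (x + t *\<^sub>R u) - (f (x + t *\<^sub>R v) - f x)
        = t * (D (x + s *\<^sub>R u + t *\<^sub>R v) - D (x + s *\<^sub>R u))"
      using MVT2[OF t(1) der1] by auto
    have der2: "((\<lambda>r. D (x + s *\<^sub>R u + r *\<^sub>R v)) has_real_derivative D2 (x + s *\<^sub>R u + r *\<^sub>R v)) (at r)"
      if "0 \<le> r" "r \<le> t" for r
      unfolding D2_def
      by (intro has_real_derivative_along_line smooth_on_differentiable[OF sD] inS[of s t r])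
        (use that s t in auto)
    obtain r where r: "0 < r" "r < t" and eq2:
      "D (x + s *\<^sub>R u + t *\<^sub>R v) - D (x + s *\<^sub>R u) = t * D2 (x + s *\<^sub>R u + r *\<^sub>R v)"
      using MVT2[OF t(1) der2] by auto
    have "(f (x + t *\<^sub>R u + t *\<^sub>R v) - f (x + t *\<^sub>R u) - f (x + t *\<^sub>R v) + f x) / t\<^sup>2
        = D2 (x + s *\<^sub>R u + r *\<^sub>R v)"
      using eq1 eq2 t by (simp add: power2_eq_square field_simps)
    moreover have "dist (D2 (x + s *\<^sub>R u + r *\<^sub>R v)) (D2 x) < e"
      using near[of s t r] s r t by (intro d1) auto
    ultimately show ?thesis
      by (simp add: dist_real_def)
  qed
  moreover have "d > 0"
    using d1 d2 pos by (simp add: d_def)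
  ultimately show ?thesis
    unfolding D2_def D_def by (intro exI[of _ d] conjI allI impI)
qed

text \<open>The second difference is unchanged when \<open>u\<close> and \<open>v\<close> are
  exchanged, so one and the same quotient approximates both mixed derivatives; it cannot lie within
  half their distance of each.\<close>

lemma second_derivative_symmetric:
  fixes f :: "'a::euclidean_space \<Rightarrow> real"
  assumes "open S" "x \<in> S" "smooth_on S f"
  shows "frechet_derivative (\<lambda>y. frechet_derivative f (at y) u) (at x) v
       = frechet_derivative (\<lambda>y. frechet_derivative f (at y) v) (at x) u" (is "?l = ?r")
proof (rule ccontr)
  assume "?l \<noteq> ?r"
  then have e: "\<bar>?l - ?r\<bar> / 2 > 0"
    by simp
  obtain d1 where d1: "d1 > 0" "\<And>t. 0 < t \<Longrightarrow> t < d1 \<Longrightarrow>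
    \<bar>(f (x + t *\<^sub>R u + t *\<^sub>R v) - f (x + t *\<^sub>R u) - f (x + t *\<^sub>R v) + f x) / t\<^sup>2 - ?l\<bar> < \<bar>?l - ?r\<bar> / 2"
    using second_difference_quotient[OF assms e, of u v] by blast
  obtain d2 where d2: "d2 > 0" "\<And>t. 0 < t \<Longrightarrow> t < d2 \<Longrightarrow>
    \<bar>(f (x + t *\<^sub>R v + t *\<^sub>R u) - f (x + t *\<^sub>R v) - f (x + t *\<^sub>R u) + f x) / t\<^sup>2 - ?r\<bar> < \<bar>?l - ?r\<bar> / 2"
    using second_difference_quotient[OF assms e, of v u] by blast
  define t where "t = min d1 d2 / 2"
  have t: "0 < t" "t < d1" "t < d2"
    using d1(1) d2(1) by (auto simp: t_def)
  define q where "q = (f (x + t *\<^sub>R u + t *\<^sub>R v) - f (x + t *\<^sub>R u) - f (x + t *\<^sub>R v) + f x) / t\<^sup>2"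
  have "q = (f (x + t *\<^sub>R v + t *\<^sub>R u) - f (x + t *\<^sub>R v) - f (x + t *\<^sub>R u) + f x) / t\<^sup>2"
    by (simp add: q_def add_ac)
  then have "\<bar>q - ?l\<bar> < \<bar>?l - ?r\<bar> / 2" "\<bar>q - ?r\<bar> < \<bar>?l - ?r\<bar> / 2"
    using d1(2)[OF t(1,2)] d2(2)[OF t(1,3)] unfolding q_def by metis+
  moreover have False if "\<bar>q - a\<bar> < \<bar>a - b\<bar> / 2" "\<bar>q - b\<bar> < \<bar>a - b\<bar> / 2" for a b :: real
    using add_strict_mono[OF that] abs_triangle_ineq4[of "q - b" "q - a"] by simp
  ultimately show False
    by blast
qed

section \<open>Completely integrable linear total differential equations\<close>

text \<open>The condition \<open>K * \<rho> \<le> 1 / 2\<close> makes integration along rays a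
  contraction with factor \<open>1/2\<close>. The bound on \<open>G'\<close> serves the derivatives
  of the iterates, since differentiating the integrand in \<open>x\<close> also differentiates
  \<open>G\<close>.\<close>

locale ray_system =
  fixes G :: "'e::euclidean_space \<Rightarrow> 'e \<Rightarrow>\<^sub>L ('f::banach \<Rightarrow>\<^sub>L 'f)"
    and G' :: "'e \<Rightarrow> 'e \<Rightarrow>\<^sub>L ('e \<Rightarrow>\<^sub>L ('f \<Rightarrow>\<^sub>L 'f))"
    and \<rho> K :: real
  assumes rho_pos: "\<rho> > 0"
    and deriv_G: "\<And>x. x \<in> ball 0 \<rho> \<Longrightarrow> (G has_derivative blinfun_apply (G' x)) (at x)"
    and cont_G': "continuous_on (ball 0 \<rho>) G'"
    and bound_G: "\<And>x. x \<in> ball 0 \<rho> \<Longrightarrow> norm (G x) \<le> K"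
    and bound_G': "\<And>x. x \<in> ball 0 \<rho> \<Longrightarrow> norm (G' x) \<le> K"
    and small: "K * \<rho> \<le> 1 / 2"
begin

abbreviation B where "B \<equiv> ball (0::'e) \<rho>"

text \<open>After rescaling the ray, \<open>f x = w + ray_int f x\<close> on the ball says that
  \<open>s \<mapsto> f (s x)\<close> solves the linear ODE with coefficient \<open>G (s x) x\<close>
  and value \<open>w\<close> at \<open>s = 0\<close>.\<close>

definition ray_int :: "('e \<Rightarrow> 'f) \<Rightarrow> 'e \<Rightarrow> 'f" where
  "ray_int f x = integral {0..1} (\<lambda>t. G (t *\<^sub>R x) x (f (t *\<^sub>R x)))"

text \<open>The derivative in direction \<open>h\<close> of the integrand of \<open>ray_int\<close>,
  with \<open>f'\<close> as derivative of \<open>f\<close>. Packing it as a bounded linear map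
  allows it to be integrated as a whole.\<close>

definition ray_ker :: "('e \<Rightarrow> 'f) \<Rightarrow> ('e \<Rightarrow> 'e \<Rightarrow>\<^sub>L 'f) \<Rightarrow> 'e \<Rightarrow> real \<Rightarrow> 'e \<Rightarrow>\<^sub>L 'f" where
  "ray_ker f f' x t = Blinfun (\<lambda>h. G (t *\<^sub>R x) h (f (t *\<^sub>R x))
     + t *\<^sub>R (G' (t *\<^sub>R x) h x (f (t *\<^sub>R x)) + G (t *\<^sub>R x) x (f' (t *\<^sub>R x) h)))"

definition ray_int' :: "('e \<Rightarrow> 'f) \<Rightarrow> ('e \<Rightarrow> 'e \<Rightarrow>\<^sub>L 'f) \<Rightarrow> 'e \<Rightarrow> 'e \<Rightarrow>\<^sub>L 'f" where
  "ray_int' f f' x = integral {0..1} (ray_ker f f' x)"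

definition C1 :: "('e \<Rightarrow> 'f) \<Rightarrow> ('e \<Rightarrow> 'e \<Rightarrow>\<^sub>L 'f) \<Rightarrow> bool" where
  "C1 f f' \<longleftrightarrow> (\<forall>x\<in>B. (f has_derivative blinfun_apply (f' x)) (at x)) \<and> continuous_on B f'"

lemma K_nonneg: "0 \<le> K"
  using bound_G[of 0] rho_pos by (auto intro: order_trans[OF norm_ge_zero])

lemma ray_in_ball: "x \<in> B \<Longrightarrow> 0 \<le> t \<Longrightarrow> t \<le> 1 \<Longrightarrow> t *\<^sub>R x \<in> B"
  using le_less_trans[OF mult_left_le_one_le[of "norm x" t]] by auto

lemma C1_cont: "C1 f f' \<Longrightarrow> continuous_on B f"
  by (auto simp: C1_def intro!: continuous_at_imp_continuous_on has_derivative_continuous)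

lemma cont_G: "continuous_on B G"
  by (auto intro!: continuous_at_imp_continuous_on has_derivative_continuous deriv_G)

lemma ray_ker_apply:
  "ray_ker f f' x t h = G (t *\<^sub>R x) h (f (t *\<^sub>R x))
     + t *\<^sub>R (G' (t *\<^sub>R x) h x (f (t *\<^sub>R x)) + G (t *\<^sub>R x) x (f' (t *\<^sub>R x) h))"
  unfolding ray_ker_def
  by (subst bounded_linear_Blinfun_apply) (auto intro!: bounded_linear_intros)

lemma continuous_on_ray:
  "continuous_on B g \<Longrightarrow> continuous_on (B \<times> {0..1}) (\<lambda>p. g (snd p *\<^sub>R fst p))"
  by (rule continuous_on_compose2[of B g])
    (use ray_in_ball in \<open>auto intro!: continuous_intros simp del: mem_ball\<close>)

lemma ray_continuous:
  assumes "C1 f f'"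
  shows "continuous_on (B \<times> {0..1}) (\<lambda>(x, t). G (t *\<^sub>R x) x (f (t *\<^sub>R x)))"
    and "continuous_on (B \<times> {0..1}) (\<lambda>(x, t). ray_ker f f' x t)"
proof -
  have f': "continuous_on B f'"
    using assms by (simp add: C1_def)
  note cont = continuous_on_ray[OF cont_G] continuous_on_ray[OF C1_cont[OF assms]]
    continuous_on_ray[OF cont_G'] continuous_on_ray[OF f']
  show "continuous_on (B \<times> {0..1}) (\<lambda>(x, t). G (t *\<^sub>R x) x (f (t *\<^sub>R x)))"
    unfolding case_prod_beta by (intro continuous_intros cont)
  show "continuous_on (B \<times> {0..1}) (\<lambda>(x, t). ray_ker f f' x t)"
    unfolding case_prod_beta
    by (rule continuous_on_blinfun_componentwise)
      (unfold ray_ker_apply, intro continuous_intros cont)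
qed

lemma continuous_on_slice:
  "continuous_on (B \<times> {0..1}) (\<lambda>(x, t). k x t) \<Longrightarrow> x \<in> B \<Longrightarrow> continuous_on {0..1} (k x)"
  by (rule continuous_on_compose2[of "B \<times> {0..1}" "\<lambda>(x, t). k x t" _ "\<lambda>t. (x, t)", simplified])
    (auto intro!: continuous_intros)

lemma ray_int'_apply:
  assumes "C1 f f'" "x \<in> B"
  shows "ray_int' f f' x h = integral {0..1} (\<lambda>t. ray_ker f f' x t h)"
proof -
  have "ray_ker f f' x integrable_on {0..1}"
    using continuous_on_slice[OF ray_continuous(2)[OF assms(1)] assms(2)]
    by (rule integrable_continuous_real)
  then show ?thesis
    unfolding ray_int'_def
    using integral_linear[of "ray_ker f f' x" "{0..1}" "\<lambda>k. blinfun_apply k h"]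
    by (simp add: o_def bounded_linear_intros)
qed

text \<open>Differentiation under the integral sign; the Leibniz rule asks for joint continuity of
  \<open>ray_ker\<close> in point and parameter.\<close>

lemma C1_ray_int:
  assumes "C1 f f'"
  shows "C1 (ray_int f) (ray_int' f f')"
  unfolding C1_def
proof (intro conjI ballI)
  fix x assume x: "x \<in> B"
  have ker: "((\<lambda>x. G (t *\<^sub>R x) x (f (t *\<^sub>R x))) has_derivative blinfun_apply (ray_ker f f' y t)) (at y within B)"
    if y: "y \<in> B" and t: "t \<in> cbox 0 1" for y and t :: real
  proof -
    have ty: "t *\<^sub>R y \<in> B"
      using ray_in_ball[OF y] t by auto
    have s: "((\<lambda>y. t *\<^sub>R y) has_derivative (\<lambda>h. t *\<^sub>R h)) (at y within B)"
      by (auto intro!: derivative_eq_intros)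
    have dG: "((\<lambda>y. G (t *\<^sub>R y)) has_derivative (\<lambda>h. G' (t *\<^sub>R y) (t *\<^sub>R h))) (at y within B)"
      using has_derivative_compose[OF s deriv_G[OF ty]] .
    have "(f has_derivative blinfun_apply (f' (t *\<^sub>R y))) (at (t *\<^sub>R y))"
      using assms ty by (simp add: C1_def)
    from has_derivative_compose[OF s this]
    have df: "((\<lambda>y. f (t *\<^sub>R y)) has_derivative (\<lambda>h. f' (t *\<^sub>R y) (t *\<^sub>R h))) (at y within B)" .
    have "((\<lambda>x. G (t *\<^sub>R x) x (f (t *\<^sub>R x))) has_derivative
       (\<lambda>h. G (t *\<^sub>R y) y (f' (t *\<^sub>R y) (t *\<^sub>R h)) +
         (G (t *\<^sub>R y) h + G' (t *\<^sub>R y) (t *\<^sub>R h) y) (f (t *\<^sub>R y)))) (at y within B)"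
      by (intro blinfun.FDERIV dG df has_derivative_ident)
    moreover have "(\<lambda>h. G (t *\<^sub>R y) y (f' (t *\<^sub>R y) (t *\<^sub>R h)) +
         (G (t *\<^sub>R y) h + G' (t *\<^sub>R y) (t *\<^sub>R h) y) (f (t *\<^sub>R y))) = blinfun_apply (ray_ker f f' y t)"
      by (simp add: fun_eq_iff ray_ker_apply blinfun.bilinear_simps algebra_simps)
    ultimately show ?thesis
      by simp
  qed
  have "((\<lambda>x. integral (cbox 0 1) (\<lambda>t. G (t *\<^sub>R x) x (f (t *\<^sub>R x)))) has_derivative
      blinfun_apply (integral (cbox 0 1) (ray_ker f f' x))) (at x within B)"
  proof (rule leibniz_rule[OF ker])
    show "(\<lambda>t. G (t *\<^sub>R y) y (f (t *\<^sub>R y))) integrable_on cbox 0 1" if "y \<in> B" for y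
      using integrable_continuous_real[OF continuous_on_slice[OF ray_continuous(1)[OF assms] that]] by simp
    show "continuous_on (B \<times> cbox 0 1) (\<lambda>(x, t). ray_ker f f' x t)"
      using ray_continuous(2)[OF assms] by simp
  qed (use x in auto)
  then show "(ray_int f has_derivative blinfun_apply (ray_int' f f' x)) (at x)"
    using x at_within_open[of x B] by (simp add: ray_int_def[abs_def] ray_int'_def)
next
  show "continuous_on B (ray_int' f f')"
    using integral_continuous_on_param[of B 0 1 "ray_ker f f'"] ray_continuous(2)[OF assms]
    by (simp add: ray_int'_def[abs_def])
qed

lemma norm_G_ray_le:
  assumes "x \<in> B" "0 \<le> t" "t \<le> 1"
  shows "norm (G (t *\<^sub>R x) x w) \<le> norm w / 2"
proof -
  have "norm (G (t *\<^sub>R x) x w) \<le> norm (G (t *\<^sub>R x) x) * norm w"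
    by (rule norm_blinfun)
  also have "\<dots> \<le> (norm (G (t *\<^sub>R x)) * norm x) * norm w"
    by (intro mult_right_mono norm_blinfun) auto
  also have "\<dots> \<le> (K * \<rho>) * norm w"
    using bound_G[OF ray_in_ball[OF assms]] assms(1) K_nonneg
    by (intro mult_right_mono mult_mono) auto
  also have "\<dots> \<le> 1 / 2 * norm w"
    using small by (intro mult_right_mono) auto
  finally show ?thesis
    by simp
qed

lemma norm_ray_int_le:
  assumes "continuous_on B f" "x \<in> B" "\<And>t. t \<in> {0..1} \<Longrightarrow> norm (f (t *\<^sub>R x)) \<le> a"
  shows "norm (ray_int f x) \<le> a / 2"
proof -
  have "continuous_on (B \<times> {0..1}) (\<lambda>(x, t). G (t *\<^sub>R x) x (f (t *\<^sub>R x)))"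
    unfolding case_prod_beta
    by (intro continuous_intros continuous_on_ray[OF cont_G] continuous_on_ray[OF assms(1)])
  then have "continuous_on {0..1} (\<lambda>t. G (t *\<^sub>R x) x (f (t *\<^sub>R x)))"
    by (rule continuous_on_slice) fact
  moreover have "norm (G (t *\<^sub>R x) x (f (t *\<^sub>R x))) \<le> a / 2" if "t \<in> {0..1}" for t
    using norm_G_ray_le[OF assms(2), of t "f (t *\<^sub>R x)"] assms(3)[OF that] that by auto
  ultimately show ?thesis
    unfolding ray_int_def using integral_bound[of 0 1 _ "a / 2"] by auto
qed

text \<open>The term \<open>K a\<close> comes from varying the direction \<open>x\<close> in
  \<open>G (t x) x\<close>, the term \<open>a / 2\<close> from the derivative of \<open>G\<close>,
  where \<open>norm x < \<rho>\<close> absorbs the factor \<open>K\<close>, and \<open>b / 2\<close>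
  from the derivative of \<open>f\<close>.\<close>

lemma norm_ray_int'_le:
  assumes "C1 f f'" "x \<in> B" "\<And>y. y \<in> B \<Longrightarrow> norm (f y) \<le> a" "\<And>y. y \<in> B \<Longrightarrow> norm (f' y) \<le> b"
  shows "norm (ray_int' f f' x) \<le> (K + 1 / 2) * a + b / 2"
proof (rule norm_blinfun_bound)
  have "0 \<le> a" "0 \<le> b"
    using assms(3,4)[OF assms(2)] norm_ge_zero order_trans by blast+
  then show "0 \<le> (K + 1 / 2) * a + b / 2"
    using K_nonneg by simp
  fix h
  have cont: "continuous_on {0..1} (\<lambda>t. ray_ker f f' x t h)"
    using continuous_on_slice[OF ray_continuous(2)[OF assms(1)] assms(2)] by (intro continuous_intros)
  have bnd: "norm (ray_ker f f' x t h) \<le> ((K + 1 / 2) * a + b / 2) * norm h" if t: "t \<in> {0..1}" for t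
  proof -
    have tx: "t *\<^sub>R x \<in> B"
      using ray_in_ball[OF assms(2)] t by auto
    have 1: "norm (G (t *\<^sub>R x) h (f (t *\<^sub>R x))) \<le> (K * norm h) * a"
    proof -
      have "norm (G (t *\<^sub>R x) h (f (t *\<^sub>R x))) \<le> norm (G (t *\<^sub>R x) h) * norm (f (t *\<^sub>R x))"
        by (rule norm_blinfun)
      also have "\<dots> \<le> (norm (G (t *\<^sub>R x)) * norm h) * norm (f (t *\<^sub>R x))"
        by (intro mult_right_mono norm_blinfun) auto
      also have "\<dots> \<le> (K * norm h) * a"
        using bound_G[OF tx] assms(3)[OF tx] K_nonneg by (intro mult_mono) auto
      finally show ?thesis .
    qed
    have 2: "norm (G' (t *\<^sub>R x) h x (f (t *\<^sub>R x))) \<le> (norm h / 2) * a"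
    proof -
      have "norm (G' (t *\<^sub>R x) h x (f (t *\<^sub>R x))) \<le> norm (G' (t *\<^sub>R x) h x) * norm (f (t *\<^sub>R x))"
        by (rule norm_blinfun)
      also have "\<dots> \<le> (norm (G' (t *\<^sub>R x) h) * norm x) * norm (f (t *\<^sub>R x))"
        by (intro mult_right_mono norm_blinfun) auto
      also have "\<dots> \<le> ((norm (G' (t *\<^sub>R x)) * norm h) * norm x) * norm (f (t *\<^sub>R x))"
        by (intro mult_right_mono norm_blinfun) auto
      also have "\<dots> \<le> ((K * norm h) * \<rho>) * a"
        using bound_G'[OF tx] assms(2) assms(3)[OF tx] K_nonneg rho_pos by (intro mult_mono) auto
      also have "\<dots> = (K * \<rho>) * (norm h * a)"
        by simp
      also have "\<dots> \<le> 1 / 2 * (norm h * a)"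
        using small \<open>0 \<le> a\<close> by (intro mult_right_mono) auto
      finally show ?thesis
        by simp
    qed
    have 3: "norm (G (t *\<^sub>R x) x (f' (t *\<^sub>R x) h)) \<le> b * norm h / 2"
    proof -
      have "norm (f' (t *\<^sub>R x) h) \<le> norm (f' (t *\<^sub>R x)) * norm h"
        by (rule norm_blinfun)
      also have "\<dots> \<le> b * norm h"
        using assms(4)[OF tx] by (intro mult_right_mono) auto
      finally show ?thesis
        using norm_G_ray_le[OF assms(2), of t "f' (t *\<^sub>R x) h"] t by auto
    qed
    have "norm (ray_ker f f' x t h) \<le> norm (G (t *\<^sub>R x) h (f (t *\<^sub>R x)))
       + t * norm (G' (t *\<^sub>R x) h x (f (t *\<^sub>R x)) + G (t *\<^sub>R x) x (f' (t *\<^sub>R x) h))"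
      unfolding ray_ker_apply using t by (intro norm_triangle_le) auto
    also have "\<dots> \<le> norm (G (t *\<^sub>R x) h (f (t *\<^sub>R x)))
       + 1 * norm (G' (t *\<^sub>R x) h x (f (t *\<^sub>R x)) + G (t *\<^sub>R x) x (f' (t *\<^sub>R x) h))"
      using t by (intro add_mono mult_right_mono) auto
    also have "\<dots> \<le> norm (G (t *\<^sub>R x) h (f (t *\<^sub>R x)))
       + (norm (G' (t *\<^sub>R x) h x (f (t *\<^sub>R x))) + norm (G (t *\<^sub>R x) x (f' (t *\<^sub>R x) h)))"
      by (simp add: norm_triangle_ineq)
    also have "\<dots> \<le> (K * norm h) * a + ((norm h / 2) * a + b * norm h / 2)"
      using 1 2 3 by simp
    also have "\<dots> = ((K + 1 / 2) * a + b / 2) * norm h"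
      by (simp add: algebra_simps)
    finally show ?thesis .
  qed
  show "norm (ray_int' f f' x h) \<le> ((K + 1 / 2) * a + b / 2) * norm h"
    unfolding ray_int'_apply[OF assms(1,2)]
    using integral_bound[OF _ cont bnd] by simp
qed

text \<open>The \<open>k\<close>-th term of the Neumann series: \<open>ray_int\<close> applied
  \<open>k\<close> times to the constant \<open>w\<close>, paired with its derivative. The solution
  is the sum over \<open>k\<close>, not the limit of this sequence.\<close>

definition picard :: "'f \<Rightarrow> nat \<Rightarrow> ('e \<Rightarrow> 'f) \<times> ('e \<Rightarrow> 'e \<Rightarrow>\<^sub>L 'f)" where
  "picard w k = ((\<lambda>(f, f'). (ray_int f, ray_int' f f')) ^^ k) (\<lambda>x. w, \<lambda>x. 0)"

lemma picard_Suc: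
  "fst (picard w (Suc k)) = ray_int (fst (picard w k))"
  "snd (picard w (Suc k)) = ray_int' (fst (picard w k)) (snd (picard w k))"
  by (simp_all add: picard_def case_prod_beta)

lemma C1_picard: "C1 (fst (picard w k)) (snd (picard w k))"
proof (induction k)
  case 0
  have "((\<lambda>x. w) has_derivative blinfun_apply 0) (at x)" for x :: 'e
    by (rule has_derivative_eq_rhs[OF has_derivative_const]) (simp add: fun_eq_iff)
  then show ?case
    by (auto simp: picard_def C1_def)
qed (simp add: picard_Suc C1_ray_int)

text \<open>The values shrink by \<open>1/2\<close>, but in the recursion
  \<open>b \<mapsto> (K + 1/2) a + b / 2\<close> for the derivatives the source decays at that same
  rate, which would cost a factor \<open>k\<close>. At the slower rate \<open>3/4\<close> a bound
  \<open>c (3/4)^k\<close> reproduces itself once \<open>(K + 1/2) norm w + c / 2 = 3 c / 4\<close>,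
  that is, \<open>c = 4 (K + 1/2) norm w\<close>.\<close>

lemma norm_picard_le:
  assumes "x \<in> B"
  shows "norm (fst (picard w k) x) \<le> norm w * (3 / 4) ^ k"
    and "norm (snd (picard w k) x) \<le> 4 * (K + 1 / 2) * norm w * (3 / 4) ^ k"
proof -
  have "(\<forall>x\<in>B. norm (fst (picard w k) x) \<le> norm w * (3 / 4) ^ k) \<and>
      (\<forall>x\<in>B. norm (snd (picard w k) x) \<le> 4 * (K + 1 / 2) * norm w * (3 / 4) ^ k)"
  proof (induction k)
    case 0
    show ?case
      using K_nonneg by (auto simp: picard_def)
  next
    case (Suc k)
    have "norm (fst (picard w (Suc k)) x) \<le> norm w * (3 / 4) ^ Suc k" if x: "x \<in> B" for x
    proof -
      have "norm (fst (picard w (Suc k)) x) \<le> norm w * (3 / 4) ^ k / 2"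
        unfolding picard_Suc
        by (rule norm_ray_int_le[OF C1_cont[OF C1_picard] x]) (use Suc ray_in_ball[OF x] in auto)
      also have "\<dots> \<le> norm w * (3 / 4) ^ Suc k"
        by simp
      finally show ?thesis .
    qed
    moreover have "norm (snd (picard w (Suc k)) x) \<le> 4 * (K + 1 / 2) * norm w * (3 / 4) ^ Suc k"
      if x: "x \<in> B" for x
    proof -
      have "norm (snd (picard w (Suc k)) x)
        \<le> (K + 1 / 2) * (norm w * (3 / 4) ^ k) + (4 * (K + 1 / 2) * norm w * (3 / 4) ^ k) / 2"
        unfolding picard_Suc
        by (rule norm_ray_int'_le[OF C1_picard x]) (use Suc in auto)
      also have "\<dots> = 4 * (K + 1 / 2) * norm w * (3 / 4) ^ Suc k"
        by (simp add: algebra_simps)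
      finally show ?thesis .
    qed
    ultimately show ?case
      by blast
  qed
  then show "norm (fst (picard w k) x) \<le> norm w * (3 / 4) ^ k"
    "norm (snd (picard w k) x) \<le> 4 * (K + 1 / 2) * norm w * (3 / 4) ^ k"
    using assms by auto
qed

lemma ray_int_diff:
  assumes "continuous_on B f" "continuous_on B g" "x \<in> B"
  shows "ray_int f x - ray_int g x = ray_int (\<lambda>y. f y - g y) x"
proof -
  have "continuous_on {0..1} (\<lambda>t. G (t *\<^sub>R x) x (k (t *\<^sub>R x)))" if "continuous_on B k" for k :: "'e \<Rightarrow> 'f"
    by (rule continuous_on_slice[OF _ assms(3)], unfold case_prod_beta)
      (intro continuous_intros continuous_on_ray[OF cont_G] continuous_on_ray[OF that])
  then show ?thesis
    using assms(1,2) unfolding ray_int_def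
    by (subst integral_diff[symmetric]) (auto intro: integrable_continuous_real simp: blinfun.bilinear_simps)
qed

lemma ray_fixed_point:
  "\<exists>g g'. C1 g g' \<and> (\<forall>x\<in>B. g x = w + ray_int g x)"
proof -
  let ?f = "\<lambda>k. fst (picard w k)" and ?f' = "\<lambda>k. snd (picard w k)"
  define g where "g = (\<lambda>x. \<Sum>k. ?f k x)"
  define g' where "g' = (\<lambda>x. \<Sum>k. ?f' k x)"
  have geo: "summable (\<lambda>k. c * (3 / 4 :: real) ^ k)" for c
    by (intro summable_mult summable_geometric) auto
  have ul: "uniform_limit B (\<lambda>n x. \<Sum>k<n. ?f k x) g sequentially"
    unfolding g_def by (rule Weierstrass_m_test[OF norm_picard_le(1) geo])
  have ul': "uniform_limit B (\<lambda>n x. \<Sum>k<n. ?f' k x) g' sequentially"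
    unfolding g'_def by (rule Weierstrass_m_test[OF norm_picard_le(2) geo])
  have cont_f: "continuous_on B (?f k)" and cont_f': "continuous_on B (?f' k)" for k
    using C1_picard C1_cont C1_def by blast+
  have cont_g: "continuous_on B g" and cont_g': "continuous_on B g'"
    by (rule uniform_limit_theorem[OF _ ul] uniform_limit_theorem[OF _ ul'],
        auto intro!: always_eventually continuous_on_sum cont_f cont_f')+
  have sums: "(\<lambda>k. ?f k x) sums g x" if "x \<in> B" for x
    unfolding sums_def using tendsto_uniform_limitI[OF ul that] .
  \<comment> \<open>Termwise differentiation yields some sum function \<open>h\<close> of the
    series; it agrees with \<open>g\<close> on the ball because limits are unique.\<close>
  have "\<exists>h. \<forall>x\<in>B. (\<lambda>k. ?f k x) sums h x \<and> (h has_derivative blinfun_apply (g' x)) (at x within B)"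
  proof (rule has_derivative_series)
    show "(?f k has_derivative blinfun_apply (?f' k x)) (at x within B)" if "x \<in> B" for k x
      using C1_picard[of w k] that by (auto simp: C1_def intro: has_derivative_at_withinI)
    show "\<forall>\<^sub>F n in sequentially. \<forall>x\<in>B. \<forall>h. norm ((\<Sum>i<n. ?f' i x h) - g' x h) \<le> e * norm h" if "e > 0" for e
      using uniform_limitD[OF ul' that]
    proof (eventually_elim, intro ballI allI)
      fix n x h
      assume "\<forall>x\<in>B. dist (\<Sum>k<n. ?f' k x) (g' x) < e" "x \<in> B"
      then have "norm ((\<Sum>k<n. ?f' k x) - g' x) \<le> e"
        by (metis dist_norm less_imp_le)
      then have "norm (((\<Sum>k<n. ?f' k x) - g' x) h) \<le> e * norm h"
        by (meson mult_right_mono norm_blinfun norm_ge_zero order_trans)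
      then show "norm ((\<Sum>i<n. ?f' i x h) - g' x h) \<le> e * norm h"
        by (simp add: blinfun.bilinear_simps blinfun.sum_left)
    qed
    show "0 \<in> B"
      using rho_pos by simp
    then show "(\<lambda>k. ?f k 0) sums g 0"
      by (rule sums)
  qed simp
  then obtain h where h: "\<And>x. x \<in> B \<Longrightarrow> (\<lambda>k. ?f k x) sums h x"
    "\<And>x. x \<in> B \<Longrightarrow> (h has_derivative blinfun_apply (g' x)) (at x within B)"
    by blast
  have "(g has_derivative blinfun_apply (g' x)) (at x)" if x: "x \<in> B" for x
  proof -
    have "(h has_derivative blinfun_apply (g' x)) (at x)"
      using h(2)[OF x] x at_within_open[of x B] by simp
    then show ?thesis
      by (rule has_derivative_transform_within_open[OF _ open_ball x])
        (use sums h(1) sums_unique2 in blast)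
  qed
  then have C1: "C1 g g'"
    using cont_g' by (simp add: C1_def)
  have "g x = w + ray_int g x" if x: "x \<in> B" for x
  proof -
    let ?s = "\<lambda>n y. \<Sum>k<n. ?f k y"
    have cont_s: "continuous_on B (?s n)" for n
      by (intro continuous_on_sum cont_f)
    \<comment> \<open>Telescoping: \<open>ray_int\<close> maps each term of the series to the next
      one, so only the leading term \<open>w\<close> is lost.\<close>
    have rec: "ray_int (?s n) x = ?s (Suc n) x - w" for n
    proof (induction n)
      case 0
      show ?case
        by (simp add: ray_int_def picard_def)
    next
      case (Suc n)
      have "ray_int (?s (Suc n)) x - ray_int (?s n) x = ray_int (?f n) x"
        using ray_int_diff[OF cont_s cont_s x, of "Suc n" n] by simp
      then show ?case
        using Suc by (simp add: picard_Suc algebra_simps)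
    qed
    have "(\<lambda>n. ray_int (?s n) x) \<longlonglongrightarrow> ray_int g x"
    proof (rule metric_LIMSEQ_I)
      fix e :: real assume "e > 0"
      then obtain N where N: "\<And>n y. n \<ge> N \<Longrightarrow> y \<in> B \<Longrightarrow> dist (?s n y) (g y) < e"
        using uniform_limitD[OF ul] unfolding eventually_sequentially by blast
      have "dist (ray_int (?s n) x) (ray_int g x) < e" if "n \<ge> N" for n
      proof -
        have "norm (ray_int (\<lambda>y. ?s n y - g y) x) \<le> e / 2"
        proof (rule norm_ray_int_le[OF _ x])
          show "continuous_on B (\<lambda>y. ?s n y - g y)"
            by (intro continuous_on_diff cont_s cont_g)
          show "norm (?s n (t *\<^sub>R x) - g (t *\<^sub>R x)) \<le> e" if "t \<in> {0..1}" for t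
            using N[OF \<open>n \<ge> N\<close> ray_in_ball[OF x, of t]] that by (auto simp: dist_norm)
        qed
        then show ?thesis
          using ray_int_diff[OF cont_s cont_g x] \<open>e > 0\<close> by (simp add: dist_norm)
      qed
      then show "\<exists>N. \<forall>n\<ge>N. dist (ray_int (?s n) x) (ray_int g x) < e"
        by blast
    qed
    moreover have "(\<lambda>n. ?s (Suc n) x - w) \<longlonglongrightarrow> g x - w"
      using sums[OF x] by (intro tendsto_diff tendsto_const LIMSEQ_Suc) (simp add: sums_def)
    ultimately have "ray_int g x = g x - w"
      using rec LIMSEQ_unique by simp
    then show ?thesis
      by simp
  qed
  with C1 show ?thesis
    by blast
qed

text \<open>The integrand is the derivative of \<open>t G(t x) v (f (t x))\<close>, which vanishes
  at \<open>t = 0\<close>.\<close>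

lemma ray_derivative_integral:
  assumes "C1 f f'" "x \<in> B"
  shows "((\<lambda>t. G (t *\<^sub>R x) v (f (t *\<^sub>R x))
      + t *\<^sub>R (G' (t *\<^sub>R x) x v (f (t *\<^sub>R x)) + G (t *\<^sub>R x) v (f' (t *\<^sub>R x) x)))
    has_integral G x v (f x)) {0..1}"
proof -
  have "((\<lambda>t. t *\<^sub>R G (t *\<^sub>R x) v (f (t *\<^sub>R x))) has_vector_derivative
     G (t *\<^sub>R x) v (f (t *\<^sub>R x))
      + t *\<^sub>R (G' (t *\<^sub>R x) x v (f (t *\<^sub>R x)) + G (t *\<^sub>R x) v (f' (t *\<^sub>R x) x))) (at t within {0..1})"
    if t: "t \<in> {0..1}" for t
  proof -
    have tx: "t *\<^sub>R x \<in> B"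
      using ray_in_ball[OF assms(2)] t by auto
    have s: "((\<lambda>t. t *\<^sub>R x) has_derivative (\<lambda>h. h *\<^sub>R x)) (at t within {0..1})"
      by (auto intro!: derivative_eq_intros)
    have dG: "((\<lambda>t. G (t *\<^sub>R x)) has_derivative (\<lambda>h. G' (t *\<^sub>R x) (h *\<^sub>R x))) (at t within {0..1})"
      using has_derivative_compose[OF s deriv_G[OF tx]] .
    have "(f has_derivative blinfun_apply (f' (t *\<^sub>R x))) (at (t *\<^sub>R x))"
      using assms tx by (simp add: C1_def)
    from has_derivative_compose[OF s this]
    have df: "((\<lambda>t. f (t *\<^sub>R x)) has_derivative (\<lambda>h. f' (t *\<^sub>R x) (h *\<^sub>R x))) (at t within {0..1})" .
    have "((\<lambda>t. t *\<^sub>R G (t *\<^sub>R x) v (f (t *\<^sub>R x))) has_derivative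
      (\<lambda>h. t *\<^sub>R (G (t *\<^sub>R x) v (f' (t *\<^sub>R x) (h *\<^sub>R x)) +
         (G (t *\<^sub>R x) 0 + G' (t *\<^sub>R x) (h *\<^sub>R x) v) (f (t *\<^sub>R x))) + h *\<^sub>R G (t *\<^sub>R x) v (f (t *\<^sub>R x))))
      (at t within {0..1})"
      by (intro has_derivative_scaleR blinfun.FDERIV dG df has_derivative_ident has_derivative_const)
    then show ?thesis
      by (simp add: has_vector_derivative_def blinfun.bilinear_simps algebra_simps)
  qed
  from fundamental_theorem_of_calculus[OF _ this] show ?thesis
    by simp
qed

text \<open>By integrability the defect \<open>W(x)v = f'(x)v - G(x)v f(x)\<close> satisfies
  \<open>W(x)v = \<integral>\<^sub>0\<^sup>1 t G(tx)x W(tx)v dt\<close>, hence vanishes since the kernel has norm at most \<open>1/2\<close>.\<close>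

lemma solution_exists:
  assumes integrable: "\<And>x u v w. x \<in> B \<Longrightarrow>
    G' x u v w + G x v (G x u w) = G' x v u w + G x u (G x v w)"
  shows "\<exists>f. f 0 = w0 \<and> (\<forall>x\<in>B. (f has_derivative (\<lambda>u. G x u (f x))) (at x))"
proof -
  obtain f f' where f: "C1 f f'" and fixp: "\<And>x. x \<in> B \<Longrightarrow> f x = w0 + ray_int f x"
    using ray_fixed_point by blast
  have cont: "continuous_on {0..1} (\<lambda>t. ray_ker f f' x t v)" if "x \<in> B" for x v
    using continuous_on_slice[OF ray_continuous(2)[OF f] that] by (intro continuous_intros)
  have f'_eq: "f' x = ray_int' f f' x" if x: "x \<in> B" for x
  proof -
    have "((\<lambda>x. w0 + ray_int f x) has_derivative blinfun_apply (ray_int' f f' x)) (at x)"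
      using C1_ray_int[OF f] x by (auto simp: C1_def intro!: derivative_eq_intros)
    then have "(f has_derivative blinfun_apply (ray_int' f f' x)) (at x)"
      by (rule has_derivative_transform_within_open[OF _ open_ball x]) (simp add: fixp)
    moreover have "(f has_derivative blinfun_apply (f' x)) (at x)"
      using f x by (simp add: C1_def)
    ultimately show ?thesis
      using has_derivative_unique blinfun_apply_inject by blast
  qed
  \<comment> \<open>For \<open>h = x\<close> the kernel is exactly the integrand of
    \<open>ray_derivative_integral\<close> with \<open>v = x\<close>.\<close>
  have radial: "f' x x = G x x (f x)" if x: "x \<in> B" for x
  proof -
    have "f' x x = integral {0..1} (\<lambda>t. ray_ker f f' x t x)"
      using f'_eq[OF x] ray_int'_apply[OF f x] by simp
    also have "\<dots> = G x x (f x)"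
      unfolding ray_ker_apply by (rule integral_unique[OF ray_derivative_integral[OF f x]])
    finally show ?thesis .
  qed
  define W where "W = (\<lambda>x v. f' x v - G x v (f x))"
  have W_int: "((\<lambda>t. t *\<^sub>R G (t *\<^sub>R x) x (W (t *\<^sub>R x) v)) has_integral W x v) {0..1}" if x: "x \<in> B" for x v
  proof -
    have "((\<lambda>t. ray_ker f f' x t v) has_integral f' x v) {0..1}"
      using integrable_integral[OF integrable_continuous_real[OF cont[OF x]]]
      by (simp add: f'_eq[OF x] ray_int'_apply[OF f x])
    from has_integral_diff[OF this ray_derivative_integral[OF f x, of v]]
    have "((\<lambda>t. ray_ker f f' x t v - (G (t *\<^sub>R x) v (f (t *\<^sub>R x))
      + t *\<^sub>R (G' (t *\<^sub>R x) x v (f (t *\<^sub>R x)) + G (t *\<^sub>R x) v (f' (t *\<^sub>R x) x)))) has_integral W x v) {0..1}"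
      by (simp add: W_def)
    then show ?thesis
    proof (rule has_integral_eq[rotated])
      fix t :: real assume t: "t \<in> {0..1}"
      have tx: "t *\<^sub>R x \<in> B"
        using ray_in_ball[OF x] t by auto
      have "t *\<^sub>R G (t *\<^sub>R x) v (f' (t *\<^sub>R x) x) = G (t *\<^sub>R x) v (f' (t *\<^sub>R x) (t *\<^sub>R x))"
        by (simp add: blinfun.bilinear_simps)
      also have "\<dots> = t *\<^sub>R G (t *\<^sub>R x) v (G (t *\<^sub>R x) x (f (t *\<^sub>R x)))"
        unfolding radial[OF tx] by (simp add: blinfun.bilinear_simps)
      finally have rad: "t *\<^sub>R G (t *\<^sub>R x) v (f' (t *\<^sub>R x) x) = t *\<^sub>R G (t *\<^sub>R x) v (G (t *\<^sub>R x) x (f (t *\<^sub>R x)))" .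
      \<comment> \<open>Integrability exchanges the two directions in \<open>G'\<close>. The
        commutator left behind cancels the radial term and completes \<open>G x (f' v)\<close> to
        \<open>G x (W v)\<close>, all taken at \<open>t x\<close>.\<close>
      have int: "G' (t *\<^sub>R x) v x (f (t *\<^sub>R x)) = G' (t *\<^sub>R x) x v (f (t *\<^sub>R x))
        + G (t *\<^sub>R x) v (G (t *\<^sub>R x) x (f (t *\<^sub>R x))) - G (t *\<^sub>R x) x (G (t *\<^sub>R x) v (f (t *\<^sub>R x)))"
        using integrable[OF tx, of v x "f (t *\<^sub>R x)"] by (simp add: algebra_simps)
      show "ray_ker f f' x t v - (G (t *\<^sub>R x) v (f (t *\<^sub>R x))
          + t *\<^sub>R (G' (t *\<^sub>R x) x v (f (t *\<^sub>R x)) + G (t *\<^sub>R x) v (f' (t *\<^sub>R x) x)))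
        = t *\<^sub>R G (t *\<^sub>R x) x (W (t *\<^sub>R x) v)"
        unfolding ray_ker_apply W_def scaleR_add_right rad int
        by (simp add: blinfun.bilinear_simps scaleR_add_right scaleR_diff_right)
    qed
  qed
  have W_zero: "W x v = 0" if x: "x \<in> B" for x v
  proof -
    have "continuous_on B (\<lambda>y. W y v)"
      unfolding W_def using f cont_G C1_cont[OF f] by (auto simp: C1_def intro!: continuous_intros)
    then have cW: "continuous_on {0..1} (\<lambda>t. norm (W (t *\<^sub>R x) v))"
      by (intro continuous_on_norm continuous_on_compose2[of B "\<lambda>y. W y v" "{0..1}" "\<lambda>t. t *\<^sub>R x"])
        (use ray_in_ball[OF x] in \<open>auto intro!: continuous_intros simp del: mem_ball\<close>)
    \<comment> \<open>At a point where \<open>norm (W (t x) v)\<close> is maximal along the segment,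
      the integral equation bounds the maximum by half of itself.\<close>
    obtain s where s: "s \<in> {0..1}" and max: "\<And>t. t \<in> {0..1} \<Longrightarrow> norm (W (t *\<^sub>R x) v) \<le> norm (W (s *\<^sub>R x) v)"
      using continuous_attains_sup[OF compact_Icc _ cW] by auto
    let ?y = "s *\<^sub>R x" and ?m = "norm (W (s *\<^sub>R x) v)"
    have y: "?y \<in> B"
      using ray_in_ball[OF x] s by auto
    have "norm (W ?y v) \<le> ?m / 2 * measure lborel (cbox 0 (1::real))"
    proof (rule has_integral_bound)
      show "((\<lambda>t. t *\<^sub>R G (t *\<^sub>R ?y) ?y (W (t *\<^sub>R ?y) v)) has_integral W ?y v) (cbox 0 1)"
        using W_int[OF y] by simp
      fix t :: real assume "t \<in> cbox 0 1"
      then have t: "0 \<le> t" "t \<le> 1"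
        by auto
      have "norm (t *\<^sub>R G (t *\<^sub>R ?y) ?y (W (t *\<^sub>R ?y) v)) \<le> 1 * norm (G (t *\<^sub>R ?y) ?y (W (t *\<^sub>R ?y) v))"
        unfolding norm_scaleR using t by (intro mult_right_mono) auto
      also have "\<dots> \<le> norm (W (t *\<^sub>R ?y) v) / 2"
        using norm_G_ray_le[OF y t] by simp
      also have "\<dots> \<le> ?m / 2"
        using max[of "t * s"] t s by (simp add: mult_le_one)
      finally show "norm (t *\<^sub>R G (t *\<^sub>R ?y) ?y (W (t *\<^sub>R ?y) v)) \<le> ?m / 2" .
    qed simp
    then have "?m = 0"
      by simp
    then show ?thesis
      using max[of 1] by simp
  qed
  have "f 0 = w0"
    using fixp[of 0] rho_pos by (simp add: ray_int_def blinfun.bilinear_simps)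
  moreover have "(f has_derivative (\<lambda>u. G x u (f x))) (at x)" if "x \<in> B" for x
  proof -
    have "blinfun_apply (f' x) = (\<lambda>u. G x u (f x))"
      using W_zero[OF that] by (auto simp: W_def fun_eq_iff)
    moreover have "(f has_derivative blinfun_apply (f' x)) (at x)"
      using f that by (simp add: C1_def)
    ultimately show ?thesis
      by simp
  qed
  ultimately show ?thesis
    by blast
qed

end

text \<open>Shrinking the radius below \<open>1 / (2 K)\<close> gives the contraction. As
  \<open>K\<close> depends on the coefficients only, a single ball works for every initial value
  \<open>w\<close>.\<close>

lemma linear_total_equation_blinfun:
  fixes G :: "'e::euclidean_space \<Rightarrow> 'e \<Rightarrow>\<^sub>L ('f::banach \<Rightarrow>\<^sub>L 'f)"
  assumes "open U" "0 \<in> U"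
    and dG: "\<And>x. x \<in> U \<Longrightarrow> (G has_derivative blinfun_apply (G' x)) (at x)"
    and cG': "continuous_on U G'"
    and int: "\<And>x u v w. x \<in> U \<Longrightarrow> G' x u v w + G x v (G x u w) = G' x v u w + G x u (G x v w)"
  shows "\<exists>r>0. ball 0 r \<subseteq> U \<and>
    (\<forall>w. \<exists>f. f 0 = w \<and> (\<forall>x\<in>ball 0 r. (f has_derivative (\<lambda>u. G x u (f x))) (at x)))"
proof -
  \<comment> \<open>The summand \<open>1\<close> is the slack for continuity: as long as
    \<open>G\<close> and \<open>G'\<close> stay within distance \<open>1\<close> of their values at
    \<open>0\<close>, their norms are at most \<open>K\<close>.\<close>
  define K where "K = max (norm (G 0)) (norm (G' 0)) + 1"
  have cG: "continuous_on U G"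
    by (auto intro!: continuous_at_imp_continuous_on has_derivative_continuous dG)
  have iso: "isCont G 0" "isCont G' 0"
    using cG cG' assms(1,2) continuous_on_eq_continuous_at by blast+
  obtain d1 where d1: "d1 > 0" "\<And>x. dist x 0 < d1 \<Longrightarrow> dist (G x) (G 0) < 1"
    using iso(1) unfolding continuous_at_eps_delta by (metis zero_less_one)
  obtain d2 where d2: "d2 > 0" "\<And>x. dist x 0 < d2 \<Longrightarrow> dist (G' x) (G' 0) < 1"
    using iso(2) unfolding continuous_at_eps_delta by (metis zero_less_one)
  obtain d3 where d3: "d3 > 0" "ball 0 d3 \<subseteq> U"
    using assms(1,2) open_contains_ball by blast
  have K: "K > 0"
    unfolding K_def by (smt (verit) norm_ge_zero)
  define r where "r = Min {d1, d2, d3, 1 / (2 * K)}"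
  have r: "r > 0" "r \<le> d1" "r \<le> d2" "r \<le> d3" "r \<le> 1 / (2 * K)"
    using d1 d2 d3 K by (auto simp: r_def)
  have nle: "norm a \<le> K" if "dist a b < 1" "norm b \<le> K - 1" for a b :: "'z::real_normed_vector"
    using that norm_triangle_ineq2[of a b] by (simp add: dist_norm)
  interpret ray_system G G' r K
  proof
    show "norm (G x) \<le> K" if "x \<in> ball 0 r" for x
      using that r by (intro nle[OF d1(2)]) (auto simp: K_def)
    show "norm (G' x) \<le> K" if "x \<in> ball 0 r" for x
      using that r by (intro nle[OF d2(2)]) (auto simp: K_def)
    have "ball 0 r \<subseteq> U"
      using r d3 by (auto simp: subset_iff)
    then show "continuous_on (ball 0 r) G'" "\<And>x. x \<in> ball 0 r \<Longrightarrow> (G has_derivative blinfun_apply (G' x)) (at x)"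
      using cG' dG continuous_on_subset by blast+
    show "K * r \<le> 1 / 2"
      using r(5) K by (simp add: field_simps)
  qed (use r in auto)
  have sub: "ball 0 r \<subseteq> U"
    using r d3 by (auto simp: subset_iff)
  show ?thesis
    using solution_exists int sub r(1) by blast
qed

text \<open>Smoothness of \<open>H\<close> is given one pair of arguments at a time, while the ray
  construction wants a smooth operator-valued map. \<open>G\<close> is a finite sum of rank-one maps
  \<open>u \<mapsto> w \<mapsto> (u \<bullet> b) (w \<bullet> d) y\<close> with
  \<open>y = H x b d\<close>, hence a linear image of smooth functions.\<close>

lemma smooth_on_bilinear_field_blinfun:
  fixes H :: "'e::euclidean_space \<Rightarrow> 'e \<Rightarrow> 'f::euclidean_space \<Rightarrow> 'f"
  assumes "open U" "\<And>u w. smooth_on U (\<lambda>x. H x u w)"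
    and "\<And>x. x \<in> U \<Longrightarrow> bilinear (H x)"
  shows "\<exists>G :: 'e \<Rightarrow> 'e \<Rightarrow>\<^sub>L ('f \<Rightarrow>\<^sub>L 'f). smooth_on U G \<and>
    (\<forall>x\<in>U. \<forall>u w. blinfun_apply (blinfun_apply (G x) u) w = H x u w)"
proof -
  define L :: "'e \<Rightarrow> 'f \<Rightarrow> 'f \<Rightarrow> 'e \<Rightarrow>\<^sub>L ('f \<Rightarrow>\<^sub>L 'f)" where
    "L b d y = blinfun_scaleR_left (blinfun_scaleR_left y o\<^sub>L blinfun_inner_left d) o\<^sub>L blinfun_inner_left b"
    for b d y
  define G where "G x = (\<Sum>b\<in>Basis. \<Sum>d\<in>Basis. L b d (H x b d))" for x
  have L: "bounded_linear (L b d)" for b d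
    unfolding L_def by (intro bounded_linear_intros)
  have "smooth_on U G"
    unfolding G_def by (intro smooth_on_sum smooth_on_linear[OF L] assms)
  moreover have "G x u w = H x u w" if "x \<in> U" for x u w
  proof -
    have "linear (\<lambda>u. H x u w)" "\<And>u. linear (H x u)"
      using assms(3)[OF that] by (auto simp: bilinear_def)
    then have "H x u w = (\<Sum>b\<in>Basis. (u \<bullet> b) *\<^sub>R (\<Sum>d\<in>Basis. (w \<bullet> d) *\<^sub>R H x b d))"
      using linear_expand_Basis[of "\<lambda>u. H x u w" u] linear_expand_Basis[of "H x b" w for b] by simp
    then show ?thesis
      by (simp add: G_def L_def blinfun.sum_left blinfun.bilinear_simps scaleR_sum_right)
  qed
  ultimately show ?thesis
    by blast
qed

text \<open>Bootstrapping: if \<open>f\<close> has \<open>k\<close> continuous derivatives, so does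
  the right-hand side \<open>H x v (f x)\<close>, which is the derivative of
  \<open>f\<close>.\<close>

lemma smooth_on_total_equation:
  fixes H :: "'e::euclidean_space \<Rightarrow> 'e \<Rightarrow> 'f::euclidean_space \<Rightarrow> 'f"
  assumes "open U" "\<And>u w. smooth_on U (\<lambda>x. H x u w)"
    and "\<And>x. x \<in> U \<Longrightarrow> bilinear (H x)"
    and "\<And>x. x \<in> U \<Longrightarrow> (f has_derivative (\<lambda>u. H x u (f x))) (at x)"
  shows "smooth_on U f"
  unfolding smooth_on_def
proof
  show "Ck_on k U f" for k
  proof (induction k)
    case 0
    show ?case
      using assms(4) by (auto intro!: continuous_at_imp_continuous_on has_derivative_continuous)
  next
    case (Suc k)
    show ?case
    proof (rule Ck_on_SucI[OF assms(1,4)])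
      show "Ck_on k U (\<lambda>x. H x v (f x))" for v
        by (rule Ck_on_apply_linear[OF assms(1) _ smooth_onD[OF assms(2)] Suc]) (use assms(3) in \<open>auto simp: bilinear_def\<close>)
    qed
  qed
qed

text \<open>Hypothesis \<open>int\<close> is the symmetry of the second derivative of a would-be
  solution: differentiating \<open>H x v (f x)\<close> along \<open>u\<close> and inserting the
  equation once more gives its left-hand side at \<open>w = f x\<close>.\<close>

theorem linear_total_equation:
  fixes H :: "'e::euclidean_space \<Rightarrow> 'e \<Rightarrow> 'f::euclidean_space \<Rightarrow> 'f"
  assumes "open U" "a \<in> U" and smooth: "\<And>u w. smooth_on U (\<lambda>x. H x u w)"
    and bil: "\<And>x. x \<in> U \<Longrightarrow> bilinear (H x)"
    and int: "\<And>x u v w. x \<in> U \<Longrightarrow>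
      frechet_derivative (\<lambda>y. H y v w) (at x) u + H x v (H x u w)
      = frechet_derivative (\<lambda>y. H y u w) (at x) v + H x u (H x v w)"
  shows "\<exists>r>0. ball a r \<subseteq> U \<and>
    (\<forall>w. \<exists>f. f a = w \<and> smooth_on (ball a r) f \<and>
      (\<forall>x\<in>ball a r. (f has_derivative (\<lambda>u. H x u (f x))) (at x)))"
proof -
  obtain G :: "'e \<Rightarrow> 'e \<Rightarrow>\<^sub>L ('f \<Rightarrow>\<^sub>L 'f)" where sG: "smooth_on U G" and G: "\<And>x u w. x \<in> U \<Longrightarrow> blinfun_apply (blinfun_apply (G x) u) w = H x u w"
    using smooth_on_bilinear_field_blinfun[OF assms(1) smooth bil] by blast
  define G' where "G' x = Blinfun (frechet_derivative G (at x))" for x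
  have G'_apply: "blinfun_apply (G' x) = frechet_derivative G (at x)" if "x \<in> U" for x
    unfolding G'_def
    by (rule bounded_linear_Blinfun_apply[OF has_derivative_bounded_linear[OF smooth_on_has_derivative[OF sG that]]])
  have G'_H: "G' x u v w = frechet_derivative (\<lambda>y. H y v w) (at x) u" if x: "x \<in> U" for x u v w
  proof -
    have "(G has_derivative blinfun_apply (G' x)) (at x)"
      using smooth_on_has_derivative[OF sG x] G'_apply[OF x] by simp
    then have "((\<lambda>y. G y v w) has_derivative (\<lambda>u. G' x u v w)) (at x)"
      by (auto intro!: derivative_eq_intros simp: blinfun.bilinear_simps)
    then have "((\<lambda>y. H y v w) has_derivative (\<lambda>u. G' x u v w)) (at x)"
      by (rule has_derivative_transform_within_open[OF _ assms(1) x]) (simp add: G)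
    then show ?thesis
      by (simp add: frechet_derivative_works_at)
  qed
  let ?T = "(\<lambda>x. a + x) -` U"
  have T: "open ?T" "0 \<in> ?T"
    using assms(1,2) by (auto intro!: open_vimage continuous_intros)
  have "\<exists>r>0. ball 0 r \<subseteq> ?T \<and>
    (\<forall>w. \<exists>f. f 0 = w \<and> (\<forall>x\<in>ball 0 r. (f has_derivative (\<lambda>u. G (a + x) u (f x))) (at x)))"
  proof (rule linear_total_equation_blinfun[OF T, where G' = "\<lambda>x. G' (a + x)"])
    show "((\<lambda>x. G (a + x)) has_derivative blinfun_apply (G' (a + x))) (at x)" if "x \<in> ?T" for x
    proof -
      have "((\<lambda>x. a + x) has_derivative (\<lambda>h. h)) (at x)"
        by (auto intro!: derivative_eq_intros)
      moreover have "(G has_derivative blinfun_apply (G' (a + x))) (at (a + x))"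
        using smooth_on_has_derivative[OF sG, of "a + x"] G'_apply[of "a + x"] that by simp
      ultimately show ?thesis
        by (rule has_derivative_compose)
    qed
    have "continuous_on U G'"
    proof (rule continuous_on_blinfun_componentwise)
      show "continuous_on U (\<lambda>x. G' x i)" for i
        using smooth_on_continuous_on[OF smooth_on_deriv[OF sG, of i]]
        by (rule continuous_on_eq) (simp add: G'_apply)
    qed
    then show "continuous_on ?T (\<lambda>x. G' (a + x))"
      by (rule continuous_on_compose2) (auto intro!: continuous_intros)
    show "G' (a + x) u v w + G (a + x) v (G (a + x) u w) = G' (a + x) v u w + G (a + x) u (G (a + x) v w)"
      if "x \<in> ?T" for x u v w
      using that int by (simp add: G'_H G)
  qed
  then obtain r where r: "r > 0" "ball 0 r \<subseteq> ?T" and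
    sol: "\<And>w. \<exists>f. f 0 = w \<and> (\<forall>x\<in>ball 0 r. (f has_derivative (\<lambda>u. G (a + x) u (f x))) (at x))"
    by blast
  have sub: "ball a r \<subseteq> U"
  proof
    fix x assume "x \<in> ball a r"
    then have "x - a \<in> ball 0 r"
      by (simp add: dist_norm norm_minus_commute)
    then show "x \<in> U"
      using r(2) by auto
  qed
  have "\<exists>f. f a = w \<and> smooth_on (ball a r) f \<and> (\<forall>x\<in>ball a r. (f has_derivative (\<lambda>u. H x u (f x))) (at x))" for w
  proof -
    obtain f where f: "f 0 = w" "\<And>x. x \<in> ball 0 r \<Longrightarrow> (f has_derivative (\<lambda>u. G (a + x) u (f x))) (at x)"
      using sol by blast
    define h where "h x = f (x - a)" for x
    have dh: "(h has_derivative (\<lambda>u. H x u (h x))) (at x)" if x: "x \<in> ball a r" for x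
    proof -
      have "((\<lambda>x. x - a) has_derivative (\<lambda>h. h)) (at x)"
        by (auto intro!: derivative_eq_intros)
      moreover have "(f has_derivative (\<lambda>u. H x u (h x))) (at (x - a))"
        using f(2)[of "x - a"] x sub G[of x] by (auto simp: dist_norm norm_minus_commute h_def)
      ultimately show ?thesis
        unfolding h_def by (rule has_derivative_compose)
    qed
    have "smooth_on (ball a r) h"
      by (rule smooth_on_total_equation[where H = H])
        (use sub smooth bil smooth_on_subset dh in blast)+
    moreover have "h a = w"
      by (simp add: h_def f)
    ultimately show ?thesis
      using dh by blast
  qed
  with r(1) sub show ?thesis
    by blast
qed

section \<open>Smooth inverse functions\<close>

lemma Ck_on_inverse_real:
  fixes f :: "'a::euclidean_space \<Rightarrow> real"
  assumes "open S" "Ck_on k S f" "\<And>x. x \<in> S \<Longrightarrow> f x \<noteq> 0"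
  shows "Ck_on k S (\<lambda>x. inverse (f x))"
  using assms(2)
proof (induction k)
  case 0
  then show ?case
    using assms(3) by (auto intro!: continuous_on_inverse)
next
  case (Suc k)
  show ?case
  proof (rule Ck_on_SucI[OF assms(1)])
    show "((\<lambda>x. inverse (f x)) has_derivative
        (\<lambda>v. - (inverse (f x) * frechet_derivative f (at x) v * inverse (f x)))) (at x)" if "x \<in> S" for x
      using Suc.prems that assms(3)
      by (intro Deriv.has_derivative_inverse) (simp_all add: frechet_derivative_works[symmetric])
    have inv: "Ck_on k S (\<lambda>x. inverse (f x))"
      using Suc.IH Ck_on_SucD[OF Suc.prems] by blast
    show "Ck_on k S (\<lambda>x. - (inverse (f x) * frechet_derivative f (at x) v * inverse (f x)))" for v
      using Suc.prems
      by (intro Ck_on_linear[OF bounded_linear_minus[OF bounded_linear_ident] assms(1)]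
          Ck_on_bilinear[OF bounded_bilinear_mult assms(1)] inv) simp
  qed
qed

lemma Ck_on_prod:
  fixes f :: "'i \<Rightarrow> 'a::euclidean_space \<Rightarrow> real"
  assumes "open S" "\<And>i. i \<in> I \<Longrightarrow> Ck_on k S (f i)"
  shows "Ck_on k S (\<lambda>x. \<Prod>i\<in>I. f i x)"
  using assms(2)
proof (induction I rule: infinite_finite_induct)
  case (insert i I)
  then show ?case
    by (simp del: Ck_on.simps add: Ck_on_bilinear[OF bounded_bilinear_mult assms(1)])
qed (simp_all del: Ck_on.simps add: Ck_on_const)

lemma Ck_on_det:
  fixes M :: "'a::euclidean_space \<Rightarrow> real^'n^'n"
  assumes "open S" "\<And>i j. Ck_on k S (\<lambda>x. M x $ i $ j)"
  shows "Ck_on k S (\<lambda>x. det (M x))"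
  unfolding det_def
  by (intro Ck_on_sum[OF assms(1)] Ck_on_bilinear[OF bounded_bilinear_mult assms(1)]
      Ck_on_prod[OF assms(1)] Ck_on_const assms(2))

lemma Ck_on_vec:
  fixes f :: "'a::euclidean_space \<Rightarrow> real^'n"
  assumes "open S" "\<And>i. Ck_on k S (\<lambda>x. f x $ i)"
  shows "Ck_on k S f"
proof (rule Ck_on_cong[OF assms(1)])
  show "Ck_on k S (\<lambda>x. \<Sum>i\<in>UNIV. f x $ i *\<^sub>R axis i 1)"
    by (intro Ck_on_sum[OF assms(1)] Ck_on_bilinear[OF bounded_bilinear_scaleR assms(1)] assms(2) Ck_on_const)
  show "(\<Sum>i\<in>UNIV. f x $ i *\<^sub>R axis i 1) = f x" for x
    using basis_expansion[of "f x"] by (simp add: scalar_mult_eq_scaleR)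
qed

lemma Ck_on_nth:
  fixes f :: "'a::euclidean_space \<Rightarrow> real^'n"
  shows "open S \<Longrightarrow> Ck_on k S f \<Longrightarrow> Ck_on k S (\<lambda>x. f x $ i)"
  by (rule Ck_on_linear[OF bounded_linear_vec_nth])

text \<open>The derivative of \<open>h\<close> is the inverse matrix of the derivative of
  \<open>f\<close> at \<open>h y\<close>. By Cramer's rule its entries are quotients of polynomials
  in the entries of the latter, so each order of regularity of \<open>h\<close> yields the
  next.\<close>

lemma smooth_on_inverse_function:
  fixes f h :: "real^'n \<Rightarrow> real^'n"
  assumes "open N" "open V" "h ` V \<subseteq> N" "smooth_on N f"
    and dh: "\<And>y. y \<in> V \<Longrightarrow> (h has_derivative h' y) (at y)"
    and inv: "\<And>y v. y \<in> V \<Longrightarrow> frechet_derivative f (at (h y)) (h' y v) = v"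
  shows "smooth_on V h"
  unfolding smooth_on_def
proof
  show "Ck_on k V h" for k
  proof (induction k)
    case 0
    show ?case
      using dh by (auto intro!: continuous_at_imp_continuous_on has_derivative_continuous)
  next
    case (Suc k)
    define M where "M y = matrix (frechet_derivative f (at (h y)))" for y
    have hN: "h y \<in> N" if "y \<in> V" for y
      using assms(3) that by blast
    have lin: "linear (frechet_derivative f (at (h y)))" if "y \<in> V" for y
      using linear_frechet_derivative smooth_on_differentiable[OF assms(4) hN[OF that]] by blast
    have M: "M y *v (h' y v) = v" if "y \<in> V" for y v
      unfolding M_def using matrix_works[OF lin[OF that, folded linear_matrix_vector_mul_eq]] inv[OF that]
      by simp
    have det: "det (M y) \<noteq> 0" if y: "y \<in> V" for y
    proof -
      have "surj ((*v) (M y))"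
        using M[OF y] by (metis surj_def)
      then show ?thesis
        using matrix_right_invertible_surjective invertible_det_nz invertible_right_inverse by blast
    qed
    have cM: "Ck_on k V (\<lambda>y. M y $ i $ j)" for i j
    proof -
      have "Ck_on k V (\<lambda>y. frechet_derivative f (at (h y)) (axis j 1))"
        by (rule Ck_on_compose[OF assms(2,1,3) Suc smooth_onD[OF smooth_on_deriv[OF assms(4)]]])
      then show ?thesis
        unfolding M_def matrix_def by (simp add: Ck_on_nth[OF assms(2)] del: Ck_on.simps)
    qed
    have cramer_h: "h' y v = (\<chi> l. det (\<chi> i j. if j = l then v $ i else M y $ i $ j) / det (M y))" if "y \<in> V" for y v
      using M[OF that, of v] cramer[OF det[OF that]] by blast
    show ?case
    proof (rule Ck_on_SucI[OF assms(2) dh])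
      fix v
      have "Ck_on k V (\<lambda>y. h' y v $ l)" for l
      proof (rule Ck_on_cong[OF assms(2)])
        show "Ck_on k V (\<lambda>y. det (\<chi> i j. if j = l then v $ i else M y $ i $ j) * inverse (det (M y)))"
        proof (intro Ck_on_bilinear[OF bounded_bilinear_mult assms(2)] Ck_on_inverse_real assms(2) det Ck_on_det cM)
          show "Ck_on k V (\<lambda>y. (\<chi> i j. if j = l then v $ i else M y $ i $ j) $ i $ j)" for i j
            using cM by (cases "j = l") (simp_all add: Ck_on_const del: Ck_on.simps)
        qed
      qed (simp add: cramer_h divide_inverse)
      then show "Ck_on k V (\<lambda>y. h' y v)"
        by (rule Ck_on_vec[OF assms(2)])
    qed
  qed
qed

text \<open>The inverse function theorem gives a homeomorphism with differentiable inverse, which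
  \<open>smooth_on_inverse_function\<close> upgrades. Normalising the derivative at \<open>a\<close>
  to the identity lets \<open>id_blinfun\<close> serve as its inverse.\<close>

lemma local_diffeomorphism:
  fixes f :: "real^'n \<Rightarrow> real^'n"
  assumes "open U" "a \<in> U" "smooth_on U f" "\<And>v. frechet_derivative f (at a) v = v"
  obtains N V h where "open N" "N \<subseteq> U" "a \<in> N" "open V" "homeomorphism N V f h" "smooth_on V h"
    "\<And>y v. y \<in> V \<Longrightarrow> frechet_derivative f (at (h y)) (frechet_derivative h (at y) v) = v"
    "\<And>x v. x \<in> N \<Longrightarrow> frechet_derivative h (at (f x)) (frechet_derivative f (at x) v) = v"
proof -
  define f' where "f' x = Blinfun (frechet_derivative f (at x))" for x
  have f': "blinfun_apply (f' x) = frechet_derivative f (at x)" if "x \<in> U" for x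
    unfolding f'_def
    by (rule bounded_linear_Blinfun_apply[OF has_derivative_bounded_linear[OF smooth_on_has_derivative[OF assms(3) that]]])
  have df: "(f has_derivative blinfun_apply (f' x)) (at x)" if "x \<in> U" for x
    using f'[OF that] smooth_on_has_derivative[OF assms(3) that] by simp
  have "continuous_on U f'"
  proof (rule continuous_on_blinfun_componentwise)
    show "continuous_on U (\<lambda>x. f' x i)" for i
      using smooth_on_continuous_on[OF smooth_on_deriv[OF assms(3), of i]]
      by (rule continuous_on_eq) (simp add: f')
  qed
  moreover have "id_blinfun o\<^sub>L f' a = id_blinfun"
    by (rule blinfun_eqI) (simp add: f'[OF assms(2)] assms(4))
  ultimately obtain N V h h' where N: "open N" "N \<subseteq> U" "a \<in> N" and V: "open V" and hom: "homeomorphism N V f h"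
    and dh: "\<And>y. y \<in> V \<Longrightarrow> (h has_derivative h' y) (at y)"
    and h': "\<And>y. y \<in> V \<Longrightarrow> h' y = inv (blinfun_apply (f' (h y)))"
    and bij: "\<And>y. y \<in> V \<Longrightarrow> bij (blinfun_apply (f' (h y)))"
    using inverse_function_theorem[OF assms(1) df _ assms(2)] by metis
  have hV: "h ` V \<subseteq> N"
    using hom by (auto simp: homeomorphism_def)
  have inv1: "frechet_derivative f (at (h y)) (h' y v) = v" if "y \<in> V" for y v
  proof -
    have "h y \<in> U"
      using hV N that by blast
    then show ?thesis
      using bij[OF that] h'[OF that] f'[of "h y"] by (simp add: bij_is_surj surj_f_inv_f)
  qed
  have inv2: "h' (f x) (frechet_derivative f (at x) v) = v" if "x \<in> N" for x v
  proof -
    have fx: "f x \<in> V" "h (f x) = x"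
      using hom that by (auto simp: homeomorphism_def)
    have "x \<in> U"
      using N that by blast
    then show ?thesis
      using bij[OF fx(1)] h'[OF fx(1)] f'[of x] fx(2) by (simp add: bij_is_inj inv_f_f)
  qed
  have fdh: "frechet_derivative h (at y) = h' y" if "y \<in> V" for y
    using frechet_derivative_works_at[OF dh[OF that]] .
  have "smooth_on V h"
    using smooth_on_inverse_function[OF N(1) V hV smooth_on_subset[OF assms(3) N(2)] dh inv1] .
  moreover have "f x \<in> V" if "x \<in> N" for x
    using hom that by (auto simp: homeomorphism_def)
  ultimately show thesis
    using that[OF N V hom] inv1 inv2 fdh by simp
qed

section \<open>Charts, tangent vectors and vector fields\<close>

abbreviation chart_inv :: "('a, 'e::euclidean_space) chart \<Rightarrow> 'e \<Rightarrow> 'a" where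
  "chart_inv c \<equiv> inv_into (fst c) (snd c)"

text \<open>The components of a tangent vector are its values on the coordinate functions. Stated
  for arbitrary functionals, the formula is linear in \<open>v\<close> outright.\<close>

definition coords :: "('a, 'e::euclidean_space) chart \<Rightarrow> 'a tvec \<Rightarrow> 'e" where
  "coords c v = (\<Sum>b\<in>Basis. v (\<lambda>q. snd c q \<bullet> b) *\<^sub>R b)"

abbreviation field_rep :: "('a, 'e::euclidean_space) chart \<Rightarrow> 'a vfield \<Rightarrow> 'e \<Rightarrow> 'e" where
  "field_rep c X \<equiv> \<lambda>x. coords c (X (chart_inv c x))"

lemma coords_lin: "coords c (\<lambda>f. a * v f + b * w f) = a *\<^sub>R coords c v + b *\<^sub>R coords c w"
  by (simp add: coords_def sum.distrib scaleR_sum_right scaleR_add_left)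

lemma coords_sum:
  "coords c (\<lambda>f. \<Sum>i\<in>I. s i * v i f) = (\<Sum>i\<in>I. s i *\<^sub>R coords c (v i))"
  unfolding coords_def scaleR_sum_right scaleR_sum_left scaleR_scaleR by (rule sum.swap)

locale atlas =
  fixes A :: "('a, 'e::euclidean_space) chart set"
  assumes atlas: "smooth_atlas A"
begin

lemma atlas_subset_maximal: "c \<in> A \<Longrightarrow> c \<in> maximal_atlas A"
  using atlas by (auto simp: maximal_atlas_def smooth_atlas_def points_def)

lemma chart_inj: "c \<in> maximal_atlas A \<Longrightarrow> inj_on (snd c) (fst c)"
  by (simp add: maximal_atlas_def is_chart_def)

lemma chart_inv_chart [simp]: "c \<in> maximal_atlas A \<Longrightarrow> q \<in> fst c \<Longrightarrow> chart_inv c (snd c q) = q"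
  by (simp add: chart_inj)

lemma chart_covered:
  assumes "c \<in> maximal_atlas A" "q \<in> fst c"
  obtains d where "d \<in> A" "q \<in> fst d" "compatible c d"
  using assms by (auto simp: maximal_atlas_def points_def)

lemma chart_image_mem_iff:
  assumes "c \<in> maximal_atlas A" "q \<in> fst c" "U \<subseteq> fst c"
  shows "snd c q \<in> snd c ` U \<longleftrightarrow> q \<in> U"
  using inj_on_image_mem_iff[OF chart_inj[OF assms(1)] assms(2,3)] .

text \<open>The topology is defined through the charts in \<open>A\<close>. Near each point of a
  maximal-atlas chart some chart \<open>d\<close> of \<open>A\<close> is available, and the image is
  locally the preimage of an open set under a continuous transition map.\<close>

lemma mopen_imp_open_image:
  assumes c: "c \<in> maximal_atlas A" and U: "mopen A U"
  shows "open (snd c ` (U \<inter> fst c))"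
proof (subst open_subopen, clarify)
  fix q assume q: "q \<in> U" "q \<in> fst c"
  obtain d where d: "d \<in> A" "q \<in> fst d" "compatible c d"
    using chart_covered[OF c q(2)] .
  let ?S = "snd c ` (fst c \<inter> fst d)"
  let ?T = "?S \<inter> (snd d \<circ> chart_inv c) -` (snd d ` (U \<inter> fst d))"
  have "open ?T"
    using d U unfolding compatible_def mopen_def
    by (intro continuous_open_preimage smooth_on_continuous_on) auto
  moreover have "snd c q \<in> ?T"
    using q d c by auto
  moreover have "?T \<subseteq> snd c ` (U \<inter> fst c)"
  proof
    fix x assume "x \<in> ?T"
    then obtain r s where x: "x = snd c r" and r: "r \<in> fst c" "r \<in> fst d" and s: "s \<in> U" "s \<in> fst d"
      and eq: "snd d (chart_inv c x) = snd d s"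
      by auto
    have "snd d r = snd d s"
      using eq x chart_inv_chart[OF c r(1)] by simp
    then have "r = s"
      using inj_onD[OF chart_inj[OF atlas_subset_maximal[OF d(1)]]] r s by blast
    then show "x \<in> snd c ` (U \<inter> fst c)"
      using x r s by blast
  qed
  ultimately show "\<exists>T. open T \<and> snd c q \<in> T \<and> T \<subseteq> snd c ` (U \<inter> fst c)"
    by blast
qed

lemma mopen_preimage:
  assumes c: "c \<in> maximal_atlas A" and V: "open V"
  shows "mopen A {q \<in> fst c. snd c q \<in> V}"
  unfolding mopen_def
proof (intro conjI ballI)
  show "{q \<in> fst c. snd c q \<in> V} \<subseteq> points A"
    using c by (auto simp: maximal_atlas_def)
  fix d assume d: "d \<in> A"
  have com: "compatible c d"
    using c d by (simp add: maximal_atlas_def)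
  let ?S = "snd d ` (fst c \<inter> fst d)"
  have "snd d ` ({q \<in> fst c. snd c q \<in> V} \<inter> fst d) = ?S \<inter> (snd c \<circ> chart_inv d) -` V"
    using atlas_subset_maximal[OF d] by auto
  moreover have "open \<dots>"
    using com V unfolding compatible_def
    by (intro continuous_open_preimage smooth_on_continuous_on) auto
  ultimately show "open (snd d ` ({q \<in> fst c. snd c q \<in> V} \<inter> fst d))"
    by simp
qed

lemma mopen_chart: "c \<in> maximal_atlas A \<Longrightarrow> mopen A (fst c)"
  using mopen_preimage[of c UNIV] by simp

lemma mopen_Int: "mopen A U \<Longrightarrow> mopen A V \<Longrightarrow> mopen A (U \<inter> V)"
  using istopology_mopen[OF atlas] by (simp add: istopology_def)

lemma open_image:
  "c \<in> maximal_atlas A \<Longrightarrow> mopen A U \<Longrightarrow> U \<subseteq> fst c \<Longrightarrow> open (snd c ` U)"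
  using mopen_imp_open_image[of c U] by (simp add: Int_absorb2)

lemma smooth_fun_mono: "smooth_fun A U f \<Longrightarrow> W \<subseteq> U \<Longrightarrow> smooth_fun A W f"
  unfolding smooth_fun_def by (meson Int_mono image_mono order_refl smooth_on_subset)

text \<open>Locally, \<open>f\<close> in the chart \<open>c\<close> is \<open>f\<close> in a chart
  of \<open>A\<close> composed with a smooth transition map.\<close>

lemma smooth_fun_chart:
  assumes c: "c \<in> maximal_atlas A" and U: "mopen A U" "U \<subseteq> fst c" and f: "smooth_fun A U f"
  shows "smooth_on (snd c ` U) (f \<circ> chart_inv c)"
proof (rule smooth_on_local, clarify)
  fix q assume q: "q \<in> U"
  obtain d where d: "d \<in> A" "q \<in> fst d" "compatible c d"
    using chart_covered[OF c] q U by blast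
  note dm = atlas_subset_maximal[OF d(1)]
  have W: "mopen A (U \<inter> fst d)"
    using mopen_Int[OF U(1) mopen_chart[OF dm]] .
  have op: "open (snd c ` (U \<inter> fst d))" "open (snd d ` (U \<inter> fst d))"
    using open_image[OF c W] open_image[OF dm W] U by auto
  have "smooth_on (snd c ` (U \<inter> fst d)) (\<lambda>x. (f \<circ> chart_inv d) ((snd d \<circ> chart_inv c) x))"
  proof (rule smooth_on_compose[OF op])
    show "(snd d \<circ> chart_inv c) ` snd c ` (U \<inter> fst d) \<subseteq> snd d ` (U \<inter> fst d)"
      using U c by auto
    have "smooth_on (snd c ` (fst c \<inter> fst d)) (snd d \<circ> chart_inv c)"
      using d by (simp add: compatible_def)
    then show "smooth_on (snd c ` (U \<inter> fst d)) (snd d \<circ> chart_inv c)"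
      by (rule smooth_on_subset) (use U in auto)
    show "smooth_on (snd d ` (U \<inter> fst d)) (f \<circ> chart_inv d)"
      using f d by (simp add: smooth_fun_def)
  qed
  then have "smooth_on (snd c ` (U \<inter> fst d)) (f \<circ> chart_inv c)"
  proof (rule smooth_on_cong[OF op(1), rotated])
    fix x assume "x \<in> snd c ` (U \<inter> fst d)"
    then show "(f \<circ> chart_inv d) ((snd d \<circ> chart_inv c) x) = (f \<circ> chart_inv c) x"
      using U c dm by (auto simp: subset_iff)
  qed
  then show "\<exists>T. open T \<and> snd c q \<in> T \<and> smooth_on T (f \<circ> chart_inv c)"
    using op(1) q d by blast
qed

lemma smooth_funI:
  assumes c: "c \<in> maximal_atlas A" and U: "mopen A U" "U \<subseteq> fst c"
    and f: "smooth_on (snd c ` U) (f \<circ> chart_inv c)"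
  shows "smooth_fun A U f"
  unfolding smooth_fun_def
proof
  fix d assume d: "d \<in> A"
  note dm = atlas_subset_maximal[OF d]
  have W: "mopen A (U \<inter> fst d)"
    using mopen_Int[OF U(1) mopen_chart[OF dm]] .
  have op: "open (snd d ` (U \<inter> fst d))" "open (snd c ` (U \<inter> fst d))"
    using open_image[OF c W] open_image[OF dm W] U by auto
  have "smooth_on (snd d ` (U \<inter> fst d)) (\<lambda>x. (f \<circ> chart_inv c) ((snd c \<circ> chart_inv d) x))"
  proof (rule smooth_on_compose[OF op])
    show "(snd c \<circ> chart_inv d) ` snd d ` (U \<inter> fst d) \<subseteq> snd c ` (U \<inter> fst d)"
      using dm by auto
    have "smooth_on (snd d ` (fst c \<inter> fst d)) (snd c \<circ> chart_inv d)"
      using c d by (simp add: maximal_atlas_def compatible_def)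
    then show "smooth_on (snd d ` (U \<inter> fst d)) (snd c \<circ> chart_inv d)"
      by (rule smooth_on_subset) (use U in auto)
    show "smooth_on (snd c ` (U \<inter> fst d)) (f \<circ> chart_inv c)"
      by (rule smooth_on_subset[OF f]) auto
  qed
  then show "smooth_on (snd d ` (U \<inter> fst d)) (f \<circ> chart_inv d)"
  proof (rule smooth_on_cong[OF op(1), rotated])
    fix x assume "x \<in> snd d ` (U \<inter> fst d)"
    then show "(f \<circ> chart_inv c) ((snd c \<circ> chart_inv d) x) = (f \<circ> chart_inv d) x"
      using U c dm by (auto simp: subset_iff)
  qed
qed

section \<open>Germs of smooth functions and tangent vectors in a chart\<close>

lemma smooth_nearE:
  assumes "c \<in> maximal_atlas A" "mopen A U" "U \<subseteq> fst c" "p \<in> U" "smooth_near A p f"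
  obtains W where "mopen A W" "W \<subseteq> U" "p \<in> W" "smooth_fun A W f" "smooth_on (snd c ` W) (f \<circ> chart_inv c)"
proof -
  obtain V where V: "mopen A V" "p \<in> V" "smooth_fun A V f"
    using assms(5) by (auto simp: smooth_near_def)
  have W: "mopen A (U \<inter> V)" "smooth_fun A (U \<inter> V) f"
    using mopen_Int[OF assms(2) V(1)] smooth_fun_mono[OF V(3)] by auto
  show thesis
    using that[OF W(1) _ _ W(2) smooth_fun_chart[OF assms(1) W(1) _ W(2)]] assms V by auto
qed

lemma smooth_near_differentiable:
  assumes "c \<in> maximal_atlas A" "p \<in> fst c" "smooth_near A p f"
  shows "(f \<circ> chart_inv c) differentiable (at (snd c p))"
proof -
  obtain W where W: "p \<in> W" "smooth_on (snd c ` W) (f \<circ> chart_inv c)"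
    using smooth_nearE[OF assms(1) mopen_chart[OF assms(1)] order_refl assms(2,3)] .
  then show ?thesis
    by (intro smooth_on_differentiable[OF W(2)]) auto
qed

text \<open>The working rule for evaluating tangent vectors: a coordinate expression
  \<open>K\<close> on some open set around \<open>p\<close> suffices. Smoothness near
  \<open>p\<close> is delivered too, because \<open>dir_deriv\<close> is \<open>0\<close> by
  convention on other functions.\<close>

lemma dir_deriv_eqI:
  assumes c: "c \<in> maximal_atlas A" and U: "mopen A U" "U \<subseteq> fst c" "p \<in> U"
    and k: "\<And>q. q \<in> U \<Longrightarrow> k q = K (snd c q)" "smooth_on (snd c ` U) K"
    and K': "(K has_derivative K') (at (snd c p))"
  shows "smooth_near A p k" "dir_deriv A c u p k = K' u"
proof -
  have op: "open (snd c ` U)"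
    using open_image[OF c U(1,2)] .
  have eq: "K x = (k \<circ> chart_inv c) x" if "x \<in> snd c ` U" for x
    using that k U c by (auto simp: subset_iff)
  have "smooth_fun A U k"
    by (rule smooth_funI[OF c U(1,2) smooth_on_cong[OF op eq k(2)]])
  then show near: "smooth_near A p k"
    using U by (auto simp: smooth_near_def)
  have "((k \<circ> chart_inv c) has_derivative K') (at (snd c p))"
    by (rule has_derivative_transform_within_open[OF K' op]) (use U eq in auto)
  then show "dir_deriv A c u p k = K' u"
    using near by (simp add: dir_deriv_def frechet_derivative_works_at)
qed

lemma coords_dir_deriv [simp]:
  assumes c: "c \<in> maximal_atlas A" and p: "p \<in> fst c"
  shows "coords c (dir_deriv A c u p) = u"
proof -
  have "dir_deriv A c u p (\<lambda>q. snd c q \<bullet> b) = u \<bullet> b" for b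
    by (rule dir_deriv_eqI(2)[OF c mopen_chart[OF c] order_refl p, where K = "\<lambda>x. x \<bullet> b"])
      (auto intro!: smooth_on_linear[OF bounded_linear_inner_left] smooth_on_ident open_image[OF c mopen_chart[OF c]]
        derivative_eq_intros)
  then show ?thesis
    by (simp add: coords_def euclidean_representation)
qed

lemma smooth_fun_coordinate:
  assumes "c \<in> maximal_atlas A"
  shows "smooth_fun A (fst c) (\<lambda>q. snd c q \<bullet> b)"
proof (rule smooth_funI[OF assms mopen_chart[OF assms] order_refl])
  note op = open_image[OF assms mopen_chart[OF assms] order_refl]
  show "smooth_on (snd c ` fst c) ((\<lambda>q. snd c q \<bullet> b) \<circ> chart_inv c)"
    by (rule smooth_on_cong[OF op _ smooth_on_linear[OF bounded_linear_inner_left[of b] op smooth_on_ident]])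
      (use assms in auto)
qed

text \<open>By definition, maximal-atlas charts are compatible with charts of \<open>A\<close>.
  Between two of them, smoothness of the transition is recovered from smoothness of the coordinate
  functions of \<open>d\<close>.\<close>

lemma smooth_on_transition:
  assumes "c \<in> maximal_atlas A" "d \<in> maximal_atlas A"
  shows "smooth_on (snd c ` (fst c \<inter> fst d)) (snd d \<circ> chart_inv c)"
proof (rule smooth_on_inner_Basis)
  have W: "mopen A (fst c \<inter> fst d)"
    using assms by (intro mopen_Int mopen_chart)
  then show "open (snd c ` (fst c \<inter> fst d))"
    using open_image[OF assms(1)] by auto
  show "smooth_on (snd c ` (fst c \<inter> fst d)) (\<lambda>x. (snd d \<circ> chart_inv c) x \<bullet> b)" for b
    using smooth_fun_chart[OF assms(1) W _ smooth_fun_mono[OF smooth_fun_coordinate[OF assms(2), of b]]]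
    by (auto simp: o_def)
qed

lemma dir_deriv_change_chart:
  assumes c: "c \<in> maximal_atlas A" and d: "d \<in> maximal_atlas A" and p: "p \<in> fst c" "p \<in> fst d"
  shows "dir_deriv A c u p = dir_deriv A d (frechet_derivative (snd d \<circ> chart_inv c) (at (snd c p)) u) p"
proof
  fix f
  let ?t = "snd d \<circ> chart_inv c"
  show "dir_deriv A c u p f = dir_deriv A d (frechet_derivative ?t (at (snd c p)) u) p f"
  proof (cases "smooth_near A p f")
    case True
    have W: "mopen A (fst c \<inter> fst d)"
      using c d by (intro mopen_Int mopen_chart)
    have op: "open (snd c ` (fst c \<inter> fst d))"
      using open_image[OF c W] by auto
    have t: "(?t has_derivative frechet_derivative ?t (at (snd c p))) (at (snd c p))"
      using p by (intro smooth_on_has_derivative[OF smooth_on_transition[OF c d]]) auto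
    have "((f \<circ> chart_inv d) has_derivative frechet_derivative (f \<circ> chart_inv d) (at (snd d p))) (at (?t (snd c p)))"
      using smooth_near_differentiable[OF d p(2) True] p c frechet_derivative_works by auto
    from diff_chain_at[OF t this]
    have "((f \<circ> chart_inv d \<circ> ?t) has_derivative
        frechet_derivative (f \<circ> chart_inv d) (at (snd d p)) \<circ> frechet_derivative ?t (at (snd c p))) (at (snd c p))" .
    then have "((f \<circ> chart_inv c) has_derivative
        frechet_derivative (f \<circ> chart_inv d) (at (snd d p)) \<circ> frechet_derivative ?t (at (snd c p))) (at (snd c p))"
      by (rule has_derivative_transform_within_open[OF _ op]) (use p c d in auto)
    then show ?thesis
      using True by (simp add: dir_deriv_def frechet_derivative_works_at)
  qed (simp add: dir_deriv_def)
qed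

text \<open>\<open>tangent_space\<close> ranges over all charts of \<open>A\<close>, but the chain
  rule moves every vector into one given chart. So a tangent vector is determined by its components
  in any chart of the maximal atlas.\<close>

lemma tangent_space_chart:
  assumes "c \<in> maximal_atlas A" "p \<in> fst c"
  shows "v \<in> tangent_space A p \<longleftrightarrow> v = dir_deriv A c (coords c v) p"
proof
  assume "v \<in> tangent_space A p"
  then obtain d u where "d \<in> A" "p \<in> fst d" "v = dir_deriv A d u p"
    by (auto simp: tangent_space_def)
  then have "\<exists>w. v = dir_deriv A c w p"
    using dir_deriv_change_chart[OF atlas_subset_maximal assms(1)] assms(2) by blast
  then show "v = dir_deriv A c (coords c v) p"
    using assms by auto
next
  assume v: "v = dir_deriv A c (coords c v) p"
  obtain d where d: "d \<in> A" "p \<in> fst d"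
    using chart_covered[OF assms] .
  have "v = dir_deriv A d (frechet_derivative (snd d \<circ> chart_inv c) (at (snd c p)) (coords c v)) p"
    using dir_deriv_change_chart[OF assms(1) atlas_subset_maximal[OF d(1)] assms(2) d(2)] v by simp
  then show "v \<in> tangent_space A p"
    unfolding tangent_space_def using d by blast
qed

lemma dir_deriv_in_tangent_space:
  "c \<in> maximal_atlas A \<Longrightarrow> p \<in> fst c \<Longrightarrow> dir_deriv A c u p \<in> tangent_space A p"
  by (simp add: tangent_space_chart)

lemma dir_deriv_lin:
  assumes "c \<in> maximal_atlas A" "p \<in> fst c"
  shows "dir_deriv A c (a *\<^sub>R u + b *\<^sub>R w) p = (\<lambda>f. a * dir_deriv A c u p f + b * dir_deriv A c w p f)"
proof
  fix f
  show "dir_deriv A c (a *\<^sub>R u + b *\<^sub>R w) p f = a * dir_deriv A c u p f + b * dir_deriv A c w p f"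
    using linear_frechet_derivative[OF smooth_near_differentiable[OF assms, of f]]
    by (cases "smooth_near A p f") (simp_all add: dir_deriv_def linear_add linear_scale)
qed

lemma dir_deriv_zero:
  "c \<in> maximal_atlas A \<Longrightarrow> p \<in> fst c \<Longrightarrow> dir_deriv A c 0 p = (\<lambda>f. 0)"
  using dir_deriv_lin[of c p 0 0 0 0] by simp

lemma dir_deriv_sum:
  assumes "c \<in> maximal_atlas A" "p \<in> fst c" "finite I"
  shows "dir_deriv A c (\<Sum>i\<in>I. a i *\<^sub>R u i) p = (\<lambda>f. \<Sum>i\<in>I. a i * dir_deriv A c (u i) p f)"
  using assms(3)
proof (induction I rule: finite_induct)
  case empty
  then show ?case
    using dir_deriv_zero[OF assms(1,2)] by simp
next
  case (insert i I)
  then show ?case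
    using dir_deriv_lin[OF assms(1,2), of "a i" "u i" 1 "\<Sum>i\<in>I. a i *\<^sub>R u i"] by simp
qed

lemma tangent_space_lin:
  assumes "c \<in> maximal_atlas A" "p \<in> fst c" "v \<in> tangent_space A p" "w \<in> tangent_space A p"
  shows "(\<lambda>f. a * v f + b * w f) \<in> tangent_space A p"
  using assms(3,4) dir_deriv_lin[OF assms(1,2)]
  by (simp add: tangent_space_chart[OF assms(1,2)] coords_lin)

section \<open>Vector fields and brackets in a chart\<close>

lemma vfield_eq:
  assumes "c \<in> maximal_atlas A" "smooth_vfield A U X" "q \<in> U" "q \<in> fst c"
  shows "X q = dir_deriv A c (field_rep c X (snd c q)) q"
  using assms tangent_space_chart[OF assms(1,4)] by (auto simp: smooth_vfield_def)

lemma smooth_vfield_mono: "smooth_vfield A U X \<Longrightarrow> W \<subseteq> U \<Longrightarrow> smooth_vfield A W X"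
  unfolding smooth_vfield_def by blast

lemma smooth_on_field_rep:
  assumes c: "c \<in> maximal_atlas A" and U: "mopen A U" "U \<subseteq> fst c" and X: "smooth_vfield A U X"
  shows "smooth_on (snd c ` U) (field_rep c X)"
proof -
  have "smooth_fun A U (\<lambda>p. X p (\<lambda>q. snd c q \<bullet> b))" for b
    using X U smooth_fun_mono[OF smooth_fun_coordinate[OF c] U(2)] by (auto simp: smooth_vfield_def)
  from smooth_fun_chart[OF c U this]
  have "smooth_on (snd c ` U) (\<lambda>x. X (chart_inv c x) (\<lambda>q. snd c q \<bullet> b))" for b
    by (simp add: o_def)
  then show ?thesis
    unfolding coords_def
    by (intro smooth_on_sum smooth_on_bilinear[OF bounded_bilinear_scaleR] smooth_on_const open_image[OF c U])
qed

lemma field_apply_fun: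
  assumes c: "c \<in> maximal_atlas A" and U: "mopen A U" "U \<subseteq> fst c" "p \<in> U" and X: "smooth_vfield A U X"
    and k: "\<And>q. q \<in> U \<Longrightarrow> k q = K (snd c q)" "smooth_on (snd c ` U) K"
    and K': "(K has_derivative K') (at (snd c p))"
  shows "X p k = K' (field_rep c X (snd c p))"
proof -
  have "X p k = dir_deriv A c (field_rep c X (snd c p)) p k"
    by (rule fun_cong[OF vfield_eq[OF c X U(3)]]) (use U in auto)
  also have "\<dots> = K' (field_rep c X (snd c p))"
    by (rule dir_deriv_eqI(2)[OF c U k K'])
  finally show ?thesis .
qed

lemma smooth_vfieldI:
  assumes c: "c \<in> maximal_atlas A" and U: "mopen A U" "U \<subseteq> fst c" and xi: "smooth_on (snd c ` U) \<xi>"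
    and X: "\<And>q. q \<in> U \<Longrightarrow> X q = dir_deriv A c (\<xi> (snd c q)) q"
  shows "smooth_vfield A U X"
  unfolding smooth_vfield_def
proof (intro conjI ballI allI impI)
  show "X p \<in> tangent_space A p" if "p \<in> U" for p
    using X[OF that] dir_deriv_in_tangent_space[OF c] U that by auto
  fix W f assume W: "mopen A W" "W \<subseteq> U" and f: "smooth_fun A W f"
  have Wc: "W \<subseteq> fst c"
    using W U by auto
  note op = open_image[OF c W(1) Wc] and F = smooth_fun_chart[OF c W(1) Wc f]
  have near: "smooth_near A q f" if "q \<in> W" for q
    using that W f by (auto simp: smooth_near_def)
  have "smooth_on (snd c ` W) (\<lambda>x. frechet_derivative (f \<circ> chart_inv c) (at x) (\<xi> x))"
  proof (rule smooth_on_apply_linear[where L = "\<lambda>x. frechet_derivative (f \<circ> chart_inv c) (at x)", OF op])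
    show "linear (frechet_derivative (f \<circ> chart_inv c) (at x))" if "x \<in> snd c ` W" for x
      using that F linear_frechet_derivative smooth_on_differentiable by blast
    show "smooth_on (snd c ` W) \<xi>"
      by (rule smooth_on_subset[OF xi]) (use W in auto)
  qed (rule smooth_on_deriv[OF F])
  then have "smooth_on (snd c ` W) ((\<lambda>p. X p f) \<circ> chart_inv c)"
    by (rule smooth_on_cong[OF op, rotated])
      (use W Wc U X near c in \<open>auto simp: dir_deriv_def subset_iff\<close>)
  then show "smooth_fun A W (\<lambda>p. X p f)"
    by (rule smooth_funI[OF c W(1) Wc])
qed

lemma smooth_vfield_dir_deriv:
  assumes "c \<in> maximal_atlas A"
  shows "smooth_vfield A (fst c) (dir_deriv A c u)"
  by (rule smooth_vfieldI[OF assms mopen_chart[OF assms] order_refl smooth_on_const]) simp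

text \<open>The Hessian term is written with the component of \<open>Y\<close> frozen at
  \<open>p\<close>, which makes it bilinear in the two fields and ready to cancel in
  brackets.\<close>

lemma field_apply_apply:
  assumes c: "c \<in> maximal_atlas A" and U: "mopen A U" "U \<subseteq> fst c" "p \<in> U"
    and X: "smooth_vfield A U X" and Y: "smooth_vfield A U Y" and f: "smooth_near A p f"
  shows "X p (\<lambda>q. Y q f) =
    frechet_derivative (\<lambda>x. frechet_derivative (f \<circ> chart_inv c) (at x) (field_rep c Y (snd c p))) (at (snd c p))
      (field_rep c X (snd c p))
    + frechet_derivative (f \<circ> chart_inv c) (at (snd c p))
      (frechet_derivative (field_rep c Y) (at (snd c p)) (field_rep c X (snd c p)))"
proof -
  let ?F = "f \<circ> chart_inv c" and ?x = "snd c p"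
  obtain W where W: "mopen A W" "W \<subseteq> U" "p \<in> W" "smooth_fun A W f" "smooth_on (snd c ` W) ?F"
    using smooth_nearE[OF c U f] .
  have Wc: "W \<subseteq> fst c"
    using W U by auto
  note op = open_image[OF c W(1) Wc]
  have x: "?x \<in> snd c ` W"
    using W by auto
  have lin: "linear (frechet_derivative ?F (at x))" if "x \<in> snd c ` W" for x
    using linear_frechet_derivative smooth_on_differentiable[OF W(5) that] by blast
  note sY = smooth_on_field_rep[OF c W(1) Wc smooth_vfield_mono[OF Y W(2)]]
  show ?thesis
  proof (rule field_apply_fun[OF c W(1) Wc W(3) smooth_vfield_mono[OF X W(2)]])
    show "Y q f = frechet_derivative ?F (at (snd c q)) (field_rep c Y (snd c q))" if q: "q \<in> W" for q
    proof -
      have "smooth_near A q f"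
        using q W by (auto simp: smooth_near_def)
      moreover have "Y q f = dir_deriv A c (field_rep c Y (snd c q)) q f"
        by (rule fun_cong[OF vfield_eq[OF c Y]]) (use q W Wc in auto)
      ultimately show ?thesis
        by (simp add: dir_deriv_def)
    qed
    show "smooth_on (snd c ` W) (\<lambda>x. frechet_derivative ?F (at x) (field_rep c Y x))"
      by (rule smooth_on_apply_linear[OF op lin smooth_on_deriv[OF W(5)] sY])
    show "((\<lambda>x. frechet_derivative ?F (at x) (field_rep c Y x)) has_derivative
      (\<lambda>h. frechet_derivative (\<lambda>x. frechet_derivative ?F (at x) (field_rep c Y ?x)) (at ?x) h
        + frechet_derivative ?F (at ?x) (frechet_derivative (field_rep c Y) (at ?x) h))) (at ?x)"
      by (rule has_derivative_apply_linear[OF op x lin smooth_on_has_derivative[OF smooth_on_deriv[OF W(5)] x]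
            smooth_on_has_derivative[OF sY x]])
  qed
qed

text \<open>In \<open>X (Y f) - Y (X f)\<close> the Hessian terms cancel by symmetry of second
  derivatives, which leaves a first-order operator.\<close>

lemma bracket_eq:
  assumes c: "c \<in> maximal_atlas A" and U: "mopen A U" "U \<subseteq> fst c" "p \<in> U"
    and X: "smooth_vfield A U X" and Y: "smooth_vfield A U Y"
  shows "bracket A X Y p = dir_deriv A c
    (frechet_derivative (field_rep c Y) (at (snd c p)) (field_rep c X (snd c p))
     - frechet_derivative (field_rep c X) (at (snd c p)) (field_rep c Y (snd c p))) p"
proof
  fix f
  show "bracket A X Y p f = dir_deriv A c
    (frechet_derivative (field_rep c Y) (at (snd c p)) (field_rep c X (snd c p))
     - frechet_derivative (field_rep c X) (at (snd c p)) (field_rep c Y (snd c p))) p f"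
  proof (cases "smooth_near A p f")
    case True
    let ?F = "f \<circ> chart_inv c" and ?x = "snd c p"
    obtain W where W: "mopen A W" "W \<subseteq> U" "p \<in> W" "smooth_on (snd c ` W) ?F"
      using smooth_nearE[OF c U True] .
    have op: "open (snd c ` W)" "?x \<in> snd c ` W"
      using open_image[OF c W(1)] W U by auto
    have "linear (frechet_derivative ?F (at ?x))"
      using linear_frechet_derivative smooth_on_differentiable[OF W(4) op(2)] by blast
    then show ?thesis
      using True field_apply_apply[OF c U X Y True] field_apply_apply[OF c U Y X True]
        second_derivative_symmetric[OF op W(4)]
      by (simp add: bracket_def dir_deriv_def linear_diff)
  qed (simp add: bracket_def dir_deriv_def)
qed

lemma smooth_vfield_bracket:
  assumes c: "c \<in> maximal_atlas A" and U: "mopen A U" "U \<subseteq> fst c"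
    and X: "smooth_vfield A U X" and Y: "smooth_vfield A U Y"
  shows "smooth_vfield A U (bracket A X Y)"
  by (rule smooth_vfieldI[OF c U smooth_on_diff[OF open_image[OF c U]
          smooth_on_deriv_along[OF open_image[OF c U] smooth_on_field_rep[OF c U Y] smooth_on_field_rep[OF c U X]]
          smooth_on_deriv_along[OF open_image[OF c U] smooth_on_field_rep[OF c U X] smooth_on_field_rep[OF c U Y]]]
        bracket_eq[OF c U _ X Y]])

lemma coords_bracket:
  assumes c: "c \<in> maximal_atlas A" and U: "mopen A U" "U \<subseteq> fst c" "p \<in> U"
    and X: "smooth_vfield A U X" and Y: "smooth_vfield A U Y"
  shows "coords c (bracket A X Y p) =
    frechet_derivative (field_rep c Y) (at (snd c p)) (field_rep c X (snd c p))
     - frechet_derivative (field_rep c X) (at (snd c p)) (field_rep c Y (snd c p))"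
  using bracket_eq[OF c U X Y] coords_dir_deriv[OF c] U by auto

end

section \<open>Exterior derivatives in a chart\<close>

lemma has_derivative_bilinear_field:
  fixes X Y :: "'a::real_normed_vector \<Rightarrow> 'b::euclidean_space"
  assumes S: "open S" "x \<in> S"
    and lin: "\<And>z v. z \<in> S \<Longrightarrow> linear (\<lambda>u. B z u v)" "\<And>z u. z \<in> S \<Longrightarrow> linear (\<lambda>v. B z u v)"
    and dB: "\<And>u v. ((\<lambda>z. B z u v) has_derivative dB u v) (at x)"
    and X: "(X has_derivative X') (at x)" and Y: "(Y has_derivative Y') (at x)"
  shows "((\<lambda>z. B z (X z) (Y z)) has_derivative
    (\<lambda>h. dB (X x) (Y x) h + B x (X' h) (Y x) + B x (X x) (Y' h))) (at x)"
proof -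
  have "((\<lambda>z. B z u (Y z)) has_derivative (\<lambda>h. dB u (Y x) h + B x u (Y' h))) (at x)" for u
    by (rule has_derivative_apply_linear[OF S lin(2) dB Y])
  from has_derivative_apply_linear[where L = "\<lambda>z u. B z u (Y z)", OF S lin(1) this X]
  show ?thesis
    by (simp add: algebra_simps)
qed

lemma has_derivative_trilinear_field:
  fixes X Y Z :: "'a::real_normed_vector \<Rightarrow> 'b::euclidean_space"
  assumes S: "open S" "x \<in> S"
    and lin: "\<And>z v w. z \<in> S \<Longrightarrow> linear (\<lambda>u. B z u v w)" "\<And>z u w. z \<in> S \<Longrightarrow> linear (\<lambda>v. B z u v w)"
      "\<And>z u v. z \<in> S \<Longrightarrow> linear (\<lambda>w. B z u v w)"
    and dB: "\<And>u v w. ((\<lambda>z. B z u v w) has_derivative dB u v w) (at x)"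
    and X: "(X has_derivative X') (at x)" and Y: "(Y has_derivative Y') (at x)"
    and Z: "(Z has_derivative Z') (at x)"
  shows "((\<lambda>z. B z (X z) (Y z) (Z z)) has_derivative
    (\<lambda>h. dB (X x) (Y x) (Z x) h + B x (X' h) (Y x) (Z x) + B x (X x) (Y' h) (Z x) + B x (X x) (Y x) (Z' h))) (at x)"
proof -
  have "((\<lambda>z. B z u (Y z) (Z z)) has_derivative
    (\<lambda>h. dB u (Y x) (Z x) h + B x u (Y' h) (Z x) + B x u (Y x) (Z' h))) (at x)" for u
    by (rule has_derivative_bilinear_field[OF S lin(2,3) dB Y Z])
  from has_derivative_apply_linear[where L = "\<lambda>z u. B z u (Y z) (Z z)", OF S lin(1) this X]
  show ?thesis
    by (simp add: algebra_simps)
qed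

lemma ext_d_3:
  "ext_d A \<eta> [X, Y, Z] p =
     X p (\<lambda>q. \<eta> [Y, Z] q) - Y p (\<lambda>q. \<eta> [X, Z] q) + Z p (\<lambda>q. \<eta> [X, Y] q)
     - \<eta> [bracket A X Y, Z] p + \<eta> [bracket A X Z, Y] p - \<eta> [bracket A Y Z, X] p"
  by (simp add: ext_d_def omit_def eval_nat_numeral lessThan_Suc)

lemma ext_d_4:
  "ext_d A \<eta> [X, Y, Z, V] p =
     X p (\<lambda>q. \<eta> [Y, Z, V] q) - Y p (\<lambda>q. \<eta> [X, Z, V] q) + Z p (\<lambda>q. \<eta> [X, Y, V] q) - V p (\<lambda>q. \<eta> [X, Y, Z] q)
     - \<eta> [bracket A X Y, Z, V] p + \<eta> [bracket A X Z, Y, V] p - \<eta> [bracket A X V, Y, Z] p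
     - \<eta> [bracket A Y Z, X, V] p + \<eta> [bracket A Y V, X, Z] p - \<eta> [bracket A Z V, X, Y] p"
  by (simp add: ext_d_def omit_def eval_nat_numeral lessThan_Suc)

context atlas
begin

text \<open>The derivatives of the fields produced by the product rule cancel against the brackets.\<close>

lemma ext_d_2_form:
  assumes c: "c \<in> maximal_atlas A" and U: "mopen A U" "U \<subseteq> fst c" "p \<in> U"
    and \<eta>: "\<And>X Y q. smooth_vfield A U X \<Longrightarrow> smooth_vfield A U Y \<Longrightarrow> q \<in> U \<Longrightarrow>
      \<eta> [X, Y] q = B (snd c q) (coords c (X q)) (coords c (Y q))"
    and lin: "\<And>z v. z \<in> snd c ` U \<Longrightarrow> linear (\<lambda>u. B z u v)"
    and alt: "\<And>z u v. z \<in> snd c ` U \<Longrightarrow> B z u v = - B z v u"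
    and smooth: "\<And>u v. smooth_on (snd c ` U) (\<lambda>z. B z u v)"
    and dB: "\<And>u v. ((\<lambda>z. B z u v) has_derivative dB u v) (at (snd c p))"
    and X: "smooth_vfield A U X" and Y: "smooth_vfield A U Y" and Z: "smooth_vfield A U Z"
  shows "ext_d A \<eta> [X, Y, Z] p =
    dB (coords c (Y p)) (coords c (Z p)) (coords c (X p))
    - dB (coords c (X p)) (coords c (Z p)) (coords c (Y p))
    + dB (coords c (X p)) (coords c (Y p)) (coords c (Z p))"
proof -
  let ?x = "snd c p"
  have op: "open (snd c ` U)" "?x \<in> snd c ` U"
    using open_image[OF c U(1,2)] U by auto
  have lin2: "linear (\<lambda>v. B z u v)" if "z \<in> snd c ` U" for z u
    using linear_compose_neg[OF lin[OF that, of u]] by (simp only: alt[OF that, of u, symmetric])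
  have rep: "field_rep c W ?x = coords c (W p)" for W
    using c U by auto
  have step: "W p (\<lambda>q. \<eta> [S, T] q) =
     dB (coords c (S p)) (coords c (T p)) (coords c (W p))
     + B ?x (frechet_derivative (field_rep c S) (at ?x) (coords c (W p))) (coords c (T p))
     + B ?x (coords c (S p)) (frechet_derivative (field_rep c T) (at ?x) (coords c (W p)))"
    if W: "smooth_vfield A U W" and S: "smooth_vfield A U S" and T: "smooth_vfield A U T" for W S T
  proof -
    note sS = smooth_on_field_rep[OF c U(1,2) S] and sT = smooth_on_field_rep[OF c U(1,2) T]
    have "W p (\<lambda>q. \<eta> [S, T] q) =
     dB (field_rep c S ?x) (field_rep c T ?x) (field_rep c W ?x)
     + B ?x (frechet_derivative (field_rep c S) (at ?x) (field_rep c W ?x)) (field_rep c T ?x)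
     + B ?x (field_rep c S ?x) (frechet_derivative (field_rep c T) (at ?x) (field_rep c W ?x))"
    proof (rule field_apply_fun[OF c U W])
      show "\<eta> [S, T] q = B (snd c q) (field_rep c S (snd c q)) (field_rep c T (snd c q))" if "q \<in> U" for q
        using \<eta>[OF S T that] c U that by (auto simp: subset_iff)
      show "smooth_on (snd c ` U) (\<lambda>x. B x (field_rep c S x) (field_rep c T x))"
        by (rule smooth_on_apply_linear[OF op(1) lin2 _ sT], assumption,
            rule smooth_on_apply_linear[OF op(1) lin smooth sS])
      show "((\<lambda>x. B x (field_rep c S x) (field_rep c T x)) has_derivative
        (\<lambda>h. dB (field_rep c S ?x) (field_rep c T ?x) h
     + B ?x (frechet_derivative (field_rep c S) (at ?x) h) (field_rep c T ?x)
     + B ?x (field_rep c S ?x) (frechet_derivative (field_rep c T) (at ?x) h))) (at ?x)"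
        by (rule has_derivative_bilinear_field[OF op lin lin2 dB smooth_on_has_derivative[OF sS op(2)]
              smooth_on_has_derivative[OF sT op(2)]])
    qed
    then show ?thesis
      unfolding rep .
  qed
  have br: "\<eta> [bracket A S T, W] p =
      B ?x (frechet_derivative (field_rep c T) (at ?x) (coords c (S p))) (coords c (W p))
      - B ?x (frechet_derivative (field_rep c S) (at ?x) (coords c (T p))) (coords c (W p))"
    if S: "smooth_vfield A U S" and T: "smooth_vfield A U T" and W: "smooth_vfield A U W" for W S T
    unfolding \<eta>[OF smooth_vfield_bracket[OF c U(1,2) S T] W U(3)] coords_bracket[OF c U S T] rep
    using linear_diff[OF lin[OF op(2)]] by blast
  note anti = alt[OF op(2)]
  show ?thesis
    unfolding ext_d_3 step[OF X Y Z] step[OF Y X Z] step[OF Z X Y] br[OF X Y Z] br[OF X Z Y] br[OF Y Z X]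
    using anti[of "coords c (X p)" "frechet_derivative (field_rep c Y) (at ?x) (coords c (Z p))"]
      anti[of "coords c (X p)" "frechet_derivative (field_rep c Z) (at ?x) (coords c (Y p))"]
      anti[of "coords c (Y p)" "frechet_derivative (field_rep c Z) (at ?x) (coords c (X p))"]
    by linarith
qed

text \<open>The product rule differentiates a field in twelve terms, three for each of the four
  outer derivatives; they cancel the twelve terms of the six brackets.\<close>

lemma ext_d_3_form:
  assumes c: "c \<in> maximal_atlas A" and U: "mopen A U" "U \<subseteq> fst c" "p \<in> U"
    and \<eta>: "\<And>X Y Z q. smooth_vfield A U X \<Longrightarrow> smooth_vfield A U Y \<Longrightarrow> smooth_vfield A U Z \<Longrightarrow> q \<in> U \<Longrightarrow>
      \<eta> [X, Y, Z] q = B (snd c q) (coords c (X q)) (coords c (Y q)) (coords c (Z q))"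
    and lin: "\<And>z v w. z \<in> snd c ` U \<Longrightarrow> linear (\<lambda>u. B z u v w)"
    and alt: "\<And>z u v w. z \<in> snd c ` U \<Longrightarrow> B z u v w = - B z v u w"
      "\<And>z u v w. z \<in> snd c ` U \<Longrightarrow> B z u v w = - B z u w v"
    and smooth: "\<And>u v w. smooth_on (snd c ` U) (\<lambda>z. B z u v w)"
    and dB: "\<And>u v w. ((\<lambda>z. B z u v w) has_derivative dB u v w) (at (snd c p))"
    and X: "smooth_vfield A U X" and Y: "smooth_vfield A U Y" and Z: "smooth_vfield A U Z" and V: "smooth_vfield A U V"
  shows "ext_d A \<eta> [X, Y, Z, V] p =
    dB (coords c (Y p)) (coords c (Z p)) (coords c (V p)) (coords c (X p))
    - dB (coords c (X p)) (coords c (Z p)) (coords c (V p)) (coords c (Y p))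
    + dB (coords c (X p)) (coords c (Y p)) (coords c (V p)) (coords c (Z p))
    - dB (coords c (X p)) (coords c (Y p)) (coords c (Z p)) (coords c (V p))"
proof -
  let ?x = "snd c p"
  have op: "open (snd c ` U)" "?x \<in> snd c ` U"
    using open_image[OF c U(1,2)] U by auto
  have lin2: "linear (\<lambda>v. B z u v w)" if "z \<in> snd c ` U" for z u w
    using linear_compose_neg[OF lin[OF that, of u w]] by (simp only: alt(1)[OF that, of u, symmetric])
  have lin3: "linear (\<lambda>w. B z u v w)" if "z \<in> snd c ` U" for z u v
    using linear_compose_neg[OF lin2[OF that, of u v]] by (simp only: alt(2)[OF that, of u v, symmetric])
  have rep: "field_rep c W ?x = coords c (W p)" for W
    using c U by auto
  define D where "D = (\<lambda>S T. frechet_derivative (field_rep c S) (at ?x) (coords c (T p)))"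
  have step: "W p (\<lambda>q. \<eta> [S, T, R] q) =
     dB (coords c (S p)) (coords c (T p)) (coords c (R p)) (coords c (W p))
     + B ?x (D S W) (coords c (T p)) (coords c (R p))
     + B ?x (coords c (S p)) (D T W) (coords c (R p))
     + B ?x (coords c (S p)) (coords c (T p)) (D R W)"
    if W: "smooth_vfield A U W" and S: "smooth_vfield A U S" and T: "smooth_vfield A U T"
      and R: "smooth_vfield A U R" for W S T R
  proof -
    note sS = smooth_on_field_rep[OF c U(1,2) S] and sT = smooth_on_field_rep[OF c U(1,2) T]
      and sR = smooth_on_field_rep[OF c U(1,2) R]
    have "W p (\<lambda>q. \<eta> [S, T, R] q) =
     dB (field_rep c S ?x) (field_rep c T ?x) (field_rep c R ?x) (field_rep c W ?x)
     + B ?x (frechet_derivative (field_rep c S) (at ?x) (field_rep c W ?x)) (field_rep c T ?x) (field_rep c R ?x)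
     + B ?x (field_rep c S ?x) (frechet_derivative (field_rep c T) (at ?x) (field_rep c W ?x)) (field_rep c R ?x)
     + B ?x (field_rep c S ?x) (field_rep c T ?x) (frechet_derivative (field_rep c R) (at ?x) (field_rep c W ?x))"
    proof (rule field_apply_fun[OF c U W])
      show "\<eta> [S, T, R] q = B (snd c q) (field_rep c S (snd c q)) (field_rep c T (snd c q)) (field_rep c R (snd c q))"
        if "q \<in> U" for q
        using \<eta>[OF S T R that] c U that by (auto simp: subset_iff)
      show "smooth_on (snd c ` U) (\<lambda>x. B x (field_rep c S x) (field_rep c T x) (field_rep c R x))"
        by (rule smooth_on_apply_linear[OF op(1) lin3 _ sR], assumption,
            rule smooth_on_apply_linear[OF op(1) lin2 _ sT], assumption,
            rule smooth_on_apply_linear[OF op(1) lin smooth sS])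
      show "((\<lambda>x. B x (field_rep c S x) (field_rep c T x) (field_rep c R x)) has_derivative
        (\<lambda>h. dB (field_rep c S ?x) (field_rep c T ?x) (field_rep c R ?x) h
     + B ?x (frechet_derivative (field_rep c S) (at ?x) h) (field_rep c T ?x) (field_rep c R ?x)
     + B ?x (field_rep c S ?x) (frechet_derivative (field_rep c T) (at ?x) h) (field_rep c R ?x)
     + B ?x (field_rep c S ?x) (field_rep c T ?x) (frechet_derivative (field_rep c R) (at ?x) h))) (at ?x)"
        by (rule has_derivative_trilinear_field[OF op lin lin2 lin3 dB smooth_on_has_derivative[OF sS op(2)]
              smooth_on_has_derivative[OF sT op(2)] smooth_on_has_derivative[OF sR op(2)]])
    qed
    then show ?thesis
      unfolding rep D_def .
  qed
  have br: "\<eta> [bracket A S T, W, R] p =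
      B ?x (D T S) (coords c (W p)) (coords c (R p)) - B ?x (D S T) (coords c (W p)) (coords c (R p))"
    if S: "smooth_vfield A U S" and T: "smooth_vfield A U T" and W: "smooth_vfield A U W"
      and R: "smooth_vfield A U R" for W S T R
    unfolding \<eta>[OF smooth_vfield_bracket[OF c U(1,2) S T] W R U(3)] coords_bracket[OF c U S T] rep D_def
    using linear_diff[OF lin[OF op(2)]] by blast
  \<comment> \<open>Brackets enter in the first slot, so every differentiated field is moved there:
    one exchange from the second slot, two from the third.\<close>
  have mid: "B ?x (coords c (S p)) (D T W) (coords c (R p)) = - B ?x (D T W) (coords c (S p)) (coords c (R p))"
    and last: "B ?x (coords c (S p)) (coords c (T p)) (D R W) = B ?x (D R W) (coords c (S p)) (coords c (T p))"
    for S T W R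
    using alt(1)[OF op(2), of "coords c (S p)" "D T W" "coords c (R p)"]
      alt(2)[OF op(2), of "coords c (S p)" "coords c (T p)" "D R W"]
      alt(1)[OF op(2), of "coords c (S p)" "D R W" "coords c (T p)"]
    by linarith+
  show ?thesis
    unfolding ext_d_4 step[OF X Y Z V] step[OF Y X Z V] step[OF Z X Y V] step[OF V X Y Z]
      br[OF X Y Z V] br[OF X Z Y V] br[OF X V Y Z] br[OF Y Z X V] br[OF Y V X Z] br[OF Z V X Y]
      mid last
    by simp
qed

end

section \<open>Existence of affine coordinates\<close>

lemma has_derivative_vec_lambda:
  fixes f :: "'z::real_normed_vector \<Rightarrow> 'm::finite \<Rightarrow> real"
  assumes "\<And>i. ((\<lambda>x. f x i) has_derivative (\<lambda>h. f' h i)) (at x)"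
  shows "((\<lambda>x. \<chi> i. f x i) has_derivative (\<lambda>h. \<chi> i. f' h i)) (at x)"
proof (rule has_derivative_componentwise_within[THEN iffD2], rule)
  fix b :: "real^'m" assume "b \<in> Basis"
  then obtain i where "b = axis i 1"
    by (auto simp: Basis_vec_def)
  then show "((\<lambda>x. (\<chi> i. f x i) \<bullet> b) has_derivative (\<lambda>h. (\<chi> i. f' h i) \<bullet> b)) (at x)"
    using assms[of i] by (simp add: inner_axis)
qed

locale affine_manifold = atlas A for A :: "('a, real^'n) chart set" +
  fixes nab :: "'a conn"
  assumes conn: "connection A nab" and flat: "flat A nab" and torsionless: "torsionless A nab"
begin

section \<open>The connection in a chart and its Christoffel symbols\<close>

lemma nab_tangent:
  "mopen A U \<Longrightarrow> smooth_vfield A U Y \<Longrightarrow> p \<in> U \<Longrightarrow> v \<in> tangent_space A p \<Longrightarrow> nab p v Y \<in> tangent_space A p"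
  using conn unfolding connection_def by blast

lemma nab_lin:
  "mopen A U \<Longrightarrow> smooth_vfield A U Y \<Longrightarrow> p \<in> U \<Longrightarrow> v \<in> tangent_space A p \<Longrightarrow> w \<in> tangent_space A p \<Longrightarrow>
    nab p (\<lambda>f. a * v f + b * w f) Y = (\<lambda>f. a * nab p v Y f + b * nab p w Y f)"
  using conn unfolding connection_def by blast

lemma nab_add:
  "mopen A U \<Longrightarrow> smooth_vfield A U Y \<Longrightarrow> p \<in> U \<Longrightarrow> v \<in> tangent_space A p \<Longrightarrow> smooth_vfield A U Z \<Longrightarrow>
    nab p v (\<lambda>q f. Y q f + Z q f) = (\<lambda>f. nab p v Y f + nab p v Z f)"
  using conn unfolding connection_def by blast

lemma nab_mult:
  "mopen A U \<Longrightarrow> smooth_vfield A U Y \<Longrightarrow> p \<in> U \<Longrightarrow> v \<in> tangent_space A p \<Longrightarrow> smooth_fun A U k \<Longrightarrow>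
    nab p v (\<lambda>q f. k q * Y q f) = (\<lambda>f. v k * Y p f + k p * nab p v Y f)"
  using conn unfolding connection_def by blast

lemma nab_cong:
  assumes "mopen A U" "smooth_vfield A U Y" "p \<in> U" "v \<in> tangent_space A p" "\<And>q. q \<in> U \<Longrightarrow> Z q = Y q"
  shows "nab p v Z = nab p v Y"
proof -
  note axioms = conn[unfolded connection_def, THEN conjunct2, THEN spec, THEN spec, THEN spec,
      THEN mp, THEN mp, THEN mp, THEN bspec, OF assms(1-4)]
  have "\<forall>q\<in>U. Z q = Y q"
    using assms(5) by blast
  then show ?thesis
    using axioms[THEN conjunct2, THEN conjunct2, THEN conjunct2, THEN conjunct2, THEN spec, THEN mp] by blast
qed

lemma smooth_vfield_cov:
  "mopen A U \<Longrightarrow> smooth_vfield A U X \<Longrightarrow> smooth_vfield A U Y \<Longrightarrow> smooth_vfield A U (cov nab X Y)"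
  using conn unfolding connection_def by blast

text \<open>Components of the covariant derivative along \<open>u\<close> of the field with constant
  components \<open>w\<close>. Only basis fields are differentiated and \<open>w\<close> enters
  through its coordinates, so linearity in \<open>w\<close> is built in; linearity in
  \<open>u\<close> comes from the connection axioms.\<close>

definition christoffel :: "('a, real^'n) chart \<Rightarrow> real^'n \<Rightarrow> real^'n \<Rightarrow> real^'n \<Rightarrow> real^'n" where
  "christoffel c x u w =
     (\<Sum>b\<in>Basis. (w \<bullet> b) *\<^sub>R coords c (nab (chart_inv c x) (dir_deriv A c u (chart_inv c x)) (dir_deriv A c b)))"

lemma linear_christoffel_right: "linear (christoffel c x u)"
  by (rule linearI)
    (simp_all add: christoffel_def inner_add_left scaleR_add_left sum.distrib scaleR_sum_right)

lemma linear_christoffel_left: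
  assumes c: "c \<in> maximal_atlas A" and x: "x \<in> snd c ` fst c"
  shows "linear (\<lambda>u. christoffel c x u w)"
proof -
  have p: "chart_inv c x \<in> fst c"
    using c x by auto
  let ?p = "chart_inv c x"
  have "coords c (nab ?p (dir_deriv A c (a *\<^sub>R u + b *\<^sub>R v) ?p) (dir_deriv A c d))
    = a *\<^sub>R coords c (nab ?p (dir_deriv A c u ?p) (dir_deriv A c d))
    + b *\<^sub>R coords c (nab ?p (dir_deriv A c v ?p) (dir_deriv A c d))" for a b u v d
    unfolding dir_deriv_lin[OF c p]
      nab_lin[OF mopen_chart[OF c] smooth_vfield_dir_deriv[OF c] p dir_deriv_in_tangent_space[OF c p] dir_deriv_in_tangent_space[OF c p]]
      coords_lin ..
  from this[of 1 _ 1] this[of _ _ 0 0]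
  show ?thesis
    by (intro linearI) (simp_all add: christoffel_def scaleR_add_right sum.distrib scaleR_sum_right mult.commute)
qed

lemma smooth_on_christoffel:
  assumes c: "c \<in> maximal_atlas A"
  shows "smooth_on (snd c ` fst c) (\<lambda>x. christoffel c x u w)"
proof -
  note op = open_image[OF c mopen_chart[OF c] order_refl]
  have "smooth_on (snd c ` fst c) (field_rep c (cov nab (dir_deriv A c u) (dir_deriv A c b)))" for b
    by (intro smooth_on_field_rep smooth_vfield_cov smooth_vfield_dir_deriv c mopen_chart order_refl)
  then show ?thesis
    unfolding christoffel_def cov_def
    by (intro smooth_on_sum smooth_on_bilinear[OF bounded_bilinear_scaleR] smooth_on_const op)
qed

text \<open>\<open>Y\<close> is a combination of basis fields with coefficient functions
  \<open>k b\<close>. Additivity and the Leibniz rule split its covariant derivative into the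
  derivative of the coefficients and the Christoffel term.\<close>

lemma coords_nab:
  assumes c: "c \<in> maximal_atlas A" and U: "mopen A U" "U \<subseteq> fst c" "p \<in> U"
    and Y: "smooth_vfield A U Y" and v: "v \<in> tangent_space A p"
  shows "coords c (nab p v Y) =
    frechet_derivative (field_rep c Y) (at (snd c p)) (coords c v)
    + christoffel c (snd c p) (coords c v) (coords c (Y p))"
proof -
  have p: "p \<in> fst c"
    using U by auto
  note op = open_image[OF c U(1,2)] and sY = smooth_on_field_rep[OF c U(1,2) Y]
  define k where "k b q = field_rep c Y (snd c q) \<bullet> b" for b q
  have sk: "smooth_on (snd c ` U) (\<lambda>x. field_rep c Y x \<bullet> b)" for b
    by (rule smooth_on_linear[OF bounded_linear_inner_left op sY])
  have k: "smooth_fun A U (k b)" for b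
    by (rule smooth_funI[OF c U(1,2)], rule smooth_on_cong[OF op _ sk[of b]])
      (use c U in \<open>auto simp: k_def subset_iff\<close>)
  have vk: "v (k b) = frechet_derivative (field_rep c Y) (at (snd c p)) (coords c v) \<bullet> b" for b
  proof -
    have "v (k b) = dir_deriv A c (coords c v) p (k b)"
      using v tangent_space_chart[OF c p] by (metis (no_types))
    also have "\<dots> = frechet_derivative (field_rep c Y) (at (snd c p)) (coords c v) \<bullet> b"
      by (rule dir_deriv_eqI(2)[OF c U, where K = "\<lambda>x. field_rep c Y x \<bullet> b"])
        (use U in \<open>auto simp: k_def intro!: sk has_derivative_inner_left smooth_on_has_derivative[OF sY]\<close>)
    finally show ?thesis .
  qed
  have dir: "smooth_vfield A U (dir_deriv A c b)" for b
    using smooth_vfield_mono[OF smooth_vfield_dir_deriv[OF c] U(2)] .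
  have smoothF: "smooth_vfield A U (\<lambda>q f. \<Sum>b\<in>I. k b q * dir_deriv A c b q f)" if "finite I" for I
  proof (rule smooth_vfieldI[OF c U(1,2)])
    show "smooth_on (snd c ` U) (\<lambda>x. \<Sum>b\<in>I. (field_rep c Y x \<bullet> b) *\<^sub>R b)"
      by (intro smooth_on_sum smooth_on_bilinear[OF bounded_bilinear_scaleR] smooth_on_const op sk)
    show "(\<lambda>f. \<Sum>b\<in>I. k b q * dir_deriv A c b q f) =
        dir_deriv A c (\<Sum>b\<in>I. (field_rep c Y (snd c q) \<bullet> b) *\<^sub>R b) q" if "q \<in> U" for q
      using dir_deriv_sum[OF c _ \<open>finite I\<close>, of q "\<lambda>b. field_rep c Y (snd c q) \<bullet> b" "\<lambda>b. b"] that U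
      by (auto simp: k_def)
  qed
  have nabF: "nab p v (\<lambda>q f. \<Sum>b\<in>I. k b q * dir_deriv A c b q f)
      = (\<lambda>f. \<Sum>b\<in>I. v (k b) * dir_deriv A c b p f + k b p * nab p v (dir_deriv A c b) f)"
    if "finite I" for I
    using that
  proof (induction I rule: finite_induct)
    case empty
    let ?n = "nab p v (\<lambda>q f. 0)"
    have "smooth_vfield A U (\<lambda>q f. 0)"
      using smoothF[of "{}"] by simp
    \<comment> \<open>The covariant derivative of the zero field vanishes, since by additivity it
      equals its own double.\<close>
    from nab_add[OF U(1) this U(3) v this] have "?n f = ?n f + ?n f" for f
      by (simp add: fun_eq_iff)
    then show ?case
      by (auto simp: fun_eq_iff)
  next
    case (insert b I)
    have 1: "smooth_vfield A U (\<lambda>q f. k b q * dir_deriv A c b q f)"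
      using smoothF[of "{b}"] by simp
    show ?case
      using nab_add[OF U(1) 1 U(3) v smoothF[OF insert(1)]] nab_mult[OF U(1) dir U(3) v k, of b b] insert
      by (simp add: fun_eq_iff)
  qed
  \<comment> \<open>The expansion of \<open>Y\<close> holds on \<open>U\<close> only, so locality of
    the connection is invoked.\<close>
  have "nab p v (\<lambda>q f. \<Sum>b\<in>Basis. k b q * dir_deriv A c b q f) = nab p v Y"
  proof (rule nab_cong[OF U(1) Y U(3) v])
    fix q assume q: "q \<in> U"
    have "Y q = dir_deriv A c (field_rep c Y (snd c q)) q"
      by (rule vfield_eq[OF c Y q]) (use q U in auto)
    also have "field_rep c Y (snd c q) = (\<Sum>b\<in>Basis. k b q *\<^sub>R b)"
      by (simp add: k_def euclidean_representation)
    also have "dir_deriv A c \<dots> q = (\<lambda>f. \<Sum>b\<in>Basis. k b q * dir_deriv A c b q f)"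
      by (rule dir_deriv_sum[OF c]) (use q U in auto)
    finally show "(\<lambda>f. \<Sum>b\<in>Basis. k b q * dir_deriv A c b q f) = Y q"
      by simp
  qed
  then have nabY: "nab p v Y = (\<lambda>f. 1 * (\<Sum>b\<in>Basis. v (k b) * dir_deriv A c b p f)
      + 1 * (\<Sum>b\<in>Basis. k b p * nab p v (dir_deriv A c b) f))"
    using nabF[OF finite_Basis] by (simp add: sum.distrib)
  have "coords c (nab p v Y) =
      (\<Sum>b\<in>Basis. v (k b) *\<^sub>R coords c (dir_deriv A c b p)) + (\<Sum>b\<in>Basis. k b p *\<^sub>R coords c (nab p v (dir_deriv A c b)))"
    unfolding nabY coords_lin coords_sum scaleR_one ..
  also have "(\<Sum>b\<in>Basis. v (k b) *\<^sub>R coords c (dir_deriv A c b p))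
      = frechet_derivative (field_rep c Y) (at (snd c p)) (coords c v)"
    by (simp add: vk coords_dir_deriv[OF c p] euclidean_representation)
  also have "(\<Sum>b\<in>Basis. k b p *\<^sub>R coords c (nab p v (dir_deriv A c b)))
      = christoffel c (snd c p) (coords c v) (coords c (Y p))"
  proof -
    have "dir_deriv A c (coords c v) p = v"
      using v tangent_space_chart[OF c p] by (metis (no_types))
    then show ?thesis
      using p c by (simp add: christoffel_def k_def)
  qed
  finally show ?thesis .
qed

lemma field_rep_dir_deriv:
  assumes "c \<in> maximal_atlas A" "x \<in> snd c ` fst c"
  shows "field_rep c (dir_deriv A c u) x = u"
    and "frechet_derivative (field_rep c (dir_deriv A c u)) (at x) = (\<lambda>v. 0)"
proof -
  have *: "u = field_rep c (dir_deriv A c u) y" if "y \<in> snd c ` fst c" for y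
    using that assms(1) by auto
  show "field_rep c (dir_deriv A c u) x = u"
    using *[OF assms(2)] by simp
  have "((\<lambda>y. u) has_derivative (\<lambda>v. 0)) (at x)"
    by (rule has_derivative_const)
  then have "(field_rep c (dir_deriv A c u) has_derivative (\<lambda>v. 0)) (at x)"
    by (rule has_derivative_transform_within_open[OF _ open_image[OF assms(1) mopen_chart[OF assms(1)] order_refl] assms(2) *])
  then show "frechet_derivative (field_rep c (dir_deriv A c u)) (at x) = (\<lambda>v. 0)"
    by (rule frechet_derivative_works_at)
qed

lemma coords_nab_dir_deriv:
  assumes c: "c \<in> maximal_atlas A" and p: "p \<in> fst c" and v: "v \<in> tangent_space A p"
  shows "coords c (nab p v (dir_deriv A c w)) = christoffel c (snd c p) (coords c v) w"
  using coords_nab[OF c mopen_chart[OF c] order_refl p smooth_vfield_dir_deriv[OF c] v]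
    field_rep_dir_deriv(2)[OF c] p coords_dir_deriv[OF c p] by simp

lemma bracket_dir_deriv:
  assumes c: "c \<in> maximal_atlas A" and p: "p \<in> fst c"
  shows "bracket A (dir_deriv A c u) (dir_deriv A c v) p = dir_deriv A c 0 p"
  using bracket_eq[OF c mopen_chart[OF c] order_refl p smooth_vfield_dir_deriv[OF c] smooth_vfield_dir_deriv[OF c], of u v]
    field_rep_dir_deriv(2)[OF c] p by simp

text \<open>Fields with constant components commute, so vanishing torsion compares the two
  Christoffel terms alone.\<close>

lemma christoffel_symmetric:
  assumes c: "c \<in> maximal_atlas A" and x: "x \<in> snd c ` fst c"
  shows "christoffel c x u w = christoffel c x w u"
proof -
  obtain p where p: "p \<in> fst c" "x = snd c p"
    using x by auto
  have "cov nab (dir_deriv A c u) (dir_deriv A c w) p f - cov nab (dir_deriv A c w) (dir_deriv A c u) p f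
      - bracket A (dir_deriv A c u) (dir_deriv A c w) p f = 0" for f
    using torsionless mopen_chart[OF c] smooth_vfield_dir_deriv[OF c] p(1) unfolding torsionless_def by blast
  then have "cov nab (dir_deriv A c u) (dir_deriv A c w) p = cov nab (dir_deriv A c w) (dir_deriv A c u) p"
    using bracket_dir_deriv[OF c p(1)] dir_deriv_zero[OF c p(1)] by (auto simp: fun_eq_iff)
  then show ?thesis
    unfolding cov_def p(2)
    using coords_nab_dir_deriv[OF c p(1) dir_deriv_in_tangent_space[OF c p(1)]] coords_dir_deriv[OF c p(1)] by metis
qed

text \<open>For commuting fields the bracket term of the curvature vanishes. Two iterated covariant
  derivatives remain, each of which is, in coordinates, the derivative of a Christoffel term plus a
  product of two.\<close>

lemma christoffel_flat:
  assumes c: "c \<in> maximal_atlas A" and x: "x \<in> snd c ` fst c"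
  shows "frechet_derivative (\<lambda>y. christoffel c y v w) (at x) u + christoffel c x u (christoffel c x v w)
    = frechet_derivative (\<lambda>y. christoffel c y u w) (at x) v + christoffel c x v (christoffel c x u w)"
proof -
  obtain p where p: "p \<in> fst c" "x = snd c p"
    using x by auto
  let ?d = "dir_deriv A c"
  note oc = mopen_chart[OF c] and tan = dir_deriv_in_tangent_space[OF c]
  have second: "coords c (cov nab (?d u) (cov nab (?d v) (?d w)) p) =
      frechet_derivative (\<lambda>y. christoffel c y v w) (at x) u + christoffel c x u (christoffel c x v w)" for u v
  proof -
    have rep: "christoffel c y v w = field_rep c (cov nab (?d v) (?d w)) y" if "y \<in> snd c ` fst c" for y
    proof -
      obtain q where q: "q \<in> fst c" "y = snd c q"
        using \<open>y \<in> snd c ` fst c\<close> by auto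
      then show ?thesis
        using coords_nab_dir_deriv[OF c q(1) tan[OF q(1)], of v w] coords_dir_deriv[OF c q(1)] c
        by (simp add: cov_def)
    qed
    have "frechet_derivative (\<lambda>y. christoffel c y v w) (at x)
        = frechet_derivative (field_rep c (cov nab (?d v) (?d w))) (at x)"
      by (rule frechet_derivative_transform_within_open[OF smooth_on_differentiable[OF smooth_on_christoffel[OF c] x]
            open_image[OF c oc order_refl] x rep])
    moreover have "coords c (cov nab (?d v) (?d w) p) = christoffel c x v w"
      using rep[OF x] p c by simp
    ultimately show ?thesis
      using coords_nab[OF c oc order_refl p(1) smooth_vfield_cov[OF oc smooth_vfield_dir_deriv[OF c] smooth_vfield_dir_deriv[OF c]] tan[OF p(1)],
          of u v w] coords_dir_deriv[OF c p(1)]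
      by (simp add: cov_def[of nab "?d u"] p(2))
  qed
  have "cov nab (?d u) (cov nab (?d v) (?d w)) p f - cov nab (?d v) (cov nab (?d u) (?d w)) p f
      - cov nab (bracket A (?d u) (?d v)) (?d w) p f = 0" for f
    using flat oc smooth_vfield_dir_deriv[OF c] p(1) unfolding flat_def by blast
  moreover have "cov nab (bracket A (?d u) (?d v)) (?d w) p = (\<lambda>f. 0)"
  proof -
    have br: "bracket A (?d u) (?d v) p \<in> tangent_space A p"
      using bracket_dir_deriv[OF c p(1)] tan[OF p(1)] by simp
    have "coords c (cov nab (bracket A (?d u) (?d v)) (?d w) p) = 0"
      unfolding cov_def coords_nab_dir_deriv[OF c p(1) tan[OF p(1)]] bracket_dir_deriv[OF c p(1)] coords_dir_deriv[OF c p(1)]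
      by (rule linear_0[OF linear_christoffel_left[OF c]]) (use p(1) in simp)
    moreover have "cov nab (bracket A (?d u) (?d v)) (?d w) p \<in> tangent_space A p"
      unfolding cov_def by (rule nab_tangent[OF oc smooth_vfield_dir_deriv[OF c] p(1) br])
    ultimately show ?thesis
      using tangent_space_chart[OF c p(1)] dir_deriv_zero[OF c p(1)] by (metis (no_types))
  qed
  ultimately have "cov nab (?d u) (cov nab (?d v) (?d w)) p = cov nab (?d v) (cov nab (?d u) (?d w)) p"
    by (auto simp: fun_eq_iff)
  then show ?thesis
    using second by metis
qed

text \<open>The unknown of the total equation is a function together with its gradient
  \<open>\<theta>\<close>. \<open>adj x u\<close> is the transpose of \<open>\<Gamma> x u\<close>;
  it is the rate of change of the gradient along \<open>u\<close> that the prescribed Hessian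
  demands.\<close>

lemma affine_functions:
  assumes c: "c \<in> maximal_atlas A" and a: "a \<in> snd c ` fst c"
  obtains r \<phi> where "r > 0" "ball a r \<subseteq> snd c ` fst c" "smooth_on (ball a r) (\<phi> :: real^'n \<Rightarrow> real^'n)"
    "\<And>v. frechet_derivative \<phi> (at a) v = v"
    "\<And>x u v. x \<in> ball a r \<Longrightarrow> frechet_derivative (\<lambda>y. frechet_derivative \<phi> (at y) v) (at x) u
      = frechet_derivative \<phi> (at x) (christoffel c x u v)"
proof -
  let ?S = "snd c ` fst c"
  let ?\<Gamma> = "christoffel c"
  have op: "open ?S"
    by (rule open_image[OF c mopen_chart[OF c] order_refl])
  define adj where "adj x u \<theta> = (\<Sum>b\<in>Basis. (\<theta> \<bullet> ?\<Gamma> x u b) *\<^sub>R b)" for x u and \<theta> :: "real^'n"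
  have adj: "adj x u \<theta> \<bullet> w = \<theta> \<bullet> ?\<Gamma> x u w" for x u \<theta> w
  proof -
    have "adj x u \<theta> \<bullet> w = \<theta> \<bullet> (\<Sum>b\<in>Basis. (w \<bullet> b) *\<^sub>R ?\<Gamma> x u b)"
      by (simp add: adj_def inner_sum_left inner_sum_right inner_commute mult.commute)
    then show ?thesis
      using linear_expand_Basis[OF linear_christoffel_right, of c x u w] by simp
  qed
  define H where "H x u w = (snd w \<bullet> u, adj x u (snd w))" for x u and w :: "real \<times> (real^'n)"
  have smooth_adj: "smooth_on ?S (\<lambda>x. adj x u \<theta>)" for u \<theta>
    unfolding adj_def
    by (intro smooth_on_sum smooth_on_bilinear[OF bounded_bilinear_scaleR]
        smooth_on_linear[OF bounded_linear_inner_right] smooth_on_christoffel[OF c] smooth_on_const op)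
  have dadj: "((\<lambda>y. adj y v \<theta>) has_derivative
      (\<lambda>u. \<Sum>b\<in>Basis. (\<theta> \<bullet> frechet_derivative (\<lambda>y. ?\<Gamma> y v b) (at x) u) *\<^sub>R b)) (at x)" if "x \<in> ?S" for x v \<theta>
    unfolding adj_def
    by (intro has_derivative_sum has_derivative_scaleR_left has_derivative_inner_right
        smooth_on_has_derivative[OF smooth_on_christoffel[OF c] that])
  have lin_left: "linear (\<lambda>u. ?\<Gamma> x u w)" if "x \<in> ?S" for x w
    using linear_christoffel_left[OF c that] .
  have "\<exists>r>0. ball a r \<subseteq> ?S \<and> (\<forall>w. \<exists>f. f a = w \<and> smooth_on (ball a r) f \<and>
      (\<forall>x\<in>ball a r. (f has_derivative (\<lambda>u. H x u (f x))) (at x)))"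
  proof (rule linear_total_equation[OF op a])
    show "smooth_on ?S (\<lambda>x. H x u w)" for u w
    proof -
      have pair: "(\<lambda>x. H x u w) = (\<lambda>x. (snd w \<bullet> u, 0) + (\<lambda>y. (0, y)) (adj x u (snd w)))"
        by (simp add: H_def)
      show ?thesis
        unfolding pair
        by (rule smooth_on_add[OF op smooth_on_const
              smooth_on_linear[OF bounded_linear_Pair[OF bounded_linear_zero bounded_linear_ident] op smooth_adj]])
    qed
    show "bilinear (H x)" if "x \<in> ?S" for x
      unfolding bilinear_def
      by (intro conjI allI linearI)
        (auto simp: H_def adj_def inner_add_left inner_add_right scaleR_add_left sum.distrib scaleR_sum_right
          linear_add[OF lin_left[OF that]] linear_scale[OF lin_left[OF that]])
    show "frechet_derivative (\<lambda>y. H y v w) (at x) u + H x v (H x u w)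
        = frechet_derivative (\<lambda>y. H y u w) (at x) v + H x u (H x v w)" if x: "x \<in> ?S" for x u v w
    proof -
      have fd: "frechet_derivative (\<lambda>y. H y v w) (at x) u =
          (0, \<Sum>b\<in>Basis. (snd w \<bullet> frechet_derivative (\<lambda>y. ?\<Gamma> y v b) (at x) u) *\<^sub>R b)" for u v
      proof -
        have "((\<lambda>y. H y v w) has_derivative
           (\<lambda>u. (0, \<Sum>b\<in>Basis. (snd w \<bullet> frechet_derivative (\<lambda>y. ?\<Gamma> y v b) (at x) u) *\<^sub>R b))) (at x)"
          unfolding H_def by (intro has_derivative_Pair has_derivative_const dadj x)
        then show ?thesis
          by (simp add: frechet_derivative_works_at)
      qed
      \<comment> \<open>The first component is symmetric in \<open>u\<close> and \<open>v\<close> by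
        vanishing torsion; the second, added to the one in \<open>fd\<close>, is symmetric by
        vanishing curvature.\<close>
      have HH: "H x v (H x u w) = (snd w \<bullet> ?\<Gamma> x u v, \<Sum>b\<in>Basis. (snd w \<bullet> ?\<Gamma> x u (?\<Gamma> x v b)) *\<^sub>R b)" for u v
        by (simp add: H_def adj) (simp add: adj_def[of x v] adj)
      show ?thesis
        unfolding fd HH
        using christoffel_symmetric[OF c x, of u v] christoffel_flat[OF c x, of v _ u]
        by (simp add: sum.distrib[symmetric] scaleR_add_left[symmetric] inner_add_right[symmetric])
    qed
  qed
  then obtain r where r: "r > 0" "ball a r \<subseteq> ?S" and ex: "\<forall>w. \<exists>f. f a = w \<and> smooth_on (ball a r) f \<and>
      (\<forall>x\<in>ball a r. (f has_derivative (\<lambda>u. H x u (f x))) (at x))"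
    by blast
  \<comment> \<open>Value \<open>0\<close> and gradient the \<open>i\<close>-th unit vector at
    \<open>a\<close> make the Jacobian of the assembled map the identity there, as
    \<open>local_diffeomorphism\<close> requires.\<close>
  then have "\<exists>f. \<forall>i::'n. f i a = (0, axis i 1) \<and> smooth_on (ball a r) (f i) \<and>
      (\<forall>x\<in>ball a r. (f i has_derivative (\<lambda>u. H x u (f i x))) (at x))"
    by (intro choice) blast
  then obtain f where fa: "\<And>i. f i a = (0, axis i 1)" and sf: "\<And>i. smooth_on (ball a r) (f i)"
    and df: "\<And>i x. x \<in> ball a r \<Longrightarrow> (f i has_derivative (\<lambda>u. H x u (f i x))) (at x)"
    by blast
  define \<phi> :: "real^'n \<Rightarrow> real^'n" where "\<phi> x = (\<chi> i. fst (f i x))" for x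
  have d\<phi>: "(\<phi> has_derivative (\<lambda>u. \<chi> i. snd (f i x) \<bullet> u)) (at x)" if "x \<in> ball a r" for x
  proof -
    have "((\<lambda>x. fst (f i x)) has_derivative (\<lambda>u. snd (f i x) \<bullet> u)) (at x)" for i
      using has_derivative_fst[OF df[OF that, of i]] by (simp add: H_def)
    then show ?thesis
      unfolding \<phi>_def by (rule has_derivative_vec_lambda)
  qed
  have s\<phi>: "smooth_on (ball a r) \<phi>"
    unfolding smooth_on_def \<phi>_def
    by (intro allI Ck_on_vec[OF open_ball])
      (simp add: smooth_onD[OF smooth_on_linear[OF bounded_linear_fst open_ball sf]] del: Ck_on.simps)
  have fd\<phi>: "frechet_derivative \<phi> (at x) u = (\<chi> i. snd (f i x) \<bullet> u)" if "x \<in> ball a r" for x u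
    using frechet_derivative_works_at[OF d\<phi>[OF that]] by simp
  show thesis
  proof (rule that[OF r s\<phi>])
    show "frechet_derivative \<phi> (at a) v = v" for v
      using fd\<phi>[of a v] r fa by (simp add: inner_axis' vec_eq_iff)
    fix x u v assume x: "x \<in> ball a r"
    have "((\<lambda>y. \<chi> i. snd (f i y) \<bullet> v) has_derivative (\<lambda>u. \<chi> i. snd (f i x) \<bullet> ?\<Gamma> x u v)) (at x)"
    proof (rule has_derivative_vec_lambda)
      fix i
      have "((\<lambda>y. snd (f i y) \<bullet> v) has_derivative (\<lambda>u. snd (H x u (f i x)) \<bullet> v)) (at x)"
        by (intro has_derivative_inner_left has_derivative_snd df x)
      then show "((\<lambda>y. snd (f i y) \<bullet> v) has_derivative (\<lambda>u. snd (f i x) \<bullet> ?\<Gamma> x u v)) (at x)"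
        by (simp add: H_def adj)
    qed
    then have "((\<lambda>y. frechet_derivative \<phi> (at y) v) has_derivative (\<lambda>u. \<chi> i. snd (f i x) \<bullet> ?\<Gamma> x u v)) (at x)"
      by (rule has_derivative_transform_within_open[OF _ open_ball x]) (simp add: fd\<phi>)
    then show "frechet_derivative (\<lambda>y. frechet_derivative \<phi> (at y) v) (at x) u
      = frechet_derivative \<phi> (at x) (christoffel c x u v)"
      by (simp add: frechet_derivative_works_at fd\<phi>[OF x])
  qed
qed

text \<open>The transition maps of \<open>c'\<close> are those of \<open>c\<close> composed with
  \<open>\<phi>\<close> or \<open>h\<close>. The second claim identifies \<open>h\<close> as the
  transition back to \<open>c\<close>, which later converts coordinate fields.\<close>

lemma maximal_atlas_reparametrize:
  assumes c: "c \<in> maximal_atlas A" and N: "open N" "N \<subseteq> snd c ` fst c" and V: "open V"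
    and hom: "homeomorphism N V \<phi> h" and smooth: "smooth_on N \<phi>" "smooth_on V h"
    and c': "c' = ({q \<in> fst c. snd c q \<in> N}, \<phi> \<circ> snd c)"
  shows "c' \<in> maximal_atlas A"
    and "\<And>y. y \<in> V \<Longrightarrow> (snd c \<circ> chart_inv c') y = h y"
proof -
  have inj: "inj_on (snd c') (fst c')"
  proof (rule inj_onI)
    fix q q' assume q: "q \<in> fst c'" "q' \<in> fst c'" "snd c' q = snd c' q'"
    then have "snd c q = snd c q'"
      using homeomorphism_apply1[OF hom] by (auto simp: c') (metis)
    then show "q = q'"
      using q chart_inj[OF c] by (auto simp: c' inj_on_def)
  qed
  have img: "snd c ` fst c' = N"
    using N(2) by (auto simp: c')
  have img': "snd c' ` fst c' = V"
  proof -
    have "snd c' ` fst c' = \<phi> ` (snd c ` fst c')"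
      by (simp add: c' image_comp)
    then show ?thesis
      using img homeomorphism_image1[OF hom] by simp
  qed
  have sub: "fst c' \<subseteq> fst c"
    by (auto simp: c')
  have h: "h y = snd c q" if "q \<in> fst c'" "y = snd c' q" for q y
    using that homeomorphism_apply1[OF hom] by (auto simp: c')
  have inv: "chart_inv c' (snd c' q) = q" if "q \<in> fst c'" for q
    using that inj by simp
  show hV: "(snd c \<circ> chart_inv c') y = h y" if y: "y \<in> V" for y
  proof -
    obtain q where q: "q \<in> fst c'" "y = snd c' q"
      using y img' by blast
    then show ?thesis
      using inv h by simp
  qed
  have mo: "mopen A (fst c')"
    using mopen_preimage[OF c N(1)] by (simp add: c')
  have "compatible c' d" if d: "d \<in> A" for d
  proof -
    note dm = atlas_subset_maximal[OF d]
    have W: "mopen A (fst c' \<inter> fst d)"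
      using mopen_Int[OF mo mopen_chart[OF dm]] .
    have opc: "open (snd c ` (fst c' \<inter> fst d))" and opd: "open (snd d ` (fst c' \<inter> fst d))"
      using open_image[OF c W] open_image[OF dm W] sub by auto
    have eq: "snd c' ` (fst c' \<inter> fst d) = V \<inter> h -` (snd c ` (fst c' \<inter> fst d))" (is "?l = ?r")
    proof
      show "?l \<subseteq> ?r"
        using img' h by auto
      show "?r \<subseteq> ?l"
      proof
        fix y assume "y \<in> ?r"
        then obtain q where q: "y \<in> V" "q \<in> fst c'" "q \<in> fst d" "h y = snd c q"
          by auto
        then have "y = snd c' q"
          using homeomorphism_apply2[OF hom q(1)] by (simp add: c')
        then show "y \<in> ?l"
          using q by blast
      qed
    qed
    have opc': "open (snd c' ` (fst c' \<inter> fst d))"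
      unfolding eq
      by (intro continuous_open_preimage V opc homeomorphism_cont2[OF hom])
    have "smooth_on (snd c' ` (fst c' \<inter> fst d)) (\<lambda>y. (snd d \<circ> chart_inv c) (h y))"
    proof (rule smooth_on_compose[where f = h and g = "snd d \<circ> chart_inv c", OF opc' opc])
      show "h ` snd c' ` (fst c' \<inter> fst d) \<subseteq> snd c ` (fst c' \<inter> fst d)"
        using eq by auto
      show "smooth_on (snd c' ` (fst c' \<inter> fst d)) h"
        by (rule smooth_on_subset[OF smooth(2)]) (use eq in auto)
      show "smooth_on (snd c ` (fst c' \<inter> fst d)) (snd d \<circ> chart_inv c)"
        by (rule smooth_on_subset[OF smooth_on_transition[OF c dm]]) (use sub in auto)
    qed
    then have 1: "smooth_on (snd c' ` (fst c' \<inter> fst d)) (snd d \<circ> chart_inv c')"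
    proof (rule smooth_on_cong[OF opc', rotated])
      fix y assume "y \<in> snd c' ` (fst c' \<inter> fst d)"
      then obtain q where q: "q \<in> fst c'" "y = snd c' q"
        by blast
      then show "(snd d \<circ> chart_inv c) (h y) = (snd d \<circ> chart_inv c') y"
        using h[OF q] inv[OF q(1)] chart_inv_chart[OF c] sub by auto
    qed
    have "smooth_on (snd d ` (fst c' \<inter> fst d)) (\<lambda>y. \<phi> ((snd c \<circ> chart_inv d) y))"
    proof (rule smooth_on_compose[where f = "snd c \<circ> chart_inv d", OF opd N(1) _ _ smooth(1)])
      show "(snd c \<circ> chart_inv d) ` snd d ` (fst c' \<inter> fst d) \<subseteq> N"
        using chart_inv_chart[OF dm] by (auto simp: c')
      show "smooth_on (snd d ` (fst c' \<inter> fst d)) (snd c \<circ> chart_inv d)"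
        by (rule smooth_on_subset[OF smooth_on_transition[OF dm c]]) (use sub in auto)
    qed
    then have 2: "smooth_on (snd d ` (fst c' \<inter> fst d)) (snd c' \<circ> chart_inv d)"
      by (simp add: c' o_def)
    show ?thesis
      unfolding compatible_def using opc' opd 1 2 by blast
  qed
  then show "c' \<in> maximal_atlas A"
    unfolding maximal_atlas_def is_chart_def
    using mo inj img' V by (auto simp: mopen_def)
qed

text \<open>In the old chart, the components \<open>X\<close> of a new coordinate field satisfy
  \<open>D\<phi>(X) = e_j\<close>. Differentiating along \<open>v\<close> gives
  \<open>D\<^sup>2\<phi>(v, X) + D\<phi>(DX v) = 0\<close>. By the equation for
  \<open>\<phi>\<close> the left side is \<open>D\<phi>\<close> of the covariant derivative of the
  field, which is therefore zero because \<open>D\<phi>\<close> is injective.\<close>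

theorem affine_coordinates_exist:
  assumes "p \<in> points A"
  obtains c where "affine_coordinates A nab c" "p \<in> fst c"
proof -
  obtain c where cA: "c \<in> A" and p: "p \<in> fst c"
    using assms by (auto simp: points_def)
  note c = atlas_subset_maximal[OF cA]
  have a: "snd c p \<in> snd c ` fst c"
    using p by simp
  obtain r \<phi> where r: "r > 0" "ball (snd c p) r \<subseteq> snd c ` fst c" and s\<phi>: "smooth_on (ball (snd c p) r) (\<phi> :: real^'n \<Rightarrow> real^'n)"
    and id: "\<And>v. frechet_derivative \<phi> (at (snd c p)) v = v"
    and hess: "\<And>x u v. x \<in> ball (snd c p) r \<Longrightarrow> frechet_derivative (\<lambda>y. frechet_derivative \<phi> (at y) v) (at x) u
      = frechet_derivative \<phi> (at x) (christoffel c x u v)"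
    using affine_functions[OF c a] by metis
  have a_in: "snd c p \<in> ball (snd c p) r"
    using r by simp
  obtain N V h where N: "open N" "N \<subseteq> ball (snd c p) r" "snd c p \<in> N" and V: "open V"
    and hom: "homeomorphism N V \<phi> h" and sh: "smooth_on V h"
    and inv1: "\<And>y v. y \<in> V \<Longrightarrow> frechet_derivative \<phi> (at (h y)) (frechet_derivative h (at y) v) = v"
    and inv2: "\<And>x v. x \<in> N \<Longrightarrow> frechet_derivative h (at (\<phi> x)) (frechet_derivative \<phi> (at x) v) = v"
    using local_diffeomorphism[OF open_ball a_in s\<phi> id] by metis
  define c' where "c' = ({q \<in> fst c. snd c q \<in> N}, \<phi> \<circ> snd c)"
  have Nc: "N \<subseteq> snd c ` fst c"
    using N r by blast
  note rep = maximal_atlas_reparametrize[OF c N(1) Nc V hom smooth_on_subset[OF s\<phi> N(2)] sh c'_def]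
  note c'm = rep(1)
  have sub: "fst c' \<subseteq> fst c"
    by (auto simp: c'_def)
  have mo: "mopen A (fst c')"
    by (rule mopen_chart[OF c'm])
  have img: "snd c ` fst c' = N"
    using Nc by (auto simp: c'_def)
  have \<phi>V: "\<phi> x \<in> V" "h (\<phi> x) = x" if "x \<in> N" for x
    using that hom by (auto simp: homeomorphism_def)
  have dir: "dir_deriv A c' u q = dir_deriv A c (frechet_derivative h (at (\<phi> (snd c q))) u) q" if q: "q \<in> fst c'" for u q
  proof -
    have qN: "snd c q \<in> N"
      using q by (auto simp: c'_def)
    have "frechet_derivative h (at (\<phi> (snd c q))) = frechet_derivative (snd c \<circ> chart_inv c') (at (\<phi> (snd c q)))"
      by (rule frechet_derivative_transform_within_open[OF smooth_on_differentiable[OF sh \<phi>V(1)[OF qN]] V \<phi>V(1)[OF qN]])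
        (simp add: rep(2)[symmetric])
    then show ?thesis
      using dir_deriv_change_chart[OF c'm c q, of u] q sub by (auto simp: c'_def)
  qed
  have "cov nab (coord_field A c' i) (coord_field A c' j) q = (\<lambda>f. 0)" if q: "q \<in> fst c'" for i j q
  proof -
    let ?x = "snd c q" and ?v = "dir_deriv A c' (axis i 1) q"
    define X where "X = field_rep c (dir_deriv A c' (axis j 1))"
    have x: "?x \<in> N" and qc: "q \<in> fst c"
      using q img sub by auto
    have v: "?v \<in> tangent_space A q"
      by (rule dir_deriv_in_tangent_space[OF c'm q])
    note sm = smooth_vfield_dir_deriv[OF c'm, of "axis j 1"]
    have sX: "smooth_on N X"
      using smooth_on_field_rep[OF c mo sub sm] by (simp add: img X_def)
    define w where "w = coords c (nab q ?v (dir_deriv A c' (axis j 1)))"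
    have w: "w = frechet_derivative X (at ?x) (coords c ?v) + christoffel c ?x (coords c ?v) (X ?x)"
      unfolding w_def X_def using coords_nab[OF c mo sub q sm v] c qc by simp
    have X_eq: "frechet_derivative \<phi> (at y) (X y) = axis j 1" if y: "y \<in> N" for y
    proof -
      obtain s where s: "s \<in> fst c'" "y = snd c s"
        using y img by blast
      have "s \<in> fst c"
        using s sub by auto
      then have "X y = frechet_derivative h (at (\<phi> y)) (axis j 1)"
        unfolding X_def using dir[OF s(1), of "axis j 1"] s c by simp
      then show ?thesis
        using inv1[OF \<phi>V(1)[OF y]] \<phi>V(2)[OF y] by simp
    qed
    have lin: "linear (frechet_derivative \<phi> (at y))" if "y \<in> N" for y
      using linear_frechet_derivative smooth_on_differentiable[OF s\<phi>] that N by blast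
    have "((\<lambda>y. frechet_derivative \<phi> (at y) (X y)) has_derivative
        (\<lambda>u. frechet_derivative (\<lambda>y. frechet_derivative \<phi> (at y) (X ?x)) (at ?x) u
          + frechet_derivative \<phi> (at ?x) (frechet_derivative X (at ?x) u))) (at ?x)"
      by (rule has_derivative_apply_linear[OF N(1) x lin smooth_on_has_derivative[OF
              smooth_on_subset[OF smooth_on_deriv[OF s\<phi>] N(2)] x] smooth_on_has_derivative[OF sX x]])
    then have "((\<lambda>y. axis j 1) has_derivative
        (\<lambda>u. frechet_derivative (\<lambda>y. frechet_derivative \<phi> (at y) (X ?x)) (at ?x) u
          + frechet_derivative \<phi> (at ?x) (frechet_derivative X (at ?x) u))) (at ?x)"
      by (rule has_derivative_transform_within_open[OF _ N(1) x]) (simp add: X_eq)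
    from has_derivative_unique[OF this has_derivative_const]
    have "frechet_derivative (\<lambda>y. frechet_derivative \<phi> (at y) (X ?x)) (at ?x) (coords c ?v)
          + frechet_derivative \<phi> (at ?x) (frechet_derivative X (at ?x) (coords c ?v)) = 0"
      by (simp add: fun_eq_iff)
    then have "frechet_derivative \<phi> (at ?x) w = 0"
      using hess[of ?x "X ?x" "coords c ?v"] x N(2) linear_add[OF lin[OF x]] by (auto simp: w add.commute)
    then have "w = frechet_derivative h (at (\<phi> ?x)) 0"
      using inv2[OF x, of w] by simp
    also have "\<dots> = 0"
      using linear_0[OF linear_frechet_derivative[OF smooth_on_differentiable[OF sh \<phi>V(1)[OF x]]]] .
    finally have "w = 0" .
    moreover have "nab q ?v (dir_deriv A c' (axis j 1)) \<in> tangent_space A q"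
      by (rule nab_tangent[OF mo sm q v])
    then have "nab q ?v (dir_deriv A c' (axis j 1)) = dir_deriv A c w q"
      unfolding w_def using tangent_space_chart[OF c qc] by blast
    ultimately show ?thesis
      using dir_deriv_zero[OF c qc] by (simp add: cov_def coord_field_def)
  qed
  then have "affine_coordinates A nab c'"
    using c'm by (simp add: affine_coordinates_def)
  moreover have "p \<in> fst c'"
    using p N by (simp add: c'_def)
  ultimately show thesis
    using that by blast
qed

end

section \<open>Charts of the tangent bundle\<close>

lemma coords_vec: "coords c u = (\<chi> i. u (\<lambda>q. snd c q $ i))"
proof -
  have "coords c u $ i = u (\<lambda>q. snd c q $ i)" for i
  proof -
    have "coords c u $ i = coords c u \<bullet> axis i 1"
      by (simp add: inner_axis)
    also have "\<dots> = u (\<lambda>q. snd c q \<bullet> axis i 1)"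
      unfolding coords_def by (rule inner_sum_left_Basis) (simp add: axis_in_Basis_iff)
    finally show ?thesis
      by (simp add: inner_axis)
  qed
  then show ?thesis
    by (simp add: vec_eq_iff)
qed

lemma linear_vec_zero:
  fixes f :: "real^'m \<Rightarrow> 'z::real_vector"
  assumes "linear f" "\<And>i. f (axis i 1) = 0"
  shows "f x = 0"
proof -
  have "f x = (\<Sum>b\<in>Basis. (x \<bullet> b) *\<^sub>R f b)"
    by (rule linear_expand_Basis[OF assms(1)])
  also have "\<dots> = 0"
    using assms(2) by (intro sum.neutral) (auto simp: Basis_vec_def)
  finally show ?thesis .
qed

lemma smooth_on_Pair:
  assumes "open S" "smooth_on S f" "smooth_on S g"
  shows "smooth_on S (\<lambda>x. (f x, g x))"
proof -
  have "smooth_on S (\<lambda>x. (f x, 0) + (0, g x))"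
    by (intro smooth_on_add[OF assms(1)]
        smooth_on_linear[OF bounded_linear_Pair[OF bounded_linear_ident bounded_linear_zero] assms(1,2)]
        smooth_on_linear[OF bounded_linear_Pair[OF bounded_linear_zero bounded_linear_ident] assms(1,3)])
  then show ?thesis
    by simp
qed

lemma fst_tm_chart: "fst (tm_chart A c) = {(p, u). p \<in> fst c \<and> u \<in> tangent_space A p}"
  by (simp add: tm_chart_def)

lemma snd_tm_chart: "snd (tm_chart A c) (p, u) = (snd c p, coords c u)"
  by (simp add: tm_chart_def coords_vec)

locale vec_atlas = atlas A for A :: "('a, real^'n) chart set"
begin

lemma tm_chart_inj:
  assumes "c \<in> maximal_atlas A"
  shows "inj_on (snd (tm_chart A c)) (fst (tm_chart A c))"
proof (rule inj_onI, clarsimp simp: fst_tm_chart snd_tm_chart)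
  fix p q u v
  assume *: "p \<in> fst c" "u \<in> tangent_space A p" "q \<in> fst c" "v \<in> tangent_space A q"
    "snd c p = snd c q" "coords c u = coords c v"
  then have "p = q"
    using chart_inj[OF assms] by (auto dest: inj_onD)
  then show "p = q \<and> u = v"
    using * tangent_space_chart[OF assms] by metis
qed

lemma tm_chart_image:
  assumes "c \<in> maximal_atlas A" "S \<subseteq> fst c"
  shows "snd (tm_chart A c) ` {(p, u). p \<in> S \<and> u \<in> tangent_space A p} = (snd c ` S) \<times> UNIV"
proof
  show "snd (tm_chart A c) ` {(p, u). p \<in> S \<and> u \<in> tangent_space A p} \<subseteq> (snd c ` S) \<times> UNIV"
    by (auto simp: snd_tm_chart)
  show "(snd c ` S) \<times> UNIV \<subseteq> snd (tm_chart A c) ` {(p, u). p \<in> S \<and> u \<in> tangent_space A p}"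
  proof clarify
    fix p y assume p: "p \<in> S"
    then have pc: "p \<in> fst c"
      using assms by auto
    have "(snd c p, y) = snd (tm_chart A c) (p, dir_deriv A c y p)"
      using coords_dir_deriv[OF assms(1) pc] by (simp add: snd_tm_chart)
    then show "(snd c p, y) \<in> snd (tm_chart A c) ` {(p, u). p \<in> S \<and> u \<in> tangent_space A p}"
      using p dir_deriv_in_tangent_space[OF assms(1) pc] by (auto simp: image_iff)
  qed
qed

lemma tm_chart_inv:
  assumes c: "c \<in> maximal_atlas A" and p: "p \<in> fst c"
  shows "chart_inv (tm_chart A c) (snd c p, y) = (p, dir_deriv A c y p)"
proof -
  have "(snd c p, y) = snd (tm_chart A c) (p, dir_deriv A c y p)"
    using coords_dir_deriv[OF c p] by (simp add: snd_tm_chart)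
  moreover have "(p, dir_deriv A c y p) \<in> fst (tm_chart A c)"
    using p dir_deriv_in_tangent_space[OF c p] by (simp add: fst_tm_chart)
  ultimately show ?thesis
    using inv_into_f_f[OF tm_chart_inj[OF c]] by metis
qed

lemma tm_chart_is_chart:
  assumes "c \<in> maximal_atlas A"
  shows "is_chart (tm_chart A c)"
  unfolding is_chart_def fst_tm_chart tm_chart_image[OF assms order_refl]
  using tm_chart_inj[OF assms] open_image[OF assms mopen_chart[OF assms] order_refl]
  by (auto simp: fst_tm_chart intro: open_Times)

text \<open>In induced coordinates the transition is \<open>(x, y) \<mapsto> (t x, Dt(x) y)\<close>:
  fibre components transform by the derivative, linearly in \<open>y\<close> and smoothly in
  \<open>x\<close>.\<close>

lemma smooth_on_tm_transition:
  assumes c: "c \<in> maximal_atlas A" and d: "d \<in> maximal_atlas A"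
  shows "open (snd (tm_chart A c) ` (fst (tm_chart A c) \<inter> fst (tm_chart A d)))"
    and "smooth_on (snd (tm_chart A c) ` (fst (tm_chart A c) \<inter> fst (tm_chart A d)))
      (snd (tm_chart A d) \<circ> chart_inv (tm_chart A c))"
proof -
  let ?S = "snd c ` (fst c \<inter> fst d)" and ?t = "snd d \<circ> chart_inv c"
  have Int: "fst (tm_chart A c) \<inter> fst (tm_chart A d) = {(p, u). p \<in> fst c \<inter> fst d \<and> u \<in> tangent_space A p}"
    by (auto simp: fst_tm_chart)
  have img: "snd (tm_chart A c) ` (fst (tm_chart A c) \<inter> fst (tm_chart A d)) = ?S \<times> UNIV"
    unfolding Int by (rule tm_chart_image[OF c]) auto
  have opS: "open ?S"
    using open_image[OF c mopen_Int[OF mopen_chart[OF c] mopen_chart[OF d]]] by auto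
  then have op: "open (?S \<times> (UNIV :: (real^'n) set))"
    by (intro open_Times) auto
  then show "open (snd (tm_chart A c) ` (fst (tm_chart A c) \<inter> fst (tm_chart A d)))"
    unfolding img .
  have t: "smooth_on ?S ?t"
    by (rule smooth_on_transition[OF c d])
  have sfst: "smooth_on (?S \<times> UNIV) (fst :: (real^'n) \<times> (real^'n) \<Rightarrow> _)"
    and ssnd: "smooth_on (?S \<times> UNIV) (snd :: (real^'n) \<times> (real^'n) \<Rightarrow> _)"
    by (rule smooth_on_linear[OF bounded_linear_fst op smooth_on_ident]
        smooth_on_linear[OF bounded_linear_snd op smooth_on_ident])+
  have via_fst: "smooth_on (?S \<times> (UNIV :: (real^'n) set)) (\<lambda>z. k (fst z))" if "smooth_on ?S k" for k :: "real^'n \<Rightarrow> real^'n"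
    by (rule smooth_on_compose[OF op opS _ sfst that]) auto
  have "smooth_on (?S \<times> UNIV) (\<lambda>z. (?t (fst z), frechet_derivative ?t (at (fst z)) (snd z)))"
  proof (rule smooth_on_Pair[OF op via_fst[OF t]])
    show "smooth_on (?S \<times> UNIV) (\<lambda>z. frechet_derivative ?t (at (fst z)) (snd z))"
    proof (rule smooth_on_apply_linear[where L = "\<lambda>z. frechet_derivative ?t (at (fst z))", OF op _ via_fst[OF smooth_on_deriv[OF t]] ssnd])
      show "linear (frechet_derivative ?t (at (fst z)))" if "z \<in> ?S \<times> UNIV" for z :: "(real^'n) \<times> (real^'n)"
        by (rule linear_frechet_derivative[OF smooth_on_differentiable[OF t]]) (use that in auto)
    qed
  qed
  then show "smooth_on (snd (tm_chart A c) ` (fst (tm_chart A c) \<inter> fst (tm_chart A d)))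
      (snd (tm_chart A d) \<circ> chart_inv (tm_chart A c))"
    unfolding img
  proof (rule smooth_on_cong[OF op, rotated])
    fix z assume "z \<in> ?S \<times> (UNIV :: (real^'n) set)"
    then obtain p y where z: "z = (snd c p, y)" and p: "p \<in> fst c" "p \<in> fst d"
      by auto
    show "(?t (fst z), frechet_derivative ?t (at (fst z)) (snd z)) = (snd (tm_chart A d) \<circ> chart_inv (tm_chart A c)) z"
      unfolding z o_apply tm_chart_inv[OF c p(1)] snd_tm_chart dir_deriv_change_chart[OF c d p]
        coords_dir_deriv[OF d p(2)]
      using chart_inv_chart[OF c p(1)] by (simp add: o_def)
  qed
qed

lemma tm_chart_compatible:
  assumes "c \<in> maximal_atlas A" "d \<in> maximal_atlas A"
  shows "compatible (tm_chart A c) (tm_chart A d)"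
  unfolding compatible_def
  using smooth_on_tm_transition[OF assms] smooth_on_tm_transition[OF assms(2,1)]
  by (simp add: Int_commute)

lemma smooth_atlas_tm: "smooth_atlas (tm_atlas A)"
  unfolding smooth_atlas_def tm_atlas_def
  using tm_chart_is_chart tm_chart_compatible atlas_subset_maximal by auto

lemma tm_chart_maximal:
  assumes c: "c \<in> maximal_atlas A"
  shows "tm_chart A c \<in> maximal_atlas (tm_atlas A)"
proof -
  have "fst (tm_chart A c) \<subseteq> points (tm_atlas A)"
  proof clarify
    fix p u assume "(p, u) \<in> fst (tm_chart A c)"
    then have p: "p \<in> fst c" and u: "u \<in> tangent_space A p"
      by (auto simp: fst_tm_chart)
    obtain d where "d \<in> A" "p \<in> fst d"
      using chart_covered[OF c p] .
    then show "(p, u) \<in> points (tm_atlas A)"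
      using u by (auto simp: points_def tm_atlas_def fst_tm_chart)
  qed
  then show ?thesis
    using tm_chart_is_chart[OF c] tm_chart_compatible[OF c] atlas_subset_maximal
    by (auto simp: maximal_atlas_def tm_atlas_def)
qed

end

text \<open>The tangent bundle is a manifold of the same kind, so all chart computations apply to it
  under the prefix \<open>TM\<close>.\<close>

sublocale vec_atlas \<subseteq> TM: atlas "tm_atlas A"
  by unfold_locales (rule smooth_atlas_tm)

sublocale affine_manifold \<subseteq> vec_atlas A ..

section \<open>Lifts and the canonical Hermitian structure in affine coordinates\<close>

context affine_manifold
begin

lemma affine_maximal: "affine_coordinates A nab c \<Longrightarrow> c \<in> maximal_atlas A"
  by (simp add: affine_coordinates_def)

lemma christoffel_affine:
  assumes aff: "affine_coordinates A nab c" and p: "p \<in> fst c"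
  shows "christoffel c (snd c p) u w = 0"
proof -
  note c = affine_maximal[OF aff]
  have x: "snd c p \<in> snd c ` fst c"
    using p by simp
  have "christoffel c (snd c p) (axis i 1) (axis j 1) = 0" for i j
  proof -
    have "nab p (dir_deriv A c (axis i 1) p) (dir_deriv A c (axis j 1)) = (\<lambda>f. 0)"
      using aff p by (simp add: affine_coordinates_def cov_def coord_field_def)
    then have "coords c (nab p (dir_deriv A c (axis i 1) p) (dir_deriv A c (axis j 1))) = 0"
      by (simp add: coords_def)
    then show ?thesis
      using coords_nab_dir_deriv[OF c p dir_deriv_in_tangent_space[OF c p], of "axis i 1" "axis j 1"]
        coords_dir_deriv[OF c p] by simp
  qed
  then have "christoffel c (snd c p) (axis i 1) w = 0" for i
    using linear_vec_zero[OF linear_christoffel_right] by blast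
  then show ?thesis
    using linear_vec_zero[OF linear_christoffel_left[OF c x]] by blast
qed

text \<open>In coordinates the section is \<open>y \<mapsto> (y, Yh y)\<close>. Where the
  Christoffel symbols vanish, being parallel along \<open>x\<close> means that the derivative of
  \<open>Yh\<close> along \<open>x\<close> is zero, so \<open>x\<close> is sent to
  \<open>(x, 0)\<close> whatever section is used. This gives uniqueness in the definite description
  \<open>hlift\<close>.\<close>

lemma horizontal_derivative:
  assumes aff: "affine_coordinates A nab c" and p: "p \<in> fst c" and x: "x \<in> tangent_space A p"
    and U: "mopen A U" "p \<in> U" and Y: "smooth_vfield A U Y" "Y p = u" "nab p x Y = (\<lambda>f. 0)"
  shows "(\<lambda>F. if smooth_near (tm_atlas A) (p, u) F then x (\<lambda>q. F (q, Y q)) else 0)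
    = dir_deriv (tm_atlas A) (tm_chart A c) (coords c x, 0) (p, u)"
proof
  fix F
  let ?C = "tm_chart A c" and ?TA = "tm_atlas A"
  note c = affine_maximal[OF aff]
  note C = tm_chart_maximal[OF c]
  show "(if smooth_near ?TA (p, u) F then x (\<lambda>q. F (q, Y q)) else 0) = dir_deriv ?TA ?C (coords c x, 0) (p, u) F"
  proof (cases "smooth_near ?TA (p, u) F")
    case True
    let ?W = "U \<inter> fst c" and ?xx = "snd c p" and ?F = "F \<circ> chart_inv ?C"
    have W: "mopen A ?W" "?W \<subseteq> fst c" "p \<in> ?W"
      using mopen_Int[OF U(1) mopen_chart[OF c]] U p by auto
    have YW: "smooth_vfield A ?W Y"
      by (rule smooth_vfield_mono[OF Y(1)]) auto
    define Yh where "Yh = field_rep c Y"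
    have sY: "smooth_on (snd c ` ?W) Yh"
      unfolding Yh_def by (rule smooth_on_field_rep[OF c W(1,2) YW])
    have opW: "open (snd c ` ?W)" and xW: "?xx \<in> snd c ` ?W"
      using open_image[OF c W(1,2)] W(3) by auto
    have "coords c (nab p x Y) = 0"
      by (simp add: Y(3) coords_def)
    then have dY: "frechet_derivative Yh (at ?xx) (coords c x) = 0"
      using coords_nab[OF c W YW x] christoffel_affine[OF aff p] by (simp add: Yh_def)
    have u: "u \<in> tangent_space A p"
      using Y U by (auto simp: smooth_vfield_def)
    have PC: "(p, u) \<in> fst ?C"
      using p u by (simp add: fst_tm_chart)
    obtain TW where TW: "mopen ?TA TW" "TW \<subseteq> fst ?C" "(p, u) \<in> TW" "smooth_on (snd ?C ` TW) ?F"
      using TM.smooth_nearE[OF C TM.mopen_chart[OF C] order_refl PC True] .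
    have opT: "open (snd ?C ` TW)"
      by (rule TM.open_image[OF C TW(1,2)])
    define \<gamma> where "\<gamma> = (\<lambda>y. (y, Yh y))"
    have s\<gamma>: "smooth_on (snd c ` ?W) \<gamma>"
      unfolding \<gamma>_def by (rule smooth_on_Pair[OF opW smooth_on_ident sY])
    have \<gamma>x: "\<gamma> ?xx = snd ?C (p, u)"
      using Y(2) chart_inv_chart[OF c p] by (simp add: \<gamma>_def Yh_def snd_tm_chart)
    have \<gamma>T: "\<gamma> ?xx \<in> snd ?C ` TW"
      unfolding \<gamma>x using TW(3) by blast
    \<comment> \<open>\<open>F\<close> is known to be smooth only near \<open>(p, u)\<close>;
      \<open>?O\<close> keeps the base points over which the section still runs inside that
      neighbourhood.\<close>
    let ?O = "snd c ` ?W \<inter> \<gamma> -` (snd ?C ` TW)"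
    let ?W' = "{q \<in> fst c. snd c q \<in> ?O}"
    have opO: "open ?O"
      by (rule continuous_open_preimage[OF smooth_on_continuous_on[OF s\<gamma>] opW opT])
    have W': "mopen A ?W'" "?W' \<subseteq> fst c" "p \<in> ?W'"
      using mopen_preimage[OF c opO] p xW \<gamma>T by auto
    have img: "snd c ` ?W' \<subseteq> ?O"
      by auto
    have FY: "F (q, Y q) = ?F (\<gamma> (snd c q))" if q: "q \<in> ?W'" for q
    proof -
      have qc: "q \<in> fst c"
        using q by simp
      have "q \<in> ?W"
        using q chart_image_mem_iff[OF c qc W(2)] by blast
      then have "Y q = dir_deriv A c (Yh (snd c q)) q"
        unfolding Yh_def using vfield_eq[OF c YW _ qc] by blast
      then show ?thesis
        by (simp add: \<gamma>_def tm_chart_inv[OF c qc])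
    qed
    have op': "open (snd c ` ?W')"
      by (rule open_image[OF c W'(1,2)])
    have "dir_deriv A c (coords c x) p (\<lambda>q. F (q, Y q)) =
       frechet_derivative ?F (at (\<gamma> ?xx)) (coords c x, frechet_derivative Yh (at ?xx) (coords c x))"
    proof (rule dir_deriv_eqI(2)[OF c W', where K = "\<lambda>y. ?F (\<gamma> y)", OF FY])
      show "smooth_on (snd c ` ?W') (\<lambda>y. ?F (\<gamma> y))"
        by (rule smooth_on_compose[where f = \<gamma> and g = ?F, OF op' opT _ smooth_on_subset[OF s\<gamma>] TW(4)]) (use img in auto)
      have "(\<gamma> has_derivative (\<lambda>h. (h, frechet_derivative Yh (at ?xx) h))) (at ?xx)"
        unfolding \<gamma>_def by (intro has_derivative_Pair has_derivative_ident smooth_on_has_derivative[OF sY xW])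
      from has_derivative_compose[OF this smooth_on_has_derivative[OF TW(4) \<gamma>T]]
      show "((\<lambda>y. ?F (\<gamma> y)) has_derivative
        (\<lambda>h. frechet_derivative ?F (at (\<gamma> ?xx)) (h, frechet_derivative Yh (at ?xx) h))) (at ?xx)" .
    qed
    moreover have "x = dir_deriv A c (coords c x) p"
      using x tangent_space_chart[OF c p] by blast
    ultimately have "x (\<lambda>q. F (q, Y q)) = frechet_derivative ?F (at (snd ?C (p, u))) (coords c x, 0)"
      using dY \<gamma>x by metis
    then show ?thesis
      using True by (simp add: dir_deriv_def)
  qed (simp add: dir_deriv_def)
qed

text \<open>The field with constant components \<open>coords c u\<close> is a parallel section,
  because the Christoffel symbols vanish; this settles existence.\<close>

lemma hlift_eq:
  assumes aff: "affine_coordinates A nab c" and p: "p \<in> fst c" and u: "u \<in> tangent_space A p" and x: "x \<in> tangent_space A p"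
  shows "hlift A nab (p, u) x = dir_deriv (tm_atlas A) (tm_chart A c) (coords c x, 0) (p, u)"
proof -
  note c = affine_maximal[OF aff]
  let ?Y = "dir_deriv A c (coords c u)"
  have Yp: "?Y p = u"
    using u tangent_space_chart[OF c p] by metis
  note sY = smooth_vfield_dir_deriv[OF c, of "coords c u"]
  have "coords c (nab p x ?Y) = 0"
    using coords_nab_dir_deriv[OF c p x] christoffel_affine[OF aff p] by simp
  moreover have "nab p x ?Y \<in> tangent_space A p"
    by (rule nab_tangent[OF mopen_chart[OF c] sY p x])
  ultimately have nY: "nab p x ?Y = (\<lambda>f. 0)"
    using tangent_space_chart[OF c p] dir_deriv_zero[OF c p] by metis
  show ?thesis
    unfolding hlift_def prod.case
  proof (rule the_equality)
    show "\<exists>U Y. mopen A U \<and> p \<in> U \<and> smooth_vfield A U Y \<and> Y p = u \<and> nab p x Y = (\<lambda>f. 0) \<and>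
      dir_deriv (tm_atlas A) (tm_chart A c) (coords c x, 0) (p, u)
      = (\<lambda>F. if smooth_near (tm_atlas A) (p, u) F then x (\<lambda>q. F (q, Y q)) else 0)"
      using mopen_chart[OF c] p sY Yp nY horizontal_derivative[OF aff p x mopen_chart[OF c] p sY Yp nY]
      by (intro exI[of _ "fst c"] exI[of _ ?Y]) auto
  next
    fix \<xi>
    assume "\<exists>U Y. mopen A U \<and> p \<in> U \<and> smooth_vfield A U Y \<and> Y p = u \<and> nab p x Y = (\<lambda>f. 0) \<and>
      \<xi> = (\<lambda>F. if smooth_near (tm_atlas A) (p, u) F then x (\<lambda>q. F (q, Y q)) else 0)"
    then obtain U Y where "mopen A U" "p \<in> U" "smooth_vfield A U Y" "Y p = u" "nab p x Y = (\<lambda>f. 0)"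
      and \<xi>: "\<xi> = (\<lambda>F. if smooth_near (tm_atlas A) (p, u) F then x (\<lambda>q. F (q, Y q)) else 0)"
      by (elim exE conjE)
    from horizontal_derivative[OF aff p x this(1-5)]
    show "\<xi> = dir_deriv (tm_atlas A) (tm_chart A c) (coords c x, 0) (p, u)"
      unfolding \<xi> .
  qed
qed

text \<open>The curve \<open>u + t x\<close> in the fibre is a straight line in the induced
  coordinates.\<close>

lemma vlift_eq:
  assumes c: "c \<in> maximal_atlas A" and p: "p \<in> fst c" and u: "u \<in> tangent_space A p" and x: "x \<in> tangent_space A p"
  shows "vlift A (p, u) x = dir_deriv (tm_atlas A) (tm_chart A c) (0, coords c x) (p, u)"
proof
  fix F :: "'a \<times> 'a tvec \<Rightarrow> real"
  let ?C = "tm_chart A c" and ?TA = "tm_atlas A"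
  let ?F = "F \<circ> chart_inv ?C"
  note C = tm_chart_maximal[OF c]
  show "vlift A (p, u) x F = dir_deriv ?TA ?C (0, coords c x) (p, u) F"
  proof (cases "smooth_near ?TA (p, u) F")
    case True
    have PC: "(p, u) \<in> fst ?C"
      using p u by (simp add: fst_tm_chart)
    have "F (p, \<lambda>f. u f + t * x f) = ?F (snd ?C (p, u) + t *\<^sub>R (0, coords c x))" for t
    proof -
      let ?w = "\<lambda>f. u f + t * x f"
      have w: "?w \<in> tangent_space A p" "coords c ?w = coords c u + t *\<^sub>R coords c x"
        using tangent_space_lin[OF c p u x, of 1 t] coords_lin[of c 1 u t x] by auto
      have "chart_inv ?C (snd c p, coords c ?w) = (p, ?w)"
        unfolding tm_chart_inv[OF c p] using w(1) tangent_space_chart[OF c p] by metis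
      then show ?thesis
        by (simp add: snd_tm_chart w(2))
    qed
    then have eq: "(\<lambda>t. F (p, \<lambda>f. u f + t * x f)) = (\<lambda>t. ?F (snd ?C (p, u) + t *\<^sub>R (0, coords c x)))"
      by blast
    have "((\<lambda>t. ?F (snd ?C (p, u) + t *\<^sub>R (0, coords c x))) has_real_derivative
       frechet_derivative ?F (at (snd ?C (p, u) + 0 *\<^sub>R (0, coords c x))) (0, coords c x)) (at 0)"
      by (rule has_real_derivative_along_line)
        (simp only: scaleR_zero_left add_0_right TM.smooth_near_differentiable[OF C PC True])
    from DERIV_imp_deriv[OF this, unfolded scaleR_zero_left add_0_right] show ?thesis
      using True by (simp add: vlift_def dir_deriv_def eq)
  qed (simp add: vlift_def dir_deriv_def)
qed

lemma lift_sum_eq: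
  assumes aff: "affine_coordinates A nab c" and p: "p \<in> fst c" and u: "u \<in> tangent_space A p"
    and x: "x \<in> tangent_space A p" and y: "y \<in> tangent_space A p"
  shows "(\<lambda>F. s * hlift A nab (p, u) x F + t * vlift A (p, u) y F)
    = dir_deriv (tm_atlas A) (tm_chart A c) (s *\<^sub>R coords c x, t *\<^sub>R coords c y) (p, u)"
proof -
  note c = affine_maximal[OF aff]
  have PC: "(p, u) \<in> fst (tm_chart A c)"
    using p u by (simp add: fst_tm_chart)
  show ?thesis
    unfolding hlift_eq[OF aff p u x] vlift_eq[OF c p u y]
    using TM.dir_deriv_lin[OF tm_chart_maximal[OF c] PC, of s "(coords c x, 0)" t "(0, coords c y)"] by simp
qed

lemma lift_split_eq:
  assumes aff: "affine_coordinates A nab c" and p: "p \<in> fst c" and u: "u \<in> tangent_space A p"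
  shows "lift_split A nab (p, u) (dir_deriv (tm_atlas A) (tm_chart A c) w (p, u))
    = (dir_deriv A c (fst w) p, dir_deriv A c (snd w) p)"
proof -
  note c = affine_maximal[OF aff]
  have PC: "(p, u) \<in> fst (tm_chart A c)"
    using p u by (simp add: fst_tm_chart)
  note tan = dir_deriv_in_tangent_space[OF c p]
  have sum: "(\<lambda>F. hlift A nab (p, u) x F + vlift A (p, u) y F)
      = dir_deriv (tm_atlas A) (tm_chart A c) (coords c x, coords c y) (p, u)"
    if "x \<in> tangent_space A p" "y \<in> tangent_space A p" for x y
    using lift_sum_eq[OF aff p u that, of 1 1] by simp
  show ?thesis
    unfolding lift_split_def fst_conv
  proof (rule the_equality)
    show "fst (dir_deriv A c (fst w) p, dir_deriv A c (snd w) p) \<in> tangent_space A p \<and>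
      snd (dir_deriv A c (fst w) p, dir_deriv A c (snd w) p) \<in> tangent_space A p \<and>
      dir_deriv (tm_atlas A) (tm_chart A c) w (p, u) =
      (\<lambda>F. hlift A nab (p, u) (fst (dir_deriv A c (fst w) p, dir_deriv A c (snd w) p)) F
        + vlift A (p, u) (snd (dir_deriv A c (fst w) p, dir_deriv A c (snd w) p)) F)"
      using tan sum[OF tan tan] coords_dir_deriv[OF c p] by simp
  next
    fix z
    assume z: "fst z \<in> tangent_space A p \<and> snd z \<in> tangent_space A p \<and>
      dir_deriv (tm_atlas A) (tm_chart A c) w (p, u) = (\<lambda>F. hlift A nab (p, u) (fst z) F + vlift A (p, u) (snd z) F)"
    then have "dir_deriv (tm_atlas A) (tm_chart A c) w (p, u)
        = dir_deriv (tm_atlas A) (tm_chart A c) (coords c (fst z), coords c (snd z)) (p, u)"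
      using sum[of "fst z" "snd z"] by simp
    from arg_cong[OF this, of "coords (tm_chart A c)"]
    have "w = (coords c (fst z), coords c (snd z))"
      unfolding TM.coords_dir_deriv[OF tm_chart_maximal[OF c] PC] .
    then show "z = (dir_deriv A c (fst w) p, dir_deriv A c (snd w) p)"
      using z tangent_space_chart[OF c p] by (metis fst_conv snd_conv prod.collapse)
  qed
qed

lemma J1_eq:
  assumes aff: "affine_coordinates A nab c" and p: "p \<in> fst c" and u: "u \<in> tangent_space A p"
  shows "J1 A nab (p, u) (dir_deriv (tm_atlas A) (tm_chart A c) w (p, u))
    = dir_deriv (tm_atlas A) (tm_chart A c) (- snd w, fst w) (p, u)"
proof -
  note c = affine_maximal[OF aff]
  note tan = dir_deriv_in_tangent_space[OF c p]
  show ?thesis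
    unfolding J1_def lift_split_eq[OF aff p u] prod.case
    using lift_sum_eq[OF aff p u tan tan, of "-1" "snd w" 1 "fst w"] coords_dir_deriv[OF c p]
    by (simp add: fun_eq_iff)
qed

lemma g1_eq:
  assumes aff: "affine_coordinates A nab c" and p: "p \<in> fst c" and u: "u \<in> tangent_space A p"
  shows "g1 A nab g (p, u) (dir_deriv (tm_atlas A) (tm_chart A c) w (p, u)) (dir_deriv (tm_atlas A) (tm_chart A c) z (p, u))
    = g p (dir_deriv A c (fst w) p) (dir_deriv A c (fst z) p) + g p (dir_deriv A c (snd w) p) (dir_deriv A c (snd z) p)"
  unfolding g1_def lift_split_eq[OF aff p u] by simp

end

section \<open>The pluriclosed condition\<close>

text \<open>Uniqueness of derivatives hands linearity in the parameter \<open>a\<close> on to the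
  derivative with respect to the point.\<close>

lemma linear_frechet_derivative_param:
  fixes f :: "'a::euclidean_space \<Rightarrow> 'b::real_vector \<Rightarrow> 'c::real_normed_vector"
  assumes S: "open S" "x \<in> S" and lin: "\<And>y. y \<in> S \<Longrightarrow> linear (f y)" and smooth: "\<And>a. smooth_on S (\<lambda>y. f y a)"
  shows "linear (\<lambda>a. frechet_derivative (\<lambda>y. f y a) (at x) h)"
proof (rule linearI)
  note d = smooth_on_has_derivative[OF smooth S(2)]
  fix a b
  have "((\<lambda>y. f y a + f y b) has_derivative
      (\<lambda>h. frechet_derivative (\<lambda>y. f y a) (at x) h + frechet_derivative (\<lambda>y. f y b) (at x) h)) (at x)"
    by (intro has_derivative_add d)
  then have "((\<lambda>y. f y (a + b)) has_derivative
      (\<lambda>h. frechet_derivative (\<lambda>y. f y a) (at x) h + frechet_derivative (\<lambda>y. f y b) (at x) h)) (at x)"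
    by (rule has_derivative_transform_within_open[OF _ S]) (simp add: linear_add[OF lin])
  then show "frechet_derivative (\<lambda>y. f y (a + b)) (at x) h =
      frechet_derivative (\<lambda>y. f y a) (at x) h + frechet_derivative (\<lambda>y. f y b) (at x) h"
    by (simp add: frechet_derivative_works_at)
next
  fix r a
  have "((\<lambda>y. r *\<^sub>R f y a) has_derivative (\<lambda>h. r *\<^sub>R frechet_derivative (\<lambda>y. f y a) (at x) h)) (at x)"
    by (intro has_derivative_scaleR_right smooth_on_has_derivative[OF smooth S(2)])
  then have "((\<lambda>y. f y (r *\<^sub>R a)) has_derivative (\<lambda>h. r *\<^sub>R frechet_derivative (\<lambda>y. f y a) (at x) h)) (at x)"
    by (rule has_derivative_transform_within_open[OF _ S]) (simp add: linear_scale[OF lin])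
  then show "frechet_derivative (\<lambda>y. f y (r *\<^sub>R a)) (at x) h = r *\<^sub>R frechet_derivative (\<lambda>y. f y a) (at x) h"
    by (simp add: frechet_derivative_works_at)
qed

text \<open>Below, \<open>m h a b\<close> stands for the derivative \<open>\<partial>\<^sub>h \<mu>(a, b)\<close> of the metric and \<open>M k h a b\<close> for
  \<open>\<partial>\<^sub>k \<partial>\<^sub>h \<mu>(a, b)\<close>, so that \<open>Jd_omega_coeff (M k)\<close> is the derivative along \<open>k\<close> of the coefficients of
  \<open>J d\<omega>\<close>.\<close>

definition d_omega_coeff :: "('v \<Rightarrow> 'v \<Rightarrow> 'v \<Rightarrow> real) \<Rightarrow> 'v \<times> 'v \<Rightarrow> 'v \<times> 'v \<Rightarrow> 'v \<times> 'v \<Rightarrow> real" where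
  "d_omega_coeff m U V W =
     (m (fst U) (fst V) (snd W) - m (fst U) (snd V) (fst W))
     - (m (fst V) (fst U) (snd W) - m (fst V) (snd U) (fst W))
     + (m (fst W) (fst U) (snd V) - m (fst W) (snd U) (fst V))"

definition J_coeff :: "'v \<times> 'v \<Rightarrow> 'v \<times> 'v::uminus" where
  "J_coeff U = (- snd U, fst U)"

definition Jd_omega_coeff :: "('v \<Rightarrow> 'v \<Rightarrow> 'v \<Rightarrow> real) \<Rightarrow> 'v \<times> 'v \<Rightarrow> 'v \<times> 'v \<Rightarrow> 'v \<times> 'v::uminus \<Rightarrow> real" where
  "Jd_omega_coeff m U V W = - d_omega_coeff m (J_coeff U) (J_coeff V) (J_coeff W)"

text \<open>When \<open>M\<close> is the second derivative of a metric, this is, up to sign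
  convention, twice the part of its Riemann curvature that is linear in second derivatives. It is
  antisymmetric in \<open>a, a'\<close> and in \<open>b, b'\<close>.\<close>

definition pluri_defect :: "('v \<Rightarrow> 'v \<Rightarrow> 'v \<Rightarrow> 'v \<Rightarrow> real) \<Rightarrow> 'v \<Rightarrow> 'v \<Rightarrow> 'v \<Rightarrow> 'v \<Rightarrow> real" where
  "pluri_defect M a a' b b' = M a b' a' b + M a' b a b' - M a b a' b' - M a' b' a b"

text \<open>Both sides have 24 terms. The outer derivative takes a base component and
  \<open>J\<close> has exchanged the slots inside, so every term contains base components of two of
  the vectors and fibre components of the other two. The six choices of the base pair give the six
  defects, with shuffle signs.\<close>

lemma ddc_omega_eq_pluri_defect:
  fixes M :: "'v::real_vector \<Rightarrow> 'v \<Rightarrow> 'v \<Rightarrow> 'v \<Rightarrow> real"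
  assumes sym: "\<And>k h a b. M k h a b = M h k a b" "\<And>k h a b. M k h a b = M k h b a"
    and neg: "\<And>k h a b. M k (- h) a b = - M k h a b" "\<And>k h a b. M k h (- a) b = - M k h a b"
      "\<And>k h a b. M k h a (- b) = - M k h a b"
  shows "Jd_omega_coeff (M (fst X)) Y Z V - Jd_omega_coeff (M (fst Y)) X Z V
      + Jd_omega_coeff (M (fst Z)) X Y V - Jd_omega_coeff (M (fst V)) X Y Z
    = pluri_defect M (fst X) (fst Y) (snd Z) (snd V) - pluri_defect M (fst X) (fst Z) (snd Y) (snd V)
      + pluri_defect M (fst X) (fst V) (snd Y) (snd Z) + pluri_defect M (fst Y) (fst Z) (snd X) (snd V)
      - pluri_defect M (fst Y) (fst V) (snd X) (snd Z) + pluri_defect M (fst Z) (fst V) (snd X) (snd Y)"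
proof -
  obtain a0 b0 a1 b1 a2 b2 a3 b3 where [simp]: "X = (a0, b0)" "Y = (a1, b1)" "Z = (a2, b2)" "V = (a3, b3)"
    by (metis prod.exhaust)
  show ?thesis
    unfolding Jd_omega_coeff_def d_omega_coeff_def J_coeff_def pluri_defect_def
    by (simp add: neg) (simp add: sym)
qed

lemma d_omega_coeff_alternating:
  assumes "\<And>h a b. m h a b = m h b a"
  shows "d_omega_coeff m U V W = - d_omega_coeff m V U W" "d_omega_coeff m U V W = - d_omega_coeff m U W V"
  using assms by (simp_all add: d_omega_coeff_def)

lemma d_omega_coeff_linear:
  fixes m :: "'v::real_vector \<Rightarrow> 'v \<Rightarrow> 'v \<Rightarrow> real"
  assumes "\<And>a b. linear (\<lambda>h. m h a b)" "\<And>h b. linear (\<lambda>a. m h a b)" "\<And>h a. linear (\<lambda>b. m h a b)"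
  shows "linear (\<lambda>U. d_omega_coeff m U V W)"
  by (rule linearI)
    (simp_all add: d_omega_coeff_def linear_add[OF assms(1)] linear_add[OF assms(2)] linear_scale[OF assms(1)]
      linear_scale[OF assms(2)] algebra_simps)

lemma linear_J_coeff: "linear (J_coeff :: 'v::real_vector \<times> 'v \<Rightarrow> _)"
  by (rule linearI) (simp_all add: J_coeff_def)

locale affine_riemann_manifold = affine_manifold A nab for A :: "('a, real^'n) chart set" and nab +
  fixes g :: "'a metric_tensor"
  assumes metric: "riemannian_metric A g"
begin

text \<open>The metric as a form on components, living on the chart image rather than on the
  manifold so that it can be differentiated in the ordinary sense.\<close>

definition met :: "('a, real^'n) chart \<Rightarrow> real^'n \<Rightarrow> real^'n \<Rightarrow> real^'n \<Rightarrow> real" where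
  "met c x a b = g (chart_inv c x) (dir_deriv A c a (chart_inv c x)) (dir_deriv A c b (chart_inv c x))"

definition met1 :: "('a, real^'n) chart \<Rightarrow> real^'n \<Rightarrow> real^'n \<Rightarrow> real^'n \<Rightarrow> real^'n \<Rightarrow> real" where
  "met1 c x h a b = frechet_derivative (\<lambda>y. met c y a b) (at x) h"

definition met2 :: "('a, real^'n) chart \<Rightarrow> real^'n \<Rightarrow> real^'n \<Rightarrow> real^'n \<Rightarrow> real^'n \<Rightarrow> real^'n \<Rightarrow> real" where
  "met2 c x k h a b = frechet_derivative (\<lambda>y. met1 c y h a b) (at x) k"

context
  fixes c assumes c: "c \<in> maximal_atlas A"
begin

lemma open_chart_image: "open (snd c ` fst c)"
  by (rule open_image[OF c mopen_chart[OF c] order_refl])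

lemma chart_inv_point: "x \<in> snd c ` fst c \<Longrightarrow> chart_inv c x \<in> fst c" "x \<in> snd c ` fst c \<Longrightarrow> chart_inv c x \<in> points A"
  using c by (auto simp: maximal_atlas_def subset_iff)

lemma met_sym: "x \<in> snd c ` fst c \<Longrightarrow> met c x a b = met c x b a"
  unfolding met_def
  using metric chart_inv_point dir_deriv_in_tangent_space[OF c] unfolding riemannian_metric_def by blast

lemma met_linear_left:
  assumes x: "x \<in> snd c ` fst c"
  shows "linear (\<lambda>a. met c x a b)"
proof -
  note p = chart_inv_point[OF x]
  have "g (chart_inv c x) (\<lambda>f. s * v f + t * w f) z = s * g (chart_inv c x) v z + t * g (chart_inv c x) w z"
    if "v \<in> tangent_space A (chart_inv c x)" "w \<in> tangent_space A (chart_inv c x)" "z \<in> tangent_space A (chart_inv c x)"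
    for s t v w z
    using metric p that unfolding riemannian_metric_def by blast
  then have lin: "met c x (s *\<^sub>R u + t *\<^sub>R v) b = s * met c x u b + t * met c x v b" for s t u v
    unfolding met_def dir_deriv_lin[OF c p(1)] using dir_deriv_in_tangent_space[OF c p(1)] by blast
  show ?thesis
    using lin[of 1 _ 1] lin[of _ _ 0 0] by (intro linearI) simp_all
qed

lemma met_linear_right: "x \<in> snd c ` fst c \<Longrightarrow> linear (\<lambda>b. met c x a b)"
  using met_linear_left by (subst met_sym)

lemma smooth_on_met: "smooth_on (snd c ` fst c) (\<lambda>x. met c x a b)"
proof -
  have "smooth_fun A (fst c) (\<lambda>p. g p (dir_deriv A c a p) (dir_deriv A c b p))"
    using metric mopen_chart[OF c] smooth_vfield_dir_deriv[OF c] unfolding riemannian_metric_def by blast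
  from smooth_fun_chart[OF c mopen_chart[OF c] order_refl this] show ?thesis
    by (simp add: met_def o_def)
qed

lemma smooth_on_met1: "smooth_on (snd c ` fst c) (\<lambda>x. met1 c x h a b)"
  unfolding met1_def by (rule smooth_on_deriv[OF smooth_on_met])

lemma has_derivative_met: "x \<in> snd c ` fst c \<Longrightarrow> ((\<lambda>x. met c x a b) has_derivative (\<lambda>h. met1 c x h a b)) (at x)"
  unfolding met1_def by (rule smooth_on_has_derivative[OF smooth_on_met])

lemma has_derivative_met1: "x \<in> snd c ` fst c \<Longrightarrow> ((\<lambda>x. met1 c x h a b) has_derivative (\<lambda>k. met2 c x k h a b)) (at x)"
  unfolding met2_def by (rule smooth_on_has_derivative[OF smooth_on_met1])

lemma met1_linear:
  assumes x: "x \<in> snd c ` fst c"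
  shows "linear (\<lambda>h. met1 c x h a b)" "linear (\<lambda>a. met1 c x h a b)" "linear (\<lambda>b. met1 c x h a b)"
  using has_derivative_linear[OF has_derivative_met[OF x]]
    linear_frechet_derivative_param[where f = "\<lambda>y a. met c y a b", OF open_chart_image x met_linear_left smooth_on_met, of h]
    linear_frechet_derivative_param[where f = "\<lambda>y b. met c y a b", OF open_chart_image x met_linear_right smooth_on_met, of h]
  by (simp_all add: met1_def)

lemma met1_sym:
  assumes x: "x \<in> snd c ` fst c"
  shows "met1 c x h a b = met1 c x h b a"
  unfolding met1_def
  using frechet_derivative_transform_within_open[OF smooth_on_differentiable[OF smooth_on_met x] open_chart_image x met_sym]
  by simp

lemma met2_linear:
  assumes x: "x \<in> snd c ` fst c"
  shows "linear (\<lambda>k. met2 c x k h a b)" "linear (\<lambda>h. met2 c x k h a b)"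
    "linear (\<lambda>a. met2 c x k h a b)" "linear (\<lambda>b. met2 c x k h a b)"
  using has_derivative_linear[OF has_derivative_met1[OF x]]
    linear_frechet_derivative_param[where f = "\<lambda>y h. met1 c y h a b", OF open_chart_image x met1_linear(1) smooth_on_met1, of k]
    linear_frechet_derivative_param[where f = "\<lambda>y a. met1 c y h a b", OF open_chart_image x met1_linear(2) smooth_on_met1, of k]
    linear_frechet_derivative_param[where f = "\<lambda>y b. met1 c y h a b", OF open_chart_image x met1_linear(3) smooth_on_met1, of k]
  by (simp_all add: met2_def)

lemma met2_sym:
  assumes x: "x \<in> snd c ` fst c"
  shows "met2 c x k h a b = met2 c x h k a b" "met2 c x k h a b = met2 c x k h b a"
proof -
  show "met2 c x k h a b = met2 c x h k a b"
    unfolding met2_def met1_def by (rule second_derivative_symmetric[OF open_chart_image x smooth_on_met])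
  show "met2 c x k h a b = met2 c x k h b a"
    unfolding met2_def
    using frechet_derivative_transform_within_open[OF smooth_on_differentiable[OF smooth_on_met1 x] open_chart_image x met1_sym]
    by simp
qed

lemma met2_neg:
  assumes x: "x \<in> snd c ` fst c"
  shows "met2 c x k (- h) a b = - met2 c x k h a b" "met2 c x k h (- a) b = - met2 c x k h a b"
    "met2 c x k h a (- b) = - met2 c x k h a b"
  using linear_neg[OF met2_linear(2)[OF x]] linear_neg[OF met2_linear(3)[OF x]] linear_neg[OF met2_linear(4)[OF x]]
  by auto

text \<open>Passage from the iterated coordinate fields of the theorem to ordinary second
  derivatives; the outer field becomes the first direction of \<open>met2\<close>.\<close>

lemma partial2_metric_coeff:
  assumes p: "p \<in> fst c"
  shows "partial2 A c i j (metric_coeff A g c k l) p = met2 c (snd c p) (axis i 1) (axis j 1) (axis k 1) (axis l 1)"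
proof -
  have coeff: "metric_coeff A g c k l q = met c (snd c q) (axis k 1) (axis l 1)" if "q \<in> fst c" for q
    using chart_inv_chart[OF c that] by (simp add: metric_coeff_def met_def coord_field_def)
  have "coord_field A c j q (metric_coeff A g c k l) = met1 c (snd c q) (axis j 1) (axis k 1) (axis l 1)" if q: "q \<in> fst c" for q
    unfolding coord_field_def
    by (rule dir_deriv_eqI(2)[OF c mopen_chart[OF c] order_refl q coeff smooth_on_met has_derivative_met]) (use q in auto)
  then show ?thesis
    unfolding partial2_def coord_field_def[of A c i]
    by (intro dir_deriv_eqI(2)[OF c mopen_chart[OF c] order_refl p _ smooth_on_met1 has_derivative_met1])
      (use p in auto)
qed

end

context
  fixes c U
  assumes aff: "affine_coordinates A nab c"
    and U: "mopen (tm_atlas A) U" "U \<subseteq> fst (tm_chart A c)"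
begin

private abbreviation "TA \<equiv> tm_atlas A"
private abbreviation "C \<equiv> tm_chart A c"

private lemma c: "c \<in> maximal_atlas A"
  by (rule affine_maximal[OF aff])

private lemma C: "C \<in> maximal_atlas TA"
  by (rule tm_chart_maximal[OF c])

private lemma base: "q \<in> U \<Longrightarrow> fst (snd C q) \<in> snd c ` fst c"
  using U(2) by (cases q) (auto simp: fst_tm_chart snd_tm_chart)

private lemma base_image: "z \<in> snd C ` U \<Longrightarrow> fst z \<in> snd c ` fst c"
  using base by blast

private lemma open_U: "open (snd C ` U)"
  by (rule TM.open_image[OF C U])

text \<open>All coefficients that occur depend on the base coordinates only, so smoothness and
  derivatives on the bundle are pulled back along \<open>fst\<close>.\<close>

private lemma smooth_via_base:
  assumes "smooth_on (snd c ` fst c) k"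
  shows "smooth_on (snd C ` U) (\<lambda>z. k (fst z))"
  by (rule smooth_on_compose[OF open_U open_chart_image[OF c] _
        smooth_on_linear[OF bounded_linear_fst open_U smooth_on_ident] assms])
    (use base_image in blast)

private lemma derivative_via_base:
  assumes "(k has_derivative k') (at (fst z))"
  shows "((\<lambda>z. k (fst z)) has_derivative (\<lambda>H. k' (fst H))) (at z)"
  using has_derivative_compose[OF has_derivative_fst[OF has_derivative_ident] assms] .

private lemma J1_rep:
  assumes "q \<in> U" "v \<in> tangent_space TA q"
  shows "J1 A nab q v = dir_deriv TA C (J_coeff (coords C v)) q"
proof -
  have q: "q \<in> fst C"
    using assms U by blast
  obtain p u where pu: "q = (p, u)" "p \<in> fst c" "u \<in> tangent_space A p"
    using q by (cases q) (auto simp: fst_tm_chart)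
  have "v = dir_deriv TA C (coords C v) q"
    using assms(2) TM.tangent_space_chart[OF C q] by blast
  then have "J1 A nab q v = J1 A nab q (dir_deriv TA C (coords C v) q)"
    by (rule arg_cong)
  then show ?thesis
    unfolding pu(1) J1_eq[OF aff pu(2,3)] J_coeff_def .
qed

text \<open>\<open>J_form\<close> feeds transformed fields into \<open>d\<omega>\<close>, whose
  coordinate expression is available for smooth fields; hence \<open>J1\<close> has to preserve
  smoothness.\<close>

private lemma J1_field:
  assumes X: "smooth_vfield TA U X"
  shows "smooth_vfield TA U (\<lambda>q. J1 A nab q (X q))"
    and "q \<in> U \<Longrightarrow> coords C (J1 A nab q (X q)) = J_coeff (coords C (X q))"
proof -
  have tan: "X q \<in> tangent_space TA q" if "q \<in> U" for q
    using X that by (simp add: smooth_vfield_def)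
  show "smooth_vfield TA U (\<lambda>q. J1 A nab q (X q))"
  proof (rule TM.smooth_vfieldI[OF C U])
    show "smooth_on (snd C ` U) (\<lambda>z. J_coeff (field_rep C X z))"
      by (rule smooth_on_linear[OF linear_conv_bounded_linear[THEN iffD1, OF linear_J_coeff] open_U
            TM.smooth_on_field_rep[OF C U X]])
    show "J1 A nab q (X q) = dir_deriv TA C (J_coeff (field_rep C X (snd C q))) q" if "q \<in> U" for q
    proof -
      have "q \<in> fst C"
        using that U by blast
      then show ?thesis
        using J1_rep[OF that tan[OF that]] TM.chart_inv_chart[OF C] by simp
    qed
  qed
  show "coords C (J1 A nab q (X q)) = J_coeff (coords C (X q))" if "q \<in> U"
    unfolding J1_rep[OF that tan[OF that]] by (rule TM.coords_dir_deriv[OF C]) (use U that in blast)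
qed

private lemma fundamental_form_rep:
  assumes X: "smooth_vfield TA U X" and Y: "smooth_vfield TA U Y" and q: "q \<in> U"
  shows "fundamental_form (J1 A nab) (g1 A nab g) [X, Y] q =
    met c (fst (snd C q)) (fst (coords C (X q))) (snd (coords C (Y q)))
    - met c (fst (snd C q)) (snd (coords C (X q))) (fst (coords C (Y q)))"
proof -
  have qC: "q \<in> fst C"
    using q U by blast
  obtain p u where pu: "q = (p, u)" "p \<in> fst c" "u \<in> tangent_space A p"
    using qC by (cases q) (auto simp: fst_tm_chart)
  have tan: "X q \<in> tangent_space TA q" "Y q \<in> tangent_space TA q"
    using X Y q by (auto simp: smooth_vfield_def)
  have Yq: "Y q = dir_deriv TA C (coords C (Y q)) q"
    using tan(2) TM.tangent_space_chart[OF C qC] by blast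
  have x: "fst (snd C q) = snd c p" "snd c p \<in> snd c ` fst c"
    using pu by (auto simp: snd_tm_chart)
  have "fundamental_form (J1 A nab) (g1 A nab g) [X, Y] q = g1 A nab g q (J1 A nab q (X q)) (Y q)"
    by (simp add: fundamental_form_def)
  also have "\<dots> = g1 A nab g q (dir_deriv TA C (J_coeff (coords C (X q))) q) (dir_deriv TA C (coords C (Y q)) q)"
    using J1_rep[OF q tan(1)] Yq by (metis (no_types))
  also have "\<dots> = met c (snd c p) (- snd (coords C (X q))) (fst (coords C (Y q)))
      + met c (snd c p) (fst (coords C (X q))) (snd (coords C (Y q)))"
    unfolding pu(1) g1_eq[OF aff pu(2,3)] met_def chart_inv_chart[OF c pu(2)] by (simp add: J_coeff_def)
  also have "\<dots> = met c (fst (snd C q)) (fst (coords C (X q))) (snd (coords C (Y q)))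
    - met c (fst (snd C q)) (snd (coords C (X q))) (fst (coords C (Y q)))"
    using linear_neg[OF met_linear_left[OF c x(2)]] x(1) by simp
  finally show ?thesis .
qed

private lemma d_omega_rep:
  assumes X: "smooth_vfield TA U X" and Y: "smooth_vfield TA U Y" and Z: "smooth_vfield TA U Z" and q: "q \<in> U"
  shows "ext_d TA (fundamental_form (J1 A nab) (g1 A nab g)) [X, Y, Z] q =
    d_omega_coeff (met1 c (fst (snd C q))) (coords C (X q)) (coords C (Y q)) (coords C (Z q))"
proof -
  let ?B = "\<lambda>z u v. met c (fst z) (fst u) (snd v) - met c (fst z) (snd u) (fst v)"
  let ?dB = "\<lambda>u v H. met1 c (fst (snd C q)) (fst H) (fst u) (snd v) - met1 c (fst (snd C q)) (fst H) (snd u) (fst v)"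
  have "ext_d TA (fundamental_form (J1 A nab) (g1 A nab g)) [X, Y, Z] q =
    ?dB (coords C (Y q)) (coords C (Z q)) (coords C (X q))
    - ?dB (coords C (X q)) (coords C (Z q)) (coords C (Y q))
    + ?dB (coords C (X q)) (coords C (Y q)) (coords C (Z q))"
  proof (rule TM.ext_d_2_form[where B = ?B, OF C U q _ _ _ _ _ X Y Z])
    show "fundamental_form (J1 A nab) (g1 A nab g) [X, Y] q = ?B (snd C q) (coords C (X q)) (coords C (Y q))"
      if "smooth_vfield TA U X" "smooth_vfield TA U Y" "q \<in> U" for X Y q
      by (rule fundamental_form_rep[OF that])
    show "linear (\<lambda>u. ?B z u v)" if "z \<in> snd C ` U" for z v
      by (rule linearI)
        (simp_all add: linear_add[OF met_linear_left[OF c base_image[OF that]]]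
          linear_scale[OF met_linear_left[OF c base_image[OF that]]] algebra_simps)
    show "?B z u v = - ?B z v u" if "z \<in> snd C ` U" for z u v
      using met_sym[OF c base_image[OF that], of "fst u" "snd v"] met_sym[OF c base_image[OF that], of "snd u" "fst v"]
      by simp
    show "smooth_on (snd C ` U) (\<lambda>z. ?B z u v)" for u v
      by (rule smooth_on_diff[OF open_U smooth_via_base[OF smooth_on_met[OF c]] smooth_via_base[OF smooth_on_met[OF c]]])
    show "((\<lambda>z. ?B z u v) has_derivative ?dB u v) (at (snd C q))" for u v
      by (intro has_derivative_diff derivative_via_base has_derivative_met[OF c base[OF q]])
  qed
  then show ?thesis
    by (simp add: d_omega_coeff_def)
qed

text \<open>The minus sign in \<open>Jd_omega_coeff\<close> is the factor \<open>(-1)^3\<close> of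
  \<open>J_form\<close>.\<close>

private lemma Jd_omega_rep:
  assumes X: "smooth_vfield TA U X" and Y: "smooth_vfield TA U Y" and Z: "smooth_vfield TA U Z" and q: "q \<in> U"
  shows "J_form (J1 A nab) (ext_d TA (fundamental_form (J1 A nab) (g1 A nab g))) [X, Y, Z] q =
    Jd_omega_coeff (met1 c (fst (snd C q))) (coords C (X q)) (coords C (Y q)) (coords C (Z q))"
  using d_omega_rep[OF J1_field(1)[OF X] J1_field(1)[OF Y] J1_field(1)[OF Z] q]
    J1_field(2)[OF X q] J1_field(2)[OF Y q] J1_field(2)[OF Z q]
  by (simp add: J_form_def Jd_omega_coeff_def)

text \<open>The coefficients of \<open>J d\<omega>\<close> are combinations of first metric
  derivatives with factors independent of the point, so differentiating them merely replaces
  \<open>met1\<close> by \<open>met2\<close>.\<close>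

lemma ddc_omega_rep:
  assumes X: "smooth_vfield (tm_atlas A) U X" and Y: "smooth_vfield (tm_atlas A) U Y"
    and Z: "smooth_vfield (tm_atlas A) U Z" and V: "smooth_vfield (tm_atlas A) U V" and q: "q \<in> U"
  defines "M \<equiv> met2 c (fst (snd (tm_chart A c) q))"
    and "x \<equiv> coords (tm_chart A c) (X q)" and "y \<equiv> coords (tm_chart A c) (Y q)"
    and "z \<equiv> coords (tm_chart A c) (Z q)" and "v \<equiv> coords (tm_chart A c) (V q)"
  shows "ext_d (tm_atlas A) (J_form (J1 A nab) (ext_d (tm_atlas A) (fundamental_form (J1 A nab) (g1 A nab g)))) [X, Y, Z, V] q =
    pluri_defect M (fst x) (fst y) (snd z) (snd v) - pluri_defect M (fst x) (fst z) (snd y) (snd v)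
      + pluri_defect M (fst x) (fst v) (snd y) (snd z) + pluri_defect M (fst y) (fst z) (snd x) (snd v)
      - pluri_defect M (fst y) (fst v) (snd x) (snd z) + pluri_defect M (fst z) (fst v) (snd x) (snd y)"
proof -
  let ?B = "\<lambda>z. Jd_omega_coeff (met1 c (fst z))"
  let ?dB = "\<lambda>u v w H. Jd_omega_coeff (M (fst H)) u v w"
  have "ext_d TA (J_form (J1 A nab) (ext_d TA (fundamental_form (J1 A nab) (g1 A nab g)))) [X, Y, Z, V] q =
    ?dB y z v x - ?dB x z v y + ?dB x y v z - ?dB x y z v"
    unfolding x_def y_def z_def v_def
  proof (rule TM.ext_d_3_form[where B = ?B, OF C U q _ _ _ _ _ _ X Y Z V])
    show "J_form (J1 A nab) (ext_d TA (fundamental_form (J1 A nab) (g1 A nab g))) [X, Y, Z] q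
        = ?B (snd C q) (coords C (X q)) (coords C (Y q)) (coords C (Z q))"
      if "smooth_vfield TA U X" "smooth_vfield TA U Y" "smooth_vfield TA U Z" "q \<in> U" for X Y Z q
      by (rule Jd_omega_rep[OF that])
    show "linear (\<lambda>u. ?B z u v w)" if "z \<in> snd C ` U" for z v w
      unfolding Jd_omega_coeff_def
      using linear_compose[OF linear_J_coeff d_omega_coeff_linear[OF met1_linear[OF c base_image[OF that]]]]
      by (intro linear_compose_neg) (simp add: o_def)
    show "?B z u v w = - ?B z v u w" if "z \<in> snd C ` U" for z u v w
      unfolding Jd_omega_coeff_def
      by (rule arg_cong[where f = uminus]) (rule d_omega_coeff_alternating(1)[OF met1_sym[OF c base_image[OF that]]])
    show "?B z u v w = - ?B z u w v" if "z \<in> snd C ` U" for z u v w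
      unfolding Jd_omega_coeff_def
      by (rule arg_cong[where f = uminus]) (rule d_omega_coeff_alternating(2)[OF met1_sym[OF c base_image[OF that]]])
    show "smooth_on (snd C ` U) (\<lambda>z. ?B z u v w)" for u v w
      unfolding Jd_omega_coeff_def d_omega_coeff_def
      by (intro smooth_on_linear[OF bounded_linear_minus[OF bounded_linear_ident] open_U] smooth_on_add[OF open_U]
          smooth_on_diff[OF open_U] smooth_via_base smooth_on_met1[OF c])
    show "((\<lambda>z. ?B z u v w) has_derivative ?dB u v w) (at (snd C q))" for u v w
      unfolding Jd_omega_coeff_def d_omega_coeff_def M_def
      by (intro has_derivative_minus has_derivative_add has_derivative_diff derivative_via_base has_derivative_met1[OF c base[OF q]])
  qed
  also have "\<dots> = pluri_defect M (fst x) (fst y) (snd z) (snd v) - pluri_defect M (fst x) (fst z) (snd y) (snd v)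
      + pluri_defect M (fst x) (fst v) (snd y) (snd z) + pluri_defect M (fst y) (fst z) (snd x) (snd v)
      - pluri_defect M (fst y) (fst v) (snd x) (snd z) + pluri_defect M (fst z) (fst v) (snd x) (snd y)"
    unfolding M_def
    by (rule ddc_omega_eq_pluri_defect[where M = "met2 c (fst (snd C q))", OF met2_sym[OF c base[OF q]] met2_neg[OF c base[OF q]]])
  finally show ?thesis .
qed

end

lemma met2_zero:
  assumes "c \<in> maximal_atlas A" "x \<in> snd c ` fst c"
  shows "met2 c x 0 h a b = 0" "met2 c x k 0 a b = 0" "met2 c x k h 0 b = 0" "met2 c x k h a 0 = 0"
  using linear_0[OF met2_linear(1)[OF assms]] linear_0[OF met2_linear(2)[OF assms]]
    linear_0[OF met2_linear(3)[OF assms]] linear_0[OF met2_linear(4)[OF assms]]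
  by auto

lemma pluriclosed_iff_pluri_defect:
  "pluriclosed (tm_atlas A) (J1 A nab) (g1 A nab g) \<longleftrightarrow>
    (\<forall>c. affine_coordinates A nab c \<longrightarrow>
      (\<forall>p\<in>fst c. \<forall>a a' b b'. pluri_defect (met2 c (snd c p)) a a' b b' = 0))"
proof (intro iffI allI impI ballI)
  fix c p a a' b b'
  assume plu: "pluriclosed (tm_atlas A) (J1 A nab) (g1 A nab g)" and aff: "affine_coordinates A nab c" and p: "p \<in> fst c"
  note c = affine_maximal[OF aff]
  note C = tm_chart_maximal[OF c]
  \<comment> \<open>The coefficients are constant along the fibre, so the zero vector over
    \<open>p\<close> is as good a point as any.\<close>
  let ?P = "(p, dir_deriv A c 0 p)" and ?D = "dir_deriv (tm_atlas A) (tm_chart A c)"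
  have P: "?P \<in> fst (tm_chart A c)"
    using p dir_deriv_in_tangent_space[OF c p] by (simp add: fst_tm_chart)
  note sm = TM.smooth_vfield_dir_deriv[OF C] and oC = TM.mopen_chart[OF C]
  have x: "snd c p \<in> snd c ` fst c"
    using p by simp
  \<comment> \<open>Two horizontal and two vertical fields with constant components: of the six
    defects only the one with base slots \<open>a, a'\<close> and fibre slots \<open>b, b'\<close>
    survives.\<close>
  let ?Xs = "[?D (a, 0), ?D (a', 0), ?D (0, b), ?D (0, b')]"
  have "ext_d (tm_atlas A) (J_form (J1 A nab) (ext_d (tm_atlas A) (fundamental_form (J1 A nab) (g1 A nab g)))) ?Xs ?P = 0"
    using plu oC P sm unfolding pluriclosed_def by simp
  then show "pluri_defect (met2 c (snd c p)) a a' b b' = 0"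
    unfolding ddc_omega_rep[OF aff oC order_refl sm sm sm sm P] TM.coords_dir_deriv[OF C P] snd_tm_chart fst_conv snd_conv
    by (simp add: pluri_defect_def met2_zero[OF c x])
next
  assume cond: "\<forall>c. affine_coordinates A nab c \<longrightarrow>
      (\<forall>p\<in>fst c. \<forall>a a' b b'. pluri_defect (met2 c (snd c p)) a a' b b' = 0)"
  show "pluriclosed (tm_atlas A) (J1 A nab) (g1 A nab g)"
    unfolding pluriclosed_def
  proof (intro allI impI ballI)
    fix U and Xs :: "('a \<times> 'a tvec) vfield list" and P
    assume U: "mopen (tm_atlas A) U" and len: "length Xs = 4"
      and Xs: "\<forall>X\<in>set Xs. smooth_vfield (tm_atlas A) U X" and P: "P \<in> U"
    obtain X Y Z V where XYZV: "Xs = [X, Y, Z, V]"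
      using len by (auto simp: length_Suc_conv eval_nat_numeral)
    obtain p u where pu: "P = (p, u)" "p \<in> points A" "u \<in> tangent_space A p"
      using U P by (cases P) (auto simp: mopen_def points_def tm_atlas_def fst_tm_chart subset_iff)
    \<comment> \<open>The coordinate condition can be used only in an affine chart around the base
      point of \<open>P\<close>; this is where flatness and vanishing torsion enter through the
      existence theorem.\<close>
    obtain c where aff: "affine_coordinates A nab c" and p: "p \<in> fst c"
      by (rule affine_coordinates_exist[OF pu(2)])
    note C = tm_chart_maximal[OF affine_maximal[OF aff]]
    \<comment> \<open>The value at \<open>P\<close> refers to the fields alone, so \<open>U\<close>
      may be cut down to the part over the chart.\<close>
    let ?W = "U \<inter> fst (tm_chart A c)"
    have W: "mopen (tm_atlas A) ?W" "?W \<subseteq> fst (tm_chart A c)"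
      using TM.mopen_Int[OF U TM.mopen_chart[OF C]] by auto
    have PW: "P \<in> ?W"
      using P pu p by (simp add: fst_tm_chart)
    have sm: "smooth_vfield (tm_atlas A) ?W X" "smooth_vfield (tm_atlas A) ?W Y"
      "smooth_vfield (tm_atlas A) ?W Z" "smooth_vfield (tm_atlas A) ?W V"
      using Xs XYZV by (auto intro: TM.smooth_vfield_mono)
    have "pluri_defect (met2 c (fst (snd (tm_chart A c) P))) a a' b b' = 0" for a a' b b'
      unfolding pu(1) snd_tm_chart fst_conv by (rule cond[rule_format, OF aff p])
    then show "ext_d (tm_atlas A) (J_form (J1 A nab) (ext_d (tm_atlas A) (fundamental_form (J1 A nab) (g1 A nab g)))) Xs P = 0"
      unfolding XYZV ddc_omega_rep[OF aff W sm PW] by simp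
  qed
qed

end

text \<open>Antisymmetry in each pair reduces coordinate vectors to \<open>i < j\<close> and
  \<open>k < h\<close>, equal indices giving zero; multilinearity passes from coordinate vectors to
  all vectors.\<close>

lemma pluri_defect_zero_iff:
  fixes M :: "(real, 'n::{finite,linorder}) vec \<Rightarrow> (real, 'n) vec \<Rightarrow> (real, 'n) vec \<Rightarrow> (real, 'n) vec \<Rightarrow> real"
  assumes lin: "\<And>h a b. linear (\<lambda>k. M k h a b)" "\<And>k a b. linear (\<lambda>h. M k h a b)"
    "\<And>k h b. linear (\<lambda>a. M k h a b)" "\<And>k h a. linear (\<lambda>b. M k h a b)"
  defines "D \<equiv> \<lambda>i j k l. M (axis i 1) (axis j 1) (axis k 1) (axis l 1)"
  shows "(\<forall>a a' b b'. pluri_defect M a a' b b' = 0) \<longleftrightarrow>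
    (\<forall>i j k h. i < j \<longrightarrow> k < h \<longrightarrow> D j h i k + D i k j h = D i h j k + D j k i h)"
proof
  assume *: "\<forall>a a' b b'. pluri_defect M a a' b b' = 0"
  show "\<forall>i j k h. i < j \<longrightarrow> k < h \<longrightarrow> D j h i k + D i k j h = D i h j k + D j k i h"
  proof (intro allI impI)
    fix i j k h
    show "D j h i k + D i k j h = D i h j k + D j k i h"
      using *[rule_format, of "axis i 1" "axis j 1" "axis k 1" "axis h 1"] by (simp add: pluri_defect_def D_def)
  qed
next
  assume *: "\<forall>i j k h. i < j \<longrightarrow> k < h \<longrightarrow> D j h i k + D i k j h = D i h j k + D j k i h"
  have lt: "pluri_defect M (axis i 1) (axis j 1) (axis k 1) (axis h 1) = 0" if "i < j" "k < h" for i j k h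
    using *[rule_format, OF that] by (simp add: pluri_defect_def D_def)
  have anti: "pluri_defect M a a' b b' = - pluri_defect M a' a b b'"
    "pluri_defect M a a' b b' = - pluri_defect M a a' b' b" for a a' b b'
    by (simp_all add: pluri_defect_def)
  have lt': "pluri_defect M (axis i 1) (axis j 1) (axis k 1) (axis h 1) = 0" if "i < j" for i j k h
    using lt[OF that] anti(2)[of "axis i 1" "axis j 1" "axis k 1" "axis h 1"]
      anti(2)[of "axis i 1" "axis j 1" "axis k 1" "axis k 1"]
    by (cases k h rule: linorder_cases) auto
  have axes: "pluri_defect M (axis i 1) (axis j 1) (axis k 1) (axis h 1) = 0" for i j k h
    using lt'[of i j] lt'[of j i] anti(1)[of "axis i 1" "axis j 1" "axis k 1" "axis h 1"]
      anti(1)[of "axis i 1" "axis i 1" "axis k 1" "axis h 1"]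
    by (cases i j rule: linorder_cases) auto
  have plin: "linear (\<lambda>a. pluri_defect M a a' b b')" "linear (\<lambda>a'. pluri_defect M a a' b b')"
    "linear (\<lambda>b. pluri_defect M a a' b b')" "linear (\<lambda>b'. pluri_defect M a a' b b')" for a a' b b'
    unfolding pluri_defect_def by (intro linear_compose_add linear_compose_sub lin)+
  show "\<forall>a a' b b'. pluri_defect M a a' b b' = 0"
  proof (intro allI)
    fix a a' b b'
    have "pluri_defect M (axis i 1) (axis j 1) (axis k 1) b' = 0" for i j k
      by (rule linear_vec_zero[OF plin(4) axes])
    then have "pluri_defect M (axis i 1) (axis j 1) b b' = 0" for i j
      by (rule linear_vec_zero[OF plin(3)])
    then have "pluri_defect M (axis i 1) a' b b' = 0" for i
      by (rule linear_vec_zero[OF plin(2)])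
    then show "pluri_defect M a a' b b' = 0"
      by (rule linear_vec_zero[OF plin(1)])
  qed
qed

text \<open>In dimension two this leaves one instance of the coordinate condition, with
  \<open>i\<close> and \<open>k\<close> the smaller and \<open>j\<close> and \<open>h\<close> the
  larger index.\<close>

lemma two_element_order:
  fixes i j e f :: "'n::{finite,linorder}"
  assumes "CARD('n) = 2" "e < f" "i < j"
  shows "i = e \<and> j = f"
proof -
  have "card {e, f} = CARD('n)"
    using assms by simp
  then have "{e, f} = UNIV"
    by (intro card_subset_eq) auto
  then have "i \<in> {e, f}" "j \<in> {e, f}"
    by auto
  then show ?thesis
    using assms(2,3) by auto
qed

theorem theorem6p4:
  fixes A :: "('a, real ^ ('n :: {finite, linorder})) chart set"
    and nab :: "'a conn"
    and g :: "'a metric_tensor"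
  assumes "affine_riemann A nab g"
  shows "(pluriclosed (tm_atlas A) (J1 A nab) (g1 A nab g) \<longleftrightarrow>
           (\<forall>c. affine_coordinates A nab c \<longrightarrow>
             (\<forall>p\<in>fst c. \<forall>i j k h. i < j \<longrightarrow> k < h \<longrightarrow>
                partial2 A c j h (metric_coeff A g c i k) p
                  + partial2 A c i k (metric_coeff A g c j h) p
                = partial2 A c i h (metric_coeff A g c j k) p
                  + partial2 A c j k (metric_coeff A g c i h) p)))
       \<and> (CARD('n) = 2 \<longrightarrow>
           (\<forall>c. affine_coordinates A nab c \<longrightarrow>
             (\<forall>p\<in>fst c. \<forall>e1 e2 :: 'n. e1 < e2 \<longrightarrow>
                ((\<forall>i j k h. i < j \<longrightarrow> k < h \<longrightarrow>
                    partial2 A c j h (metric_coeff A g c i k) p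
                      + partial2 A c i k (metric_coeff A g c j h) p
                    = partial2 A c i h (metric_coeff A g c j k) p
                      + partial2 A c j k (metric_coeff A g c i h) p)
                 \<longleftrightarrow>
                 partial2 A c e2 e2 (metric_coeff A g c e1 e1) p
                   + partial2 A c e1 e1 (metric_coeff A g c e2 e2) p
                 = 2 * partial2 A c e1 e2 (metric_coeff A g c e1 e2) p))))"
proof -
  interpret affine_riemann_manifold A nab g
    using assms by unfold_locales (auto simp: affine_riemann_def smooth_manifold_def)
  have x: "snd c p \<in> snd c ` fst c" if "p \<in> fst c" for c :: "('a, (real, 'n) vec) chart" and p
    using that by simp
  have iff: "(\<forall>a a' b b'. pluri_defect (met2 c (snd c p)) a a' b b' = 0) \<longleftrightarrow>
      (\<forall>i j k h. i < j \<longrightarrow> k < h \<longrightarrow>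
                partial2 A c j h (metric_coeff A g c i k) p
                  + partial2 A c i k (metric_coeff A g c j h) p
                = partial2 A c i h (metric_coeff A g c j k) p
                  + partial2 A c j k (metric_coeff A g c i h) p)"
    if "affine_coordinates A nab c" "p \<in> fst c" for c p
  proof -
    note c = affine_maximal[OF that(1)]
    show ?thesis
      unfolding partial2_metric_coeff[OF c that(2)]
      by (rule pluri_defect_zero_iff[OF met2_linear[OF c x[OF that(2)]]])
  qed
  have two: "(\<forall>i j k h. i < j \<longrightarrow> k < h \<longrightarrow>
                    partial2 A c j h (metric_coeff A g c i k) p
                      + partial2 A c i k (metric_coeff A g c j h) p
                    = partial2 A c i h (metric_coeff A g c j k) p
                      + partial2 A c j k (metric_coeff A g c i h) p)
                 \<longleftrightarrow>
                 partial2 A c e2 e2 (metric_coeff A g c e1 e1) p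
                   + partial2 A c e1 e1 (metric_coeff A g c e2 e2) p
                 = 2 * partial2 A c e1 e2 (metric_coeff A g c e1 e2) p"
    if card: "CARD('n) = 2" and aff: "affine_coordinates A nab c" and p: "p \<in> fst c" and e: "e1 < e2"
    for c p and e1 e2 :: 'n
  proof -
    note c = affine_maximal[OF aff]
    note part = partial2_metric_coeff[OF c p] and sym = met2_sym[OF c x[OF p]]
    \<comment> \<open>The two mixed terms of the single remaining instance coincide, by symmetry of
      the metric and of second derivatives; hence the factor \<open>2\<close>.\<close>
    have "partial2 A c e1 e2 (metric_coeff A g c e2 e1) p = partial2 A c e1 e2 (metric_coeff A g c e1 e2) p"
      "partial2 A c e2 e1 (metric_coeff A g c e1 e2) p = partial2 A c e1 e2 (metric_coeff A g c e1 e2) p"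
      unfolding part by (rule sym)+
    then show ?thesis
      using e two_element_order[OF card e] by (metis (no_types, lifting) mult_2)
  qed
  show ?thesis
    using pluriclosed_iff_pluri_defect iff two by (metis (no_types, lifting))
qed

end
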